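(* Let $N\in\mathbb N$, $\alpha\in(0,N)$ and $p\ge1$ be such that $$\frac1p>\frac12-\frac1\alpha.$$ Assume that $(u_n)_{n\in\mathbb N}$ is a sequence of measurable functions from $\mathbb R^N$ to $\mathbb R$ that converges to $u:\mathbb R^N\to\mathbb R$ almost everywhere. If the sequence $(I_{\alpha/2}*|u_n|^p)_{n\in\mathbb N}$ is bounded in $L^2(\mathbb R^N)$ and if the sequence $(Du_n)_{n\in\mathbb N}$ of weak gradients is bounded in $L^2(\mathbb R^N)$, then $$\lim_{n\to\infty}\int_{\mathbb R^N}\Bigl|\,\bigl|I_{\alpha/2}*|u_n|^p\bigr|^2-\bigl|I_{\alpha/2}*|u_n-u|^p\bigr|^2\Bigr|=\int_{\mathbb R^N}\bigl|I_{\alpha/2}*|u|^p\bigr|^2.$$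
   Context: $\mathbb N$ denotes the positive integers. For $\alpha\in(0,N)$ the Riesz potential is $I_\alpha(x)=A_\alpha|x|^{-(N-\alpha)}$ for $x\in\mathbb R^N\setminus\{0\}$, with $A_\alpha=\frac{\Gamma((N-\alpha)/2)}{\Gamma(\alpha/2)\pi^{N/2}2^\alpha}$. The functions $u_n$ are understood to be weakly differentiable, so that $Du_n$ makes sense. *)

theory Defs
  imports "HOL-Analysis.Analysis"
begin

text \<open>
  The space \<open>\<real>\<^sup>N\<close> is \<^typ>\<open>real ^ 'n\<close> with \<open>N = CARD('n)\<close>.  At the origin the formula below
  yields \<open>0\<close>, by the convention \<open>x / 0 = 0\<close>; the origin is a null set, so no integral sees it.
\<close>

definition riesz_kernel :: "real \<Rightarrow> real ^ 'n \<Rightarrow> real" where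
  "riesz_kernel \<alpha> x =
     Gamma ((real CARD('n) - \<alpha>) / 2)
       / (Gamma (\<alpha> / 2) * pi powr (real CARD('n) / 2) * 2 powr \<alpha>)
     / norm x powr (real CARD('n) - \<alpha>)"

text \<open>
  \<open>I\<^sub>\<alpha> * f\<close> for \<open>f \<ge> 0\<close>, as a \<open>[0,\<infinity>]\<close>-valued function; a divergent integral has the value
  \<open>\<infinity>\<close>.  Not meaningful for \<open>f\<close> of varying sign, since \<^const>\<open>ennreal\<close> truncates.
\<close>

definition riesz_potential :: "real \<Rightarrow> (real ^ 'n \<Rightarrow> real) \<Rightarrow> real ^ 'n \<Rightarrow> ennreal" where
  "riesz_potential \<alpha> f x = (\<integral>\<^sup>+ y. ennreal (riesz_kernel \<alpha> (x - y) * f y) \<partial>lebesgue)"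

definition bounded_in_L2 :: "(nat \<Rightarrow> real ^ 'n \<Rightarrow> ennreal) \<Rightarrow> bool" where
  "bounded_in_L2 F \<longleftrightarrow>
     (\<forall>n. F n \<in> borel_measurable lebesgue) \<and>
     (\<exists>C::real. \<forall>n. (\<integral>\<^sup>+ x. (F n x)\<^sup>2 \<partial>lebesgue) \<le> ennreal C)"

text \<open>
  The distance \<open>\<bar>a - b\<bar>\<close> on \<open>[0,\<infinity>]\<close>: subtraction on \<^typ>\<open>ennreal\<close> is truncated, so at most one
  of the summands is nonzero when \<open>a\<close> and \<open>b\<close> are finite.  Moreover \<open>\<bar>\<infinity> - \<infinity>\<bar> = \<infinity>\<close>, so a
  finite integral of this expression shows that both functions are finite almost everywhere.
\<close>

definition ennreal_absdiff :: "ennreal \<Rightarrow> ennreal \<Rightarrow> ennreal" where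
  "ennreal_absdiff a b = (a - b) + (b - a)"

lemma ennreal_absdiff_ennreal:
  "0 \<le> a \<Longrightarrow> 0 \<le> b \<Longrightarrow> ennreal_absdiff (ennreal a) (ennreal b) = ennreal \<bar>a - b\<bar>"
  by (cases "a \<le> b") (simp_all add: ennreal_absdiff_def ennreal_minus ennreal_neg)

definition partial_deriv :: "'n \<Rightarrow> (real ^ 'n \<Rightarrow> real) \<Rightarrow> real ^ 'n \<Rightarrow> real" where
  "partial_deriv i \<phi> x = frechet_derivative \<phi> (at x) (axis i 1)"

primrec C_k :: "nat \<Rightarrow> (real ^ 'n \<Rightarrow> real) \<Rightarrow> bool" where
  "C_k 0 \<phi> \<longleftrightarrow> continuous_on UNIV \<phi>"
| "C_k (Suc k) \<phi> \<longleftrightarrow> (\<forall>x. \<phi> differentiable (at x)) \<and> (\<forall>i. C_k k (partial_deriv i \<phi>))"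

definition test_function :: "(real ^ 'n \<Rightarrow> real) \<Rightarrow> bool" where
  "test_function \<phi> \<longleftrightarrow> (\<forall>k. C_k k \<phi>) \<and> compact (closure {x. \<phi> x \<noteq> 0})"

definition locally_integrable :: "(real ^ 'n \<Rightarrow> 'b::euclidean_space) \<Rightarrow> bool" where
  "locally_integrable f \<longleftrightarrow> (\<forall>K. compact K \<longrightarrow> set_integrable lebesgue K f)"

definition weak_gradient :: "(real ^ 'n \<Rightarrow> real) \<Rightarrow> (real ^ 'n \<Rightarrow> real ^ 'n) \<Rightarrow> bool" where
  "weak_gradient v G \<longleftrightarrow>
     locally_integrable v \<and> locally_integrable G \<and>
     (\<forall>\<phi> i. test_function \<phi> \<longrightarrow>
        (\<integral> x. v x * partial_deriv i \<phi> x \<partial>lebesgue) = - (\<integral> x. G x $ i * \<phi> x \<partial>lebesgue))"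

end

theory Submission
  imports Defs "HOL-Computational_Algebra.Polynomial"
begin

text \<open>
  Put \<open>\<beta> = \<alpha> / 2\<close>, \<open>v\<^sub>n = \<bar>u\<^sub>n - u\<bar>\<^sup>p\<close>, and let \<open>F\<^sub>n\<close>, \<open>G\<^sub>n\<close>, \<open>F\<close> be the Riesz potentials of order \<open>\<beta>\<close>
  of \<open>\<bar>u\<^sub>n\<bar>\<^sup>p\<close>, \<open>v\<^sub>n\<close> and \<open>\<bar>u\<bar>\<^sup>p\<close>.  By Fatou, \<open>F\<close> is in \<open>L\<^sup>2\<close>, hence \<open>G\<^sub>n\<close> is bounded in \<open>L\<^sup>2\<close>.

  The elementary inequality \<open>\<bar>\<bar>u\<^sub>n\<bar>\<^sup>p - v\<^sub>n - \<bar>u\<bar>\<^sup>p\<bar> \<le> \<epsilon> v\<^sub>n + C\<^sub>\<epsilon> \<bar>u\<bar>\<^sup>p\<close> splits the defect on the left into a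
  part dominated by \<open>\<bar>u\<bar>\<^sup>p\<close>, whose potential tends to \<open>0\<close> in \<open>L\<^sup>2\<close> by dominated convergence, and a
  part with potential at most \<open>\<epsilon> G\<^sub>n\<close>.  So \<open>F\<^sub>n = G\<^sub>n + F + o(1)\<close> in \<open>L\<^sup>2\<close>
  (\<open>nn_integral_square_riesz_potential_defect_tendsto_zero\<close>), that is
  \<open>F\<^sub>n\<^sup>2 - G\<^sub>n\<^sup>2 = F\<^sup>2 + 2 F G\<^sub>n + o(1)\<close> in \<open>L\<^sup>1\<close>, and everything reduces to \<open>\<integral> F G\<^sub>n \<rightarrow> 0\<close>.

  As \<open>G\<^sub>n\<close> is bounded in \<open>L\<^sup>2\<close>, it suffices that \<open>G\<^sub>n \<rightarrow> 0\<close> in \<open>L\<^sup>1\<close> on every ball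
  (\<open>nn_integral_mult_tendsto_zero\<close>).  On a fixed ball, the part of \<open>v\<^sub>n\<close> outside a large ball
  contributes little, uniformly in \<open>n\<close>: the values of its potential at any two points of a ball of
  comparable radius agree up to a constant factor, and such a function with bounded \<open>L\<^sup>2\<close> norm on a
  large ball is small.  Hence it suffices
  that \<open>v\<^sub>n \<rightarrow> 0\<close> in \<open>L\<^sup>1\<close> on every ball (\<open>riesz_potential_tendsto_zero_L1_loc\<close>).

  Almost everywhere convergence alone does not exclude that \<open>v\<^sub>n\<close> concentrates its mass on sets of
  vanishing measure.  Here the gradients enter, through the weak form
  \<open>\<bar>{\<bar>u\<^sub>n\<bar> > t}\<bar> \<le> K t\<^sup>-\<^sup>q\<close>, \<open>q = 2 (p + \<beta>) / (1 + \<beta>)\<close>, of the Coulomb-Sobolev inequality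
  (\<open>emeasure_superlevel_le_powr\<close>).  If \<open>\<bar>u(x)\<bar> > 2 s\<close>, then for each \<open>h\<close> either \<open>\<bar>u(x + h)\<bar> > s\<close> or
  \<open>\<bar>u(x + h) - u(x)\<bar> > s\<close>.  Averaged over \<open>\<bar>h\<bar> < \<rho>\<close>, the first alternative is controlled by the
  potential of \<open>\<bar>u\<bar>\<^sup>p\<close>, the second by the bound \<open>\<parallel>u(\<cdot> + h) - u\<parallel>\<^sub>2 \<le> \<bar>h\<bar> \<parallel>Du\<parallel>\<^sub>2\<close>; the best \<open>\<rho>\<close> gives
  the exponent \<open>q\<close>.  The hypothesis \<open>1/p > 1/2 - 1/\<alpha>\<close> says exactly that \<open>q > p\<close>, so the functions
  \<open>\<bar>u\<^sub>n\<bar>\<^sup>p\<close> are uniformly integrable and \<open>v\<^sub>n \<rightarrow> 0\<close> in \<open>L\<^sup>1\<close> on balls.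

  The translation bound (\<open>nn_integral_translation_difference_le\<close>) is read off from the weak gradient
  by duality, which requires test functions approximating any bounded measurable function of bounded
  support (\<open>test_functions_dense\<close>).
\<close>

section \<open>Test functions\<close>

text \<open>
  The polynomial and the power in front of the exponential make this family closed under
  differentiation and under multiplication by polynomials.
\<close>

definition bump :: "real \<Rightarrow> real poly \<Rightarrow> nat \<Rightarrow> real \<Rightarrow> real" where
  "bump L P m t = (if \<bar>t\<bar> < L then poly P t / (L\<^sup>2 - t\<^sup>2) ^ m * exp (- (1 / (L\<^sup>2 - t\<^sup>2))) else 0)"

definition bump_deriv_poly :: "real \<Rightarrow> real poly \<Rightarrow> nat \<Rightarrow> real poly" where
  "bump_deriv_poly L P m =
     pderiv P * [:L\<^sup>2, 0, -1:]\<^sup>2 + [:0, 2 * of_nat m:] * P * [:L\<^sup>2, 0, -1:] - [:0, 2:] * P"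

lemma square_diff_pos: "\<bar>t\<bar> < L \<Longrightarrow> L\<^sup>2 - t\<^sup>2 > (0 :: real)"
  using power_strict_mono[of "\<bar>t\<bar>" L 2] by simp

lemma has_real_derivative_zero_if_quadratic:
  fixes f :: "real \<Rightarrow> real"
  assumes "f t = 0" and "\<And>s. \<bar>f s\<bar> \<le> C * (s - t)\<^sup>2"
  shows "(f has_real_derivative 0) (at t)"
proof -
  have C: "C \<ge> 0" using assms(2)[of "t+1"] by (auto intro: order_trans[OF abs_ge_zero])
  have "((\<lambda>s. (f s - f t) / (s - t)) \<longlongrightarrow> 0) (at t)"
  proof (rule Lim_null_comparison)
    show "\<forall>\<^sub>F s in at t. norm ((f s - f t) / (s - t)) \<le> C * \<bar>s - t\<bar>"
    proof (rule always_eventually, rule allI)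
      fix s
      have "\<bar>f s\<bar> \<le> (C * \<bar>s - t\<bar>) * \<bar>s - t\<bar>"
        using assms(2)[of s] by (simp add: power2_eq_square mult.assoc)
      then show "norm ((f s - f t) / (s - t)) \<le> C * \<bar>s - t\<bar>"
        using C assms(1) by (cases "s = t") (auto simp: divide_le_eq abs_divide)
    qed
    show "((\<lambda>s. C * \<bar>s - t\<bar>) \<longlongrightarrow> 0) (at t)"
      by (auto intro!: tendsto_eq_intros)
  qed
  then show ?thesis by (simp add: has_field_derivative_iff)
qed

text \<open>
  The exponential beats every power of \<open>1 / (L\<^sup>2 - s\<^sup>2)\<close>, so a bump is \<open>O((L\<^sup>2 - s\<^sup>2)\<^sup>2)\<close>.  This
  makes it differentiable with derivative \<open>0\<close> at the end points \<open>\<plusminus>L\<close>.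
\<close>

lemma abs_bump_le:
  assumes "L > 0" "\<bar>t\<bar> = L"
  obtains C where "\<And>s. \<bar>bump L P m s\<bar> \<le> C * (s - t)\<^sup>2"
proof -
  have "compact (poly P ` {-L..L})"
    by (intro compact_continuous_image continuous_intros) auto
  then have "bounded (poly P ` {-L..L})" by (rule compact_imp_bounded)
  then obtain B where B: "\<And>s. s \<in> {-L..L} \<Longrightarrow> \<bar>poly P s\<bar> \<le> B"
    unfolding bounded_iff by (metis image_eqI real_norm_def)
  have B0: "B \<ge> 0" using B[of 0] assms by (auto intro: order_trans[OF abs_ge_zero])
  have "\<bar>bump L P m s\<bar> \<le> (B * fact (m + 2) * (2 * L)\<^sup>2) * (s - t)\<^sup>2" for s
  proof (cases "\<bar>s\<bar> < L")
    case False
    then show ?thesis using B0 by (auto simp: bump_def)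
  next
    case True
    define d where "d = L\<^sup>2 - s\<^sup>2"
    have d: "d > 0" unfolding d_def by (rule square_diff_pos[OF True])
    have dle: "d \<le> 2 * L * \<bar>s - t\<bar>"
    proof -
      have "d = (t - s) * (t + s)" unfolding d_def using assms(2)
        by (metis power2_abs square_diff_square_factored power2_eq_square mult.commute)
      also have "\<dots> \<le> \<bar>t - s\<bar> * \<bar>t + s\<bar>" by (metis abs_ge_self abs_mult)
      also have "\<dots> \<le> \<bar>t - s\<bar> * (2 * L)" using True assms by (intro mult_left_mono) auto
      finally show ?thesis by (simp add: abs_minus_commute mult.commute)
    qed
    define c where "c = (fact (m + 2) :: real)"
    have c: "c > 0" by (simp add: c_def)
    (* a single term of the exponential series *)
    have "(1/d)^(m+2) / c \<le> exp (1/d)"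
    proof -
      have "(1/d)^(m+2) /\<^sub>R fact (m+2) \<le> (\<Sum>n. (1/d)^n /\<^sub>R fact n)"
        unfolding c_def
        using sum_le_suminf[OF summable_exp_generic[of "1/d"], of "{m+2}"] d by simp
      then show ?thesis unfolding c_def exp_def by (simp only: divide_inverse mult.commute real_scaleR_def)
    qed
    then have "1 / d^m * exp (- (1/d)) \<le> c * d\<^sup>2"
      using d c by (simp add: exp_minus field_simps power_add power2_eq_square)
    from mult_mono[OF B[of s] this] have "\<bar>poly P s\<bar> * (1 / d^m * exp (- (1/d))) \<le> B * (c * d\<^sup>2)"
      using True B0 d by (simp add: abs_less_iff)
    then have "\<bar>bump L P m s\<bar> \<le> B * (c * d\<^sup>2)"
      using True d by (simp add: bump_def d_def[symmetric] abs_mult abs_divide)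
    also have "\<dots> \<le> B * (c * (2 * L * \<bar>s - t\<bar>)\<^sup>2)"
      using dle d B0 c by (intro mult_left_mono power_mono) auto
    finally show ?thesis unfolding c_def by (simp only: power_mult_distrib mult.assoc power2_abs)
  qed
  then show ?thesis using that by blast
qed

lemma bump_has_derivative:
  assumes L: "L > 0"
  shows "(bump L P m has_real_derivative bump L (bump_deriv_poly L P m) (m + 2) t) (at t)"
proof -
  consider "\<bar>t\<bar> < L" | "\<bar>t\<bar> = L" | "\<bar>t\<bar> > L" by linarith
  then show ?thesis
  proof cases
    case 1
    have d: "L\<^sup>2 - t\<^sup>2 > 0" by (rule square_diff_pos[OF 1])
    show ?thesis
    proof (rule has_field_derivative_transform_within_open[of "\<lambda>t. poly P t * inverse (L\<^sup>2 - t\<^sup>2) ^ m * exp (- inverse (L\<^sup>2 - t\<^sup>2))" _ _ "{-L<..<L}"])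
      define D where "D = L\<^sup>2 - t\<^sup>2"
      have D: "D > 0" using d by (simp add: D_def)
      have "((\<lambda>t. inverse (L\<^sup>2 - t\<^sup>2)) has_real_derivative 2 * t / D\<^sup>2) (at t)"
        using d by (auto intro!: derivative_eq_intros simp: D_def power2_eq_square field_simps)
      from DERIV_mult[OF DERIV_mult[OF poly_DERIV[of P] DERIV_power[OF this, of m]] DERIV_chain2[OF DERIV_exp DERIV_minus[OF this]]]
      have der: "((\<lambda>t. poly P t * inverse (L\<^sup>2 - t\<^sup>2) ^ m * exp (- inverse (L\<^sup>2 - t\<^sup>2))) has_real_derivative
          (poly (pderiv P) t * inverse D ^ m + real m * (2 * t / D\<^sup>2 * inverse D ^ (m - Suc 0)) * poly P t) * exp (- inverse D)
          + exp (- inverse D) * - (2 * t / D\<^sup>2) * (poly P t * inverse D ^ m)) (at t)"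
        by (simp add: D_def)
      have m: "real m * (2 * t / D\<^sup>2 * inverse D ^ (m - Suc 0)) = real m * 2 * t * D / (D ^ (m + 2))"
        using D by (cases m) (auto simp: field_simps power2_eq_square)
      have q: "poly (bump_deriv_poly L P m) t = poly (pderiv P) t * D\<^sup>2 + 2 * real m * t * poly P t * D - 2 * t * poly P t"
        unfolding bump_deriv_poly_def D_def by (simp add: power2_eq_square algebra_simps)
      have "(poly (pderiv P) t * inverse D ^ m + real m * (2 * t / D\<^sup>2 * inverse D ^ (m - Suc 0)) * poly P t) * exp (- inverse D)
          + exp (- inverse D) * - (2 * t / D\<^sup>2) * (poly P t * inverse D ^ m)
        = bump L (bump_deriv_poly L P m) (m + 2) t"
        unfolding m bump_def q D_def[symmetric] using 1 D
        by (simp add: field_simps power_add power2_eq_square power4_eq_xxxx)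
      with der show "((\<lambda>t. poly P t * inverse (L\<^sup>2 - t\<^sup>2) ^ m * exp (- inverse (L\<^sup>2 - t\<^sup>2))) has_real_derivative
         bump L (bump_deriv_poly L P m) (m + 2) t) (at t)"
        by simp
    qed (use 1 in \<open>auto simp: bump_def divide_inverse power_inverse\<close>)
  next
    case 2
    from abs_bump_le[OF L this] obtain C where "\<And>s. \<bar>bump L P m s\<bar> \<le> C * (s - t)\<^sup>2" by blast
    moreover have "bump L P m t = 0" "bump L (bump_deriv_poly L P m) (m + 2) t = 0"
      using 2 by (auto simp: bump_def)
    ultimately show ?thesis
      using has_real_derivative_zero_if_quadratic[of "bump L P m" t C] by simp
  next
    case 3
    have "((\<lambda>_. 0) has_real_derivative 0) (at t)" by simp
    then have "(bump L P m has_real_derivative 0) (at t)"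
      by (rule has_field_derivative_transform_within_open[of _ _ _ "{s. L < \<bar>s\<bar>}"])
         (use 3 in \<open>auto simp: bump_def intro!: open_Collect_less continuous_intros\<close>)
    then show ?thesis using 3 by (simp add: bump_def)
  qed
qed

text \<open>
  Sums of products of one-dimensional bumps, one factor for each coordinate.  A partial derivative
  only replaces one factor of a product by another bump, so that smoothness of all orders follows
  from one closure property.
\<close>

inductive bump_sum :: "real \<Rightarrow> (real ^ 'n \<Rightarrow> real) \<Rightarrow> bool" for L where
  prod: "bump_sum L (\<lambda>x. \<Prod>i\<in>UNIV. bump L (P i) (m i) (x $ i))"
| add: "bump_sum L f \<Longrightarrow> bump_sum L g \<Longrightarrow> bump_sum L (\<lambda>x. f x + g x)"

lemma bump_sum_zero: "bump_sum L (\<lambda>x. 0)"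
proof -
  have "bump L 0 0 = (\<lambda>t. 0)" by (auto simp: bump_def)
  then show ?thesis using bump_sum.prod[of L "\<lambda>_. 0" "\<lambda>_. 0"] by (simp add: power_0_left)
qed

lemma bump_sum_sum: "finite A \<Longrightarrow> (\<And>i. i \<in> A \<Longrightarrow> bump_sum L (f i)) \<Longrightarrow> bump_sum L (\<lambda>x. \<Sum>i\<in>A. f i x)"
  by (induction rule: finite_induct) (auto intro: bump_sum_zero bump_sum.add)

lemma prod_bump_fun_upd:
  fixes x :: "real ^ 'n"
  shows "(\<Prod>i\<in>UNIV. bump L ((P(k := a)) i) ((m(k := b)) i) (x $ i))
    = bump L a b (x $ k) * (\<Prod>i\<in>UNIV - {k}. bump L (P i) (m i) (x $ i))"
  by (subst prod.remove[of UNIV k]) (auto intro!: prod.cong)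

lemma poly_times_bump: "poly Q t * bump L P m t = bump L (Q * P) m t"
  by (simp add: bump_def)

lemma bump_sum_times_affine:
  fixes f :: "real ^ 'n \<Rightarrow> real"
  assumes "bump_sum L f"
  shows "bump_sum L (\<lambda>x. (c + d * x $ k) * f x)"
  using assms
proof induction
  case (prod P m)
  have "(c + d * x $ k) * (\<Prod>i\<in>UNIV. bump L (P i) (m i) (x $ i))
     = (\<Prod>i\<in>UNIV. bump L ((P(k := [:c, d:] * P k)) i) ((m(k := m k)) i) (x $ i))" for x :: "real ^ 'n"
    unfolding prod_bump_fun_upd poly_times_bump[symmetric]
    by (subst prod.remove[of UNIV k]) (simp_all add: mult.assoc mult.commute)
  then show ?case by (simp only: bump_sum.prod)
next
  case (add f g)
  show ?case unfolding distrib_left by (rule bump_sum.add[OF add.IH])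
qed

lemma linear_eq_sum_axis:
  fixes q :: "real ^ 'n \<Rightarrow> real"
  assumes "linear q"
  shows "q x = (\<Sum>i\<in>UNIV. q (axis i 1) * x $ i)"
proof -
  have "q x = q (\<Sum>i\<in>UNIV. x $ i *\<^sub>R axis i 1)"
    using basis_expansion[of x] by (simp add: scalar_mult_eq_scaleR)
  also have "\<dots> = (\<Sum>i\<in>UNIV. q (axis i 1) * x $ i)"
    using assms by (simp add: linear_sum linear_scale mult.commute)
  finally show ?thesis .
qed

lemma bump_sum_times_poly:
  fixes f :: "real ^ 'n \<Rightarrow> real"
  assumes "real_polynomial_function q" "bump_sum L f"
  shows "bump_sum L (\<lambda>x. q x * f x)"
  using assms
proof (induction arbitrary: f rule: real_polynomial_function.induct)
  case (linear q)
  have "q x * f x = (\<Sum>i\<in>UNIV. (0 + q (axis i 1) * x $ i) * f x)" for x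
    using linear_eq_sum_axis[OF bounded_linear.linear[OF linear(1)], of x]
    by (simp add: sum_distrib_right)
  then show ?case
    by (simp only:) (intro bump_sum_sum bump_sum_times_affine linear finite)
next
  case (const k)
  then show ?case using bump_sum_times_affine[of L f k 0] by simp
next
  case (add p q)
  then show ?case unfolding distrib_right by (intro bump_sum.add) auto
next
  case (mult p q)
  then show ?case by (simp add: mult.assoc)
qed

lemma bump_sum_deriv:
  fixes f :: "real ^ 'n \<Rightarrow> real"
  assumes L: "L > 0" and f: "bump_sum L f"
  shows "(\<forall>x. f differentiable (at x)) \<and> bump_sum L (partial_deriv k f)"
  using f
proof induction
  case (prod P m)
  let ?f = "\<lambda>x::real^'n. \<Prod>i\<in>UNIV. bump L (P i) (m i) (x $ i)"
  let ?d = "\<lambda>x i. bump L (bump_deriv_poly L (P i) (m i)) (m i + 2) (x $ i)"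
  have der: "(?f has_derivative (\<lambda>y. \<Sum>i\<in>UNIV. (?d x i * y $ i) * (\<Prod>j\<in>UNIV - {i}. bump L (P j) (m j) (x $ j)))) (at x)" for x
  proof (rule has_derivative_prod)
    fix i
    have "((\<lambda>x::real^'n. x $ i) has_derivative (\<lambda>y. y $ i)) (at x)"
      by (rule bounded_linear_imp_has_derivative) (rule bounded_linear_vec_nth)
    from has_derivative_compose[OF this bump_has_derivative[OF L, THEN has_field_derivative_imp_has_derivative]]
    show "((\<lambda>x. bump L (P i) (m i) (x $ i)) has_derivative (\<lambda>y. ?d x i * y $ i)) (at x)" .
  qed
  have "partial_deriv k ?f x = (\<Sum>i\<in>UNIV. (?d x i * axis k 1 $ i) * (\<Prod>j\<in>UNIV - {i}. bump L (P j) (m j) (x $ j)))" for x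
    unfolding partial_deriv_def frechet_derivative_at[OF der, symmetric] by simp
  also have "\<dots> x = ?d x k * (\<Prod>j\<in>UNIV - {k}. bump L (P j) (m j) (x $ j))" for x
    by (subst sum.remove[of UNIV k]) (auto simp: axis_def intro!: sum.neutral)
  also have "\<dots> x = (\<Prod>i\<in>UNIV. bump L ((P(k := bump_deriv_poly L (P k) (m k))) i) ((m(k := m k + 2)) i) (x $ i))" for x
    unfolding prod_bump_fun_upd ..
  finally have "partial_deriv k ?f = (\<lambda>x. \<Prod>i\<in>UNIV. bump L ((P(k := bump_deriv_poly L (P k) (m k))) i) ((m(k := m k + 2)) i) (x $ i))"
    by (rule ext)
  moreover have "?f differentiable (at x)" for x using der by (auto simp: differentiable_def)
  ultimately show ?case by (simp only: bump_sum.prod simp_thms)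
next
  case (add f g)
  have "partial_deriv k (\<lambda>x. f x + g x) = (\<lambda>x. partial_deriv k f x + partial_deriv k g x)"
  proof
    fix x
    have "(f has_derivative frechet_derivative f (at x)) (at x)" "(g has_derivative frechet_derivative g (at x)) (at x)"
      using add.IH by (simp_all add: frechet_derivative_works)
    from frechet_derivative_at[OF has_derivative_add[OF this]]
    show "partial_deriv k (\<lambda>x. f x + g x) x = partial_deriv k f x + partial_deriv k g x"
      unfolding partial_deriv_def by (metis (no_types))
  qed
  then show ?case using add.IH by (auto intro!: bump_sum.add)
qed

lemma bump_sum_eq_0:
  assumes "bump_sum L f" "\<bar>x $ i\<bar> \<ge> L"
  shows "f x = 0"
  using assms
proof induction
  case (prod P m)
  then have "bump L (P i) (m i) (x $ i) = 0" by (auto simp: bump_def)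
  then show ?case by (auto intro!: prod_zero)
qed simp

lemma test_function_bump_sum:
  fixes f :: "real ^ 'n \<Rightarrow> real"
  assumes L: "L > 0" and f: "bump_sum L f"
  shows "test_function f"
  unfolding test_function_def
proof
  have "C_k k f" if "bump_sum L f" for k and f :: "real ^ 'n \<Rightarrow> real"
    using that
  proof (induction k arbitrary: f)
    case 0
    then show ?case
      using bump_sum_deriv[OF L 0] by (auto simp: continuous_on_eq_continuous_within differentiable_imp_continuous_within)
  next
    case (Suc k)
    then show ?case using bump_sum_deriv[OF L Suc(2)] by simp
  qed
  then show "\<forall>k. C_k k f" using f by blast
  have "{x. f x \<noteq> 0} \<subseteq> cbox (\<chi> i. -L) (\<chi> i. L)"
  proof
    fix x assume "x \<in> {x. f x \<noteq> 0}"
    then have "\<bar>x $ i\<bar> \<le> L" for i using bump_sum_eq_0[OF f, of x i] by force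
    then show "x \<in> cbox (\<chi> i. -L) (\<chi> i. L)"
      by (simp add: mem_box_cart abs_le_iff minus_le_iff)
  qed
  then have "bounded {x. f x \<noteq> 0}" using bounded_cbox bounded_subset by blast
  then show "compact (closure {x. f x \<noteq> 0})" by simp
qed

text \<open>
  Divide \<open>\<psi>\<close> by a bump \<open>\<eta>\<close> that is bounded away from \<open>0\<close> on the support of \<open>\<psi>\<close>.  The quotient is
  an almost everywhere limit of continuous functions, these may be truncated and then replaced by
  polynomials on the support of \<open>\<eta>\<close>; polynomials times \<open>\<eta>\<close> are test functions.
\<close>

lemma test_functions_dense:
  fixes \<psi> :: "real ^ 'n \<Rightarrow> real"
  assumes meas: "\<psi> \<in> borel_measurable lborel" and bdd: "\<And>x. \<bar>\<psi> x\<bar> \<le> k" and r: "r > 0"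
    and supp: "\<And>x i. \<bar>x $ i\<bar> > r \<Longrightarrow> \<psi> x = 0"
  obtains \<phi> :: "nat \<Rightarrow> real ^ 'n \<Rightarrow> real" and C
  where "\<And>n. test_function (\<phi> n)" "\<And>n x. \<bar>\<phi> n x\<bar> \<le> C"
    "\<And>n x i. \<bar>x $ i\<bar> > r + 1 \<Longrightarrow> \<phi> n x = 0" "AE x in lborel. (\<lambda>n. \<phi> n x) \<longlonglongrightarrow> \<psi> x"
proof -
  define L where "L = r + 1"
  have L: "L > 0" "r < L" using r by (auto simp: L_def)
  define \<eta> :: "real ^ 'n \<Rightarrow> real" where "\<eta> x = (\<Prod>i\<in>UNIV. bump L 1 0 (x $ i))" for x
  have \<eta>: "bump_sum L \<eta>" unfolding \<eta>_def by (rule bump_sum.prod)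
  have b01: "0 \<le> bump L 1 0 t" "bump L 1 0 t \<le> 1" for t
  proof -
    have "\<bar>t\<bar> < L \<Longrightarrow> L\<^sup>2 - t\<^sup>2 > 0" by (rule square_diff_pos)
    then show "0 \<le> bump L 1 0 t" "bump L 1 0 t \<le> 1" by (auto simp: bump_def)
  qed
  have \<eta>01: "0 \<le> \<eta> x" "\<eta> x \<le> 1" for x
    unfolding \<eta>_def using b01 by (auto intro: prod_nonneg prod_le_1)
  define c where "c = (\<Prod>i\<in>(UNIV :: 'n set). exp (- (1 / (L\<^sup>2 - r\<^sup>2))))"
  have c: "c > 0" unfolding c_def by (intro prod_pos) auto
  have \<eta>c: "c \<le> \<eta> x" if "\<And>i. \<bar>x $ i\<bar> \<le> r" for x
    unfolding c_def \<eta>_def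
  proof (intro prod_mono conjI)
    fix i
    have "(x $ i)\<^sup>2 \<le> r\<^sup>2" using that[of i] r by (metis abs_le_square_iff abs_of_pos)
    moreover have "r\<^sup>2 < L\<^sup>2" using r L by (intro power_strict_mono) auto
    ultimately have "1 / (L\<^sup>2 - (x $ i)\<^sup>2) \<le> 1 / (L\<^sup>2 - r\<^sup>2)" by (intro divide_left_mono) auto
    then show "exp (- (1 / (L\<^sup>2 - r\<^sup>2))) \<le> bump L 1 0 (x $ i)"
      using that[of i] L by (simp add: bump_def)
  qed auto
  define \<xi> where "\<xi> x = \<psi> x / \<eta> x" for x
  define k' where "k' = k / c"
  have k: "k \<ge> 0" using bdd by (rule order_trans[OF abs_ge_zero])
  have k': "k' \<ge> 0" unfolding k'_def using k c by auto
  have supp': "\<bar>x $ i\<bar> \<le> r" if "\<psi> x \<noteq> 0" for x i using supp[where x = x and i = i] that by force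
  have \<xi>le: "\<bar>\<xi> x\<bar> \<le> k'" for x
  proof (cases "\<psi> x = 0")
    case False
    then have "c \<le> \<eta> x" using supp' by (intro \<eta>c) auto
    then show ?thesis unfolding \<xi>_def k'_def abs_divide using c bdd[of x] k \<eta>01[of x] by (intro frac_le) auto
  qed (use k' in \<open>auto simp: \<xi>_def\<close>)
  have \<psi>: "\<psi> x = \<eta> x * \<xi> x" for x
  proof (cases "\<psi> x = 0")
    case False
    then have "c \<le> \<eta> x" using supp' by (intro \<eta>c) auto
    then show ?thesis using c by (simp add: \<xi>_def)
  qed (auto simp: \<xi>_def)
  have cont\<eta>: "continuous_on UNIV \<eta>"
    using bump_sum_deriv[OF L(1) \<eta>]
    by (auto simp: continuous_on_eq_continuous_within differentiable_imp_continuous_within)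
  have "\<xi> \<in> borel_measurable borel"
    unfolding \<xi>_def using meas borel_measurable_continuous_onI[OF cont\<eta>] by (intro borel_measurable_divide) auto
  then have "\<xi> \<in> borel_measurable lebesgue" by (simp add: measurable_completion)
  then have "\<xi> measurable_on UNIV" by (intro lebesgue_measurable_imp_measurable_on_real) auto
  then obtain N g where N: "negligible N" and g: "\<And>n. continuous_on UNIV (g n)"
    and lim: "\<And>x. x \<notin> N \<Longrightarrow> (\<lambda>n. g n x) \<longlonglongrightarrow> \<xi> x"
    unfolding measurable_on_def by auto
  define h where "h n x = max (- k') (min k' (g n x))" for n x
  have h: "continuous_on UNIV (h n)" for n
    unfolding h_def using g by (intro continuous_intros)
  have hle: "\<bar>h n x\<bar> \<le> k'" for n x using k' by (auto simp: h_def)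
  have hlim: "(\<lambda>n. h n x) \<longlonglongrightarrow> \<xi> x" if "x \<notin> N" for x
  proof -
    have "(\<lambda>n. h n x) \<longlonglongrightarrow> max (- k') (min k' (\<xi> x))"
      unfolding h_def by (intro tendsto_intros lim that)
    then show ?thesis using \<xi>le[of x] by (simp add: max_def min_def abs_le_iff) (smt (verit))
  qed
  define S where "S = (cbox (\<chi> i. -L) (\<chi> i. L) :: (real^'n) set)"
  have S: "x \<in> S \<longleftrightarrow> (\<forall>i. \<bar>x $ i\<bar> \<le> L)" for x
    unfolding S_def by (auto simp: mem_box_cart abs_le_iff minus_le_iff)
  have "\<exists>q. real_polynomial_function q \<and> (\<forall>x\<in>S. \<bar>h n x - q x\<bar> < 1 / real (Suc n))" for n
  proof -
    have "compact S" by (simp add: S_def)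
    moreover have "continuous_on S (h n)" using h continuous_on_subset by blast
    moreover have "0 < 1 / real (Suc n)" by simp
    ultimately show ?thesis
      by (rule Stone_Weierstrass_real_polynomial_function) blast
  qed
  then obtain q where q: "\<And>n. real_polynomial_function (q n)"
    and hq: "\<And>n x. x \<in> S \<Longrightarrow> \<bar>h n x - q n x\<bar> < 1 / real (Suc n)" by metis
  define \<phi> where "\<phi> n x = q n x * \<eta> x" for n x
  have bs: "bump_sum L (\<phi> n)" for n unfolding \<phi>_def by (rule bump_sum_times_poly[OF q \<eta>])
  have out: "\<eta> x = 0" if "x \<notin> S" for x
    using that bump_sum_eq_0[OF \<eta>, of x] unfolding S by (metis le_cases)
  show thesis
  proof
    show "test_function (\<phi> n)" for n by (rule test_function_bump_sum[OF L(1) bs])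
    show "\<bar>\<phi> n x\<bar> \<le> k' + 1" for n x
    proof (cases "x \<in> S")
      case True
      have "1 / real (Suc n) \<le> 1" by simp
      then have "\<bar>q n x\<bar> \<le> k' + 1" using hq[OF True, of n] hle[of n x] by linarith
      then have "\<bar>q n x\<bar> * \<eta> x \<le> (k' + 1) * 1"
        using \<eta>01[of x] k' by (intro mult_mono) auto
      then show ?thesis using \<eta>01[of x] by (simp add: \<phi>_def abs_mult)
    next
      case False
      show ?thesis using k' by (simp add: \<phi>_def out[OF False])
    qed
    show "\<phi> n x = 0" if "\<bar>x $ i\<bar> > r + 1" for n x i
      using bump_sum_eq_0[OF bs, of x i n] that by (simp add: L_def)
    have "(\<lambda>n. \<phi> n x) \<longlonglongrightarrow> \<psi> x" if "x \<notin> N" for x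
    proof (cases "x \<in> S")
      case True
      have "(\<lambda>n. h n x - q n x) \<longlonglongrightarrow> 0"
      proof (rule Lim_null_comparison)
        show "(\<lambda>n. 1 / real (Suc n)) \<longlonglongrightarrow> 0" by (rule lim_1_over_n[THEN LIMSEQ_Suc])
        show "\<forall>\<^sub>F n in sequentially. norm (h n x - q n x) \<le> 1 / real (Suc n)"
          unfolding real_norm_def using hq[OF True] by (intro always_eventually allI less_imp_le)
      qed
      from tendsto_diff[OF hlim[OF that] this] have "(\<lambda>n. q n x) \<longlonglongrightarrow> \<xi> x" by simp
      then show ?thesis unfolding \<phi>_def \<psi> by (auto intro!: tendsto_eq_intros)
    next
      case False
      show ?thesis by (simp add: \<phi>_def out[OF False] \<psi>)
    qed
    then have "AE x in lebesgue. (\<lambda>n. \<phi> n x) \<longlonglongrightarrow> \<psi> x"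
      using N by (intro AE_I'[of N]) (auto simp: negligible_iff_null_sets)
    then show "AE x in lborel. (\<lambda>n. \<phi> n x) \<longlonglongrightarrow> \<psi> x" by (simp add: AE_completion_iff)
  qed
qed


section \<open>Translations of functions with a square integrable weak gradient\<close>

lemma nn_integral_lborel_translate:
  fixes a :: "'a::euclidean_space" and f :: "'a \<Rightarrow> ennreal"
  assumes [measurable]: "f \<in> borel_measurable borel"
  shows "(\<integral>\<^sup>+ x. f (x + a) \<partial>lborel) = (\<integral>\<^sup>+ x. f x \<partial>lborel)"
proof -
  have "(\<integral>\<^sup>+ x. f x \<partial>lborel) = (\<integral>\<^sup>+ x. f x \<partial>distr lborel borel ((+) a))"
    by (simp add: lborel_distr_plus)
  also have "\<dots> = (\<integral>\<^sup>+ x. f (x + a) \<partial>lborel)"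
    by (subst nn_integral_distr) (auto simp: add.commute)
  finally show ?thesis ..
qed

lemma integral_lborel_translate:
  fixes a :: "'a::euclidean_space" and f :: "'a \<Rightarrow> real"
  assumes [measurable]: "f \<in> borel_measurable borel"
  shows "(\<integral> x. f (x + a) \<partial>lborel) = (\<integral> x. f x \<partial>lborel)"
proof -
  have "(\<integral> x. f x \<partial>lborel) = (\<integral> x. f x \<partial>distr lborel borel ((+) a))"
    by (simp add: lborel_distr_plus)
  also have "\<dots> = (\<integral> x. f (x + a) \<partial>lborel)"
    by (subst integral_distr) (auto simp: add.commute)
  finally show ?thesis ..
qed

lemma integrable_lborel_translate:
  fixes a :: "'a::euclidean_space" and f :: "'a \<Rightarrow> real"
  assumes "integrable lborel f"
  shows "integrable lborel (\<lambda>x. f (x + a))"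
proof -
  have [measurable]: "f \<in> borel_measurable borel" using assms by auto
  have "integrable (distr lborel borel ((+) a)) f" using assms by (simp add: lborel_distr_plus)
  then show ?thesis by (subst (asm) integrable_distr_eq) (auto simp: add.commute)
qed

lemma test_function_has_derivative:
  assumes "test_function \<phi>"
  shows "(\<phi> has_derivative frechet_derivative \<phi> (at x)) (at x)"
proof -
  have "C_k 1 \<phi>" using assms unfolding test_function_def by blast
  then show ?thesis by (simp add: frechet_derivative_works)
qed

lemma continuous_on_test_function:
  assumes "test_function \<phi>"
  shows "continuous_on UNIV \<phi>"
  using assms unfolding test_function_def by (metis C_k.simps(1))

lemma continuous_on_partial_deriv_test_function:
  assumes "test_function \<phi>"
  shows "continuous_on UNIV (partial_deriv i \<phi>)"
proof -
  have "C_k 1 \<phi>" using assms unfolding test_function_def by blast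
  then show ?thesis by simp
qed

lemma test_function_support:
  fixes \<phi> :: "real ^ 'n \<Rightarrow> real"
  assumes "test_function \<phi>"
  obtains R where "R > 0" "\<And>x. norm x > R \<Longrightarrow> \<phi> x = 0" "\<And>x i. norm x > R \<Longrightarrow> partial_deriv i \<phi> x = 0"
proof -
  have "bounded (closure {x. \<phi> x \<noteq> 0})"
    using assms by (simp add: test_function_def compact_imp_bounded)
  then obtain R where R: "R > 0" "\<And>x. x \<in> closure {x. \<phi> x \<noteq> 0} \<Longrightarrow> norm x \<le> R"
    by (auto simp: bounded_pos)
  have 0: "\<phi> x = 0" if "norm x > R" for x
    using R(2)[of x] that closure_subset[of "{x. \<phi> x \<noteq> 0}"] by (metis (mono_tags) mem_Collect_eq not_le subsetD)
  moreover have "partial_deriv i \<phi> x = 0" if "norm x > R" for x i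
  proof -
    have "(\<phi> has_derivative (\<lambda>_. 0)) (at x)"
      by (rule has_derivative_transform_within_open[of "\<lambda>_. 0" _ _ _ "{x. R < norm x}"])
         (use 0 that in \<open>auto intro!: open_Collect_less continuous_intros\<close>)
    from frechet_derivative_at[OF this] show ?thesis
      unfolding partial_deriv_def by metis
  qed
  ultimately show ?thesis using that R(1) by blast
qed

lemma partial_deriv_translate:
  assumes "\<And>x. \<phi> differentiable (at x)"
  shows "partial_deriv i (\<lambda>x. \<phi> (x + a)) = (\<lambda>x. partial_deriv i \<phi> (x + a))"
proof
  fix x
  have "((\<lambda>x. x + a) has_derivative (\<lambda>y. y)) (at x)" by (auto intro!: derivative_eq_intros)
  from has_derivative_compose[OF this assms[of "x + a", unfolded frechet_derivative_works]]
  have "((\<lambda>x. \<phi> (x + a)) has_derivative frechet_derivative \<phi> (at (x + a))) (at x)" .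
  from frechet_derivative_at[OF this]
  show "partial_deriv i (\<lambda>x. \<phi> (x + a)) x = partial_deriv i \<phi> (x + a)"
    unfolding partial_deriv_def by metis
qed

lemma C_k_translate: "C_k k \<phi> \<Longrightarrow> C_k k (\<lambda>x. \<phi> (x + a))"
proof (induction k arbitrary: \<phi>)
  case 0
  then show ?case by (auto intro!: continuous_on_compose2[of UNIV \<phi>] continuous_intros)
next
  case (Suc k)
  then have d: "\<And>x. \<phi> differentiable (at x)" by simp
  have "(\<lambda>x. \<phi> (x + a)) differentiable (at x)" for x
    using d[of "x+a"] differentiable_compose[of \<phi> "\<lambda>x. x + a" x UNIV]
    by (auto intro!: differentiable_chain_at[of "\<lambda>x. x + a" x \<phi>, unfolded o_def])
  then show ?case using Suc by (simp add: partial_deriv_translate[OF d])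
qed

lemma test_function_translate:
  assumes "test_function \<phi>"
  shows "test_function (\<lambda>x. \<phi> (x + a))"
  unfolding test_function_def
proof
  show "\<forall>k. C_k k (\<lambda>x. \<phi> (x + a))" using assms C_k_translate unfolding test_function_def by blast
  obtain R where R: "\<And>x. norm x > R \<Longrightarrow> \<phi> x = 0" using test_function_support[OF assms] by metis
  have "norm x \<le> R + norm a" if "\<phi> (x + a) \<noteq> 0" for x
    using R[of "x + a"] that norm_triangle_ineq4[of "x + a" a] by force
  then have "bounded {x. \<phi> (x + a) \<noteq> 0}" by (auto simp: bounded_iff)
  then show "compact (closure {x. \<phi> (x + a) \<noteq> 0})" by simp
qed

lemma bounded_continuous_compact_support:
  fixes f :: "'a::euclidean_space \<Rightarrow> real"
  assumes "continuous_on UNIV f" "\<And>x. norm x > R \<Longrightarrow> f x = 0"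
  obtains C where "C \<ge> 0" "\<And>x. \<bar>f x\<bar> \<le> C"
proof -
  have "compact (f ` cball 0 R)"
    by (intro compact_continuous_image continuous_on_subset[OF assms(1)]) auto
  then have "bounded (f ` cball 0 R)" by (rule compact_imp_bounded)
  then obtain B where B: "\<And>x. x \<in> cball 0 R \<Longrightarrow> \<bar>f x\<bar> \<le> B"
    unfolding bounded_iff by (metis image_eqI real_norm_def)
  have "\<bar>f x\<bar> \<le> max B 0" for x using B[of x] assms(2)[of x] by (cases "norm x \<le> R") auto
  then show ?thesis using that[of "max B 0"] by auto
qed

lemma integrable_continuous_compact_support:
  fixes f :: "'a::euclidean_space \<Rightarrow> real"
  assumes "continuous_on UNIV f" "\<And>x. norm x > R \<Longrightarrow> f x = 0"
  shows "integrable lborel f"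
proof -
  have "integrable lborel (\<lambda>x. indicator (cball 0 R) x *\<^sub>R f x)"
    by (intro borel_integrable_compact continuous_on_subset[OF assms(1)]) auto
  also have "(\<lambda>x. indicator (cball 0 R) x *\<^sub>R f x) = f"
  proof
    fix x show "indicator (cball 0 R) x *\<^sub>R f x = f x"
      using assms(2)[of x] by (cases "norm x \<le> R") auto
  qed
  finally show ?thesis .
qed

lemma has_real_derivative_along_line:
  fixes \<phi> :: "real ^ 'n \<Rightarrow> real"
  assumes "test_function \<phi>"
  shows "((\<lambda>t. \<phi> (y + t *\<^sub>R a)) has_real_derivative (\<Sum>i\<in>UNIV. a $ i * partial_deriv i \<phi> (y + t *\<^sub>R a))) (at t)"
proof -
  let ?D = "frechet_derivative \<phi> (at (y + t *\<^sub>R a))"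
  have der: "(\<phi> has_derivative ?D) (at (y + t *\<^sub>R a))" by (rule test_function_has_derivative[OF assms])
  have "((\<lambda>t. y + t *\<^sub>R a) has_derivative (\<lambda>s. s *\<^sub>R a)) (at t)" by (auto intro!: derivative_eq_intros)
  from has_derivative_compose[OF this der]
  have "((\<lambda>t. \<phi> (y + t *\<^sub>R a)) has_derivative (\<lambda>s. ?D (s *\<^sub>R a))) (at t)" .
  moreover have lin: "linear ?D" using der by (rule has_derivative_linear)
  moreover have "?D a = (\<Sum>i\<in>UNIV. a $ i * partial_deriv i \<phi> (y + t *\<^sub>R a))"
    using linear_eq_sum_axis[OF lin, of a] by (simp add: partial_deriv_def mult.commute)
  ultimately show ?thesis
    by (simp add: has_field_derivative_def linear_scale mult.commute[of _ "sum _ _"] mult_commute_abs)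
qed

text \<open>
  By the fundamental theorem of calculus and Fubini, the left-hand side is the average over
  \<open>t \<in> [0,1]\<close> of \<open>\<integral> u \<partial>\<^sub>a\<phi>(\<cdot> + t a) = - \<integral> (a \<bullet> G) \<phi>(\<cdot> + t a)\<close>.  The product is estimated by
  half the sum of the squares instead of the product of the norms: after optimization in \<open>\<phi>\<close> nothing
  is lost.
\<close>

lemma integral_times_translation_difference_le:
  fixes u :: "real ^ 'n \<Rightarrow> real" and G :: "real ^ 'n \<Rightarrow> real ^ 'n"
  assumes u[measurable]: "u \<in> borel_measurable borel" and G[measurable]: "G \<in> borel_measurable borel"
    and loc: "\<And>K. compact K \<Longrightarrow> set_integrable lborel K u"
    and weak: "\<And>\<phi> i. test_function \<phi> \<Longrightarrow>
        (\<integral> x. u x * partial_deriv i \<phi> x \<partial>lborel) = - (\<integral> x. G x $ i * \<phi> x \<partial>lborel)"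
    and G2: "integrable lborel (\<lambda>x. (norm (G x))\<^sup>2)"
    and \<phi>: "test_function \<phi>"
  shows "(\<integral> y. u y * (\<phi> (y + a) - \<phi> y) \<partial>lborel)
    \<le> ((norm a)\<^sup>2 * (\<integral> x. (norm (G x))\<^sup>2 \<partial>lborel) + (\<integral> x. (\<phi> x)\<^sup>2 \<partial>lborel)) / 2" (is "_ \<le> ?B")
proof -
  obtain R where R: "R > 0" "\<And>x. norm x > R \<Longrightarrow> \<phi> x = 0" "\<And>x i. norm x > R \<Longrightarrow> partial_deriv i \<phi> x = 0"
    using test_function_support[OF \<phi>] by blast
  note cont\<phi> = continuous_on_test_function[OF \<phi>]
  have [measurable]: "\<phi> \<in> borel_measurable borel" by (rule borel_measurable_continuous_onI[OF cont\<phi>])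
  define D where "D x = (\<Sum>i\<in>UNIV. a $ i * partial_deriv i \<phi> x)" for x
  have contD: "continuous_on UNIV D"
    unfolding D_def by (intro continuous_intros continuous_on_partial_deriv_test_function[OF \<phi>])
  have [measurable]: "D \<in> borel_measurable borel" by (rule borel_measurable_continuous_onI[OF contD])
  have D0: "D x = 0" if "norm x > R" for x using R(3) that by (simp add: D_def)
  obtain C where C: "C \<ge> 0" "\<And>x. \<bar>D x\<bar> \<le> C" using bounded_continuous_compact_support[OF contD D0] by blast
  have ftc: "(\<integral> t. D (y + t *\<^sub>R a) * indicator {0..1} t \<partial>lborel) = \<phi> (y + a) - \<phi> y" for y
  proof -
    have "(\<integral> t. D (y + t *\<^sub>R a) * indicator {0..1} t \<partial>lborel) = \<phi> (y + 1 *\<^sub>R a) - \<phi> (y + 0 *\<^sub>R a)"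
    proof (rule integral_FTC_Icc_real)
      show "((\<lambda>t. \<phi> (y + t *\<^sub>R a)) has_real_derivative D (y + t *\<^sub>R a)) (at t)" for t
        unfolding D_def by (rule has_real_derivative_along_line[OF \<phi>])
      have "continuous_on UNIV (\<lambda>t. D (y + t *\<^sub>R a))"
        by (rule continuous_on_compose2[OF contD]) (auto intro!: continuous_intros)
      then show "isCont (\<lambda>t. D (y + t *\<^sub>R a)) t" for t
        by (simp add: continuous_on_eq_continuous_at)
    qed simp
    then show ?thesis by simp
  qed
  define K where "K = cball (0 :: real^'n) (R + norm a)"
  have out: "D (y + t *\<^sub>R a) * indicator {0..1} t = 0" if "y \<notin> K" for y t
  proof (cases "t \<in> {0..1}")
    case True
    then have "norm (t *\<^sub>R a) \<le> norm a" by (simp add: mult_left_le_one_le)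
    moreover have "norm y \<le> norm (y + t *\<^sub>R a) + norm (t *\<^sub>R a)" using norm_triangle_ineq4[of "y + t *\<^sub>R a" "t *\<^sub>R a"] by simp
    ultimately have "norm (y + t *\<^sub>R a) > R" using that by (simp add: K_def)
    then show ?thesis by (simp add: D0)
  qed simp
  have uK: "integrable lborel (\<lambda>y. indicator K y * u y)"
    using loc[of K] by (simp add: set_integrable_def K_def)
  (* integrability on the product space, for Fubini *)
  have int2: "integrable (lborel \<Otimes>\<^sub>M lborel) (\<lambda>(y, t). u y * (D (y + t *\<^sub>R a) * indicator {0..1::real} t))"
  proof (rule integrableI_bounded)
    have "(\<integral>\<^sup>+ z. ennreal (norm (case z of (y, t) \<Rightarrow> u y * (D (y + t *\<^sub>R a) * indicator {0..1::real} t))) \<partial>(lborel \<Otimes>\<^sub>M lborel))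
      = (\<integral>\<^sup>+ y. \<integral>\<^sup>+ t. ennreal (norm (u y * (D (y + t *\<^sub>R a) * indicator {0..1::real} t))) \<partial>lborel \<partial>lborel)"
      by (subst lborel.nn_integral_fst[symmetric]) auto
    also have "\<dots> \<le> (\<integral>\<^sup>+ y. \<integral>\<^sup>+ t. ennreal (norm (C * (indicator K y * u y))) * indicator {0..1::real} t \<partial>lborel \<partial>lborel)"
    proof (intro nn_integral_mono)
      fix y :: "real^'n" and t :: real
      show "ennreal (norm (u y * (D (y + t *\<^sub>R a) * indicator {0..1::real} t)))
          \<le> ennreal (norm (C * (indicator K y * u y))) * indicator {0..1::real} t"
      proof (cases "y \<in> K \<and> t \<in> {0..1}")
        case True
        then show ?thesis using mult_right_mono[OF C(2)[of "y + t *\<^sub>R a"], of "\<bar>u y\<bar>"] C(1)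
          by (auto simp: abs_mult mult.commute intro!: ennreal_leI)
      next
        case False
        then show ?thesis using out[of y t] by (auto simp: indicator_def)
      qed
    qed
    also have "\<dots> = (\<integral>\<^sup>+ y. ennreal (norm (C * (indicator K y * u y))) \<partial>lborel)"
      by (simp add: nn_integral_cmult)
    also have "\<dots> < \<infinity>"
      using integrable_mult_right[OF uK, of C] by (simp only: integrable_iff_bounded)
    finally show "(\<integral>\<^sup>+ z. ennreal (norm (case z of (y, t) \<Rightarrow> u y * (D (y + t *\<^sub>R a) * indicator {0..1::real} t))) \<partial>(lborel \<Otimes>\<^sub>M lborel)) < \<infinity>" .
  qed measurable
  have "(\<integral> y. u y * (\<phi> (y + a) - \<phi> y) \<partial>lborel)
     = (\<integral> y. (\<integral> t. u y * (D (y + t *\<^sub>R a) * indicator {0..1} t) \<partial>lborel) \<partial>lborel)"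
    by (simp add: ftc)
  also have "\<dots> = (\<integral> t. (\<integral> y. u y * (D (y + t *\<^sub>R a) * indicator {0..1} t) \<partial>lborel) \<partial>lborel)"
    using lborel_pair.Fubini_integral[OF int2] by simp
  also have "\<dots> = (\<integral> t. (\<integral> y. u y * D (y + t *\<^sub>R a) \<partial>lborel) * indicator {0..1} t \<partial>lborel)"
    by (simp add: mult.assoc[symmetric])
  also have "\<dots> \<le> (\<integral> t. ?B * indicator {0..1::real} t \<partial>lborel)"
  proof (rule integral_mono)
    have "integrable lborel (\<lambda>t. \<integral> y. u y * (D (y + t *\<^sub>R a) * indicator {0..1} t) \<partial>lborel)"
      using lborel_pair.integrable_snd[OF int2] by simp
    then show "integrable lborel (\<lambda>t. (\<integral> y. u y * D (y + t *\<^sub>R a) \<partial>lborel) * indicator {0..1} t)"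
      by (simp add: mult.assoc[symmetric])
    show "integrable lborel (\<lambda>t. ?B * indicator {0..1::real} t)" by simp
    fix t :: real
    define \<phi>t where "\<phi>t = (\<lambda>y. \<phi> (y + t *\<^sub>R a))"
    have \<phi>t: "test_function \<phi>t" unfolding \<phi>t_def by (rule test_function_translate[OF \<phi>])
    have [measurable]: "\<phi>t \<in> borel_measurable borel" unfolding \<phi>t_def by measurable
    have pd: "partial_deriv i \<phi>t = (\<lambda>y. partial_deriv i \<phi> (y + t *\<^sub>R a))" for i
      unfolding \<phi>t_def using test_function_has_derivative[OF \<phi>]
      by (intro partial_deriv_translate) (auto simp: differentiable_def)
    obtain R' where R': "R' > 0" "\<And>x. norm x > R' \<Longrightarrow> \<phi>t x = 0" "\<And>x i. norm x > R' \<Longrightarrow> partial_deriv i \<phi>t x = 0"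
      by (rule test_function_support[OF \<phi>t]) blast
    have \<phi>sq: "integrable lborel (\<lambda>x. (\<phi> x)\<^sup>2)"
    proof (rule integrable_continuous_compact_support)
      show "continuous_on UNIV (\<lambda>x. (\<phi> x)\<^sup>2)" by (rule continuous_on_power[OF cont\<phi>])
      show "(\<phi> x)\<^sup>2 = 0" if "norm x > R" for x using R(2)[OF that] by simp
    qed
    have \<phi>tsq: "integrable lborel (\<lambda>x. (\<phi>t x)\<^sup>2)" "(\<integral> x. (\<phi>t x)\<^sup>2 \<partial>lborel) = (\<integral> x. (\<phi> x)\<^sup>2 \<partial>lborel)"
      unfolding \<phi>t_def by (rule integrable_lborel_translate[OF \<phi>sq], rule integral_lborel_translate) simp
    have intu: "integrable lborel (\<lambda>y. u y * partial_deriv i \<phi>t y)" for i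
    proof -
      note cont = continuous_on_partial_deriv_test_function[OF \<phi>t, of i]
      note [measurable] = borel_measurable_continuous_onI[OF cont]
      obtain C where C: "C \<ge> 0" "\<And>x. \<bar>partial_deriv i \<phi>t x\<bar> \<le> C"
        using bounded_continuous_compact_support[OF cont R'(3)] by blast
      have "integrable lborel (\<lambda>y. C * (indicator (cball 0 R') y * u y))"
        using loc[of "cball 0 R'"] by (intro integrable_mult_right) (simp add: set_integrable_def)
      then show ?thesis
      proof (rule Bochner_Integration.integrable_bound)
        show "AE y in lborel. norm (u y * partial_deriv i \<phi>t y) \<le> norm (C * (indicator (cball 0 R') y * u y))"
        proof (rule AE_I2)
          fix y
          show "norm (u y * partial_deriv i \<phi>t y) \<le> norm (C * (indicator (cball 0 R') y * u y))"
            using C(1) C(2)[of y] R'(3)[of y i]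
            mult_left_mono[OF C(2)[of y], of "\<bar>u y\<bar>"]
            by (cases "norm y \<le> R'") (auto simp: abs_mult mult.commute)
        qed
      qed measurable
    qed
    (* Cauchy-Schwarz for the inner product, then 2 a b \<le> a^2 + b^2 *)
    have amgm: "\<bar>(a \<bullet> G x) * \<phi>t x\<bar> \<le> ((norm a)\<^sup>2 * (norm (G x))\<^sup>2 + (\<phi>t x)\<^sup>2) / 2" for x
    proof -
      have "\<bar>(a \<bullet> G x) * \<phi>t x\<bar> \<le> (norm a * norm (G x)) * \<bar>\<phi>t x\<bar>"
        unfolding abs_mult by (intro mult_right_mono Cauchy_Schwarz_ineq2) auto
      also have "\<dots> \<le> ((norm a * norm (G x))\<^sup>2 + \<bar>\<phi>t x\<bar>\<^sup>2) / 2"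
        using sum_squares_bound[of "norm a * norm (G x)" "\<bar>\<phi>t x\<bar>"] by simp
      finally show ?thesis by (simp add: power_mult_distrib)
    qed
    have intB: "integrable lborel (\<lambda>x. ((norm a)\<^sup>2 * (norm (G x))\<^sup>2 + (\<phi>t x)\<^sup>2) / 2)"
      using G2 \<phi>tsq by auto
    have Gmeas: "(\<lambda>x. G x $ i * \<phi>t x) \<in> borel_measurable borel" for i
      unfolding cart_eq_inner_axis by measurable
    have intG: "integrable lborel (\<lambda>x. G x $ i * \<phi>t x)" for i
    proof (rule Bochner_Integration.integrable_bound)
      show "integrable lborel (\<lambda>x. ((norm (G x))\<^sup>2 + (\<phi>t x)\<^sup>2) / 2)" using G2 \<phi>tsq by auto
      show "AE x in lborel. norm (G x $ i * \<phi>t x) \<le> norm (((norm (G x))\<^sup>2 + (\<phi>t x)\<^sup>2) / 2)"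
      proof (rule AE_I2)
        fix x
        have "norm (G x $ i * \<phi>t x) \<le> norm (G x) * \<bar>\<phi>t x\<bar>"
          by (simp add: abs_mult mult_right_mono component_le_norm_cart)
        then show "norm (G x $ i * \<phi>t x) \<le> norm (((norm (G x))\<^sup>2 + (\<phi>t x)\<^sup>2) / 2)"
          using sum_squares_bound[of "norm (G x)" "\<bar>\<phi>t x\<bar>"] by simp
      qed
    qed (simp add: Gmeas)
    have "(\<integral> y. u y * D (y + t *\<^sub>R a) \<partial>lborel) = (\<integral> y. (\<Sum>i\<in>UNIV. a $ i * (u y * partial_deriv i \<phi>t y)) \<partial>lborel)"
      unfolding D_def pd by (simp add: sum_distrib_left mult_ac)
    also have "\<dots> = (\<Sum>i\<in>UNIV. a $ i * (\<integral> y. u y * partial_deriv i \<phi>t y \<partial>lborel))"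
      using intu by (subst Bochner_Integration.integral_sum) auto
    also have "\<dots> = - (\<Sum>i\<in>UNIV. a $ i * (\<integral> y. G y $ i * \<phi>t y \<partial>lborel))"
      by (simp add: weak[OF \<phi>t] sum_negf)
    also have "(\<Sum>i\<in>UNIV. a $ i * (\<integral> y. G y $ i * \<phi>t y \<partial>lborel)) = (\<integral> y. (\<Sum>i\<in>UNIV. a $ i * (G y $ i * \<phi>t y)) \<partial>lborel)"
      using intG by (subst Bochner_Integration.integral_sum) auto
    also have "\<dots> = (\<integral> y. (a \<bullet> G y) * \<phi>t y \<partial>lborel)"
      by (simp add: inner_vec_def sum_distrib_right mult.assoc)
    also have "- \<dots> \<le> (\<integral> x. ((norm a)\<^sup>2 * (norm (G x))\<^sup>2 + (\<phi>t x)\<^sup>2) / 2 \<partial>lborel)"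
    proof -
      have "norm (\<integral> y. (a \<bullet> G y) * \<phi>t y \<partial>lborel) \<le> (\<integral> x. ((norm a)\<^sup>2 * (norm (G x))\<^sup>2 + (\<phi>t x)\<^sup>2) / 2 \<partial>lborel)"
      proof (rule Bochner_Integration.integral_norm_bound_integral)
        show "integrable lborel (\<lambda>y. (a \<bullet> G y) * \<phi>t y)"
        proof (rule Bochner_Integration.integrable_bound[OF intB])
          show "AE x in lborel. norm ((a \<bullet> G x) * \<phi>t x) \<le> norm (((norm a)\<^sup>2 * (norm (G x))\<^sup>2 + (\<phi>t x)\<^sup>2) / 2)"
          proof (rule AE_I2)
            fix x
            show "norm ((a \<bullet> G x) * \<phi>t x) \<le> norm (((norm a)\<^sup>2 * (norm (G x))\<^sup>2 + (\<phi>t x)\<^sup>2) / 2)"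
              unfolding real_norm_def by (rule order_trans[OF amgm abs_ge_self])
          qed
        qed measurable
        show "norm ((a \<bullet> G x) * \<phi>t x) \<le> ((norm a)\<^sup>2 * (norm (G x))\<^sup>2 + (\<phi>t x)\<^sup>2) / 2" for x
          using amgm[of x] by simp
      qed (rule intB)
      then show ?thesis by (simp add: abs_le_iff)
    qed
    also have "\<dots> = (\<integral> x. (norm a)\<^sup>2 * (norm (G x))\<^sup>2 + (\<phi>t x)\<^sup>2 \<partial>lborel) / 2"
      by (rule integral_divide_zero)
    also have "(\<integral> x. (norm a)\<^sup>2 * (norm (G x))\<^sup>2 + (\<phi>t x)\<^sup>2 \<partial>lborel)
        = (norm a)\<^sup>2 * (\<integral> x. (norm (G x))\<^sup>2 \<partial>lborel) + (\<integral> x. (\<phi> x)\<^sup>2 \<partial>lborel)"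
      by (subst Bochner_Integration.integral_add[OF integrable_mult_right[OF G2] \<phi>tsq(1)]) (simp only: \<phi>tsq(2) integral_mult_right_zero)
    finally show "(\<integral> y. u y * D (y + t *\<^sub>R a) \<partial>lborel) * indicator {0..1} t \<le> ?B * indicator {0..1} t"
      by (auto simp: indicator_def)
  qed
  also have "\<dots> = ?B" by simp
  finally show ?thesis .
qed

text \<open>
  Test the difference \<open>w = u(\<cdot> + h) - u\<close> with (an approximation of) its own truncation \<open>\<psi>\<close>.  As
  \<open>\<integral> w \<psi> = \<integral> \<psi>\<^sup>2\<close>, the previous estimate becomes \<open>X \<le> (B + X) / 2\<close> for \<open>X = \<integral> \<psi>\<^sup>2 < \<infinity>\<close>, hence
  \<open>X \<le> B\<close>; remove the truncation by Fatou.
\<close>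

lemma nn_integral_translation_difference_le:
  fixes u :: "real ^ 'n \<Rightarrow> real" and G :: "real ^ 'n \<Rightarrow> real ^ 'n"
  assumes u[measurable]: "u \<in> borel_measurable borel" and G[measurable]: "G \<in> borel_measurable borel"
    and loc: "\<And>K. compact K \<Longrightarrow> set_integrable lborel K u"
    and weak: "\<And>\<phi> i. test_function \<phi> \<Longrightarrow>
        (\<integral> x. u x * partial_deriv i \<phi> x \<partial>lborel) = - (\<integral> x. G x $ i * \<phi> x \<partial>lborel)"
    and G2: "integrable lborel (\<lambda>x. (norm (G x))\<^sup>2)"
  shows "(\<integral>\<^sup>+ x. ennreal ((u (x + h) - u x)\<^sup>2) \<partial>lborel)
    \<le> ennreal ((norm h)\<^sup>2 * (\<integral> x. (norm (G x))\<^sup>2 \<partial>lborel))" (is "_ \<le> ennreal ?B")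
proof -
  define w where "w x = u (x + h) - u x" for x
  have w[measurable]: "w \<in> borel_measurable borel" unfolding w_def by measurable
  define K where "K R = cbox (\<chi> i. - R) (\<chi> i. R :: real ^ 'n)" for R
  have K: "x \<in> K R \<longleftrightarrow> (\<forall>i. \<bar>x $ i\<bar> \<le> R)" for x R
    unfolding K_def by (auto simp: mem_box_cart abs_le_iff minus_le_iff)
  have [measurable]: "K R \<in> sets borel" for R unfolding K_def by simp
  have uK: "integrable lborel (\<lambda>x. indicator S x * u x)" if "compact S" for S
    using loc[OF that] by (simp add: set_integrable_def)
  have uhK: "integrable lborel (\<lambda>x. indicator (K R) x * u (x + h))" for R
  proof -
    have "compact ((\<lambda>x. x + h) ` K R)" unfolding K_def by (intro compact_continuous_image continuous_intros) auto
    from integrable_lborel_translate[OF uK[OF this], of h]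
    have "integrable lborel (\<lambda>x. indicator ((\<lambda>x. x + h) ` K R) (x + h) * u (x + h))" .
    moreover have "indicator ((\<lambda>x. x + h) ` K R) (x + h) = (indicator (K R) x :: real)" for x
      by (auto simp: indicator_def)
    ultimately show ?thesis by simp
  qed
  have wK: "integrable lborel (\<lambda>x. indicator (K R) x * w x)" for R
  proof -
    have "compact (K R)" by (simp add: K_def)
    from Bochner_Integration.integrable_diff[OF uhK uK[OF this]] show ?thesis
      by (simp add: w_def right_diff_distrib)
  qed
  have trunc: "(\<integral>\<^sup>+ x. ennreal ((if \<bar>w x\<bar> \<le> k \<and> x \<in> K r then w x else 0)\<^sup>2) \<partial>lborel) \<le> ennreal ?B"
    if r: "r > 0" and k: "k \<ge> 0" for r k
  proof -
    define \<psi> where "\<psi> x = (if \<bar>w x\<bar> \<le> k \<and> x \<in> K r then w x else 0)" for x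
    have [measurable]: "\<psi> \<in> borel_measurable borel" unfolding \<psi>_def by measurable
    have \<psi>meas: "\<psi> \<in> borel_measurable lborel" by simp
    have \<psi>bdd: "\<bar>\<psi> x\<bar> \<le> k" for x using k by (auto simp: \<psi>_def)
    have \<psi>supp: "\<psi> x = 0" if "\<bar>x $ i\<bar> > r" for x i
      using that unfolding \<psi>_def K by (metis not_le)
    obtain \<phi> :: "nat \<Rightarrow> real ^ 'n \<Rightarrow> real" and C where \<phi>: "\<And>n. test_function (\<phi> n)" "\<And>n x. \<bar>\<phi> n x\<bar> \<le> C"
      "\<And>n x i. \<bar>x $ i\<bar> > r + 1 \<Longrightarrow> \<phi> n x = 0" "AE x in lborel. (\<lambda>n. \<phi> n x) \<longlonglongrightarrow> \<psi> x"
      by (rule test_functions_dense[OF \<psi>meas \<psi>bdd r \<psi>supp]) blast+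
    have C: "C \<ge> 0" using \<phi>(2)[of 0 0] by linarith
    have [measurable]: "\<phi> n \<in> borel_measurable borel" for n
      by (rule borel_measurable_continuous_onI[OF continuous_on_test_function[OF \<phi>(1)]])
    have \<phi>0: "\<phi> n x = 0" if "x \<notin> K (r + 1)" for n x
      using that \<phi>(3) unfolding K by (metis not_le)
    have cK: "compact (K R)" for R by (simp add: K_def)
    have Kfin: "emeasure lborel (K R) < top" for R
      using emeasure_compact_finite[OF cK[of R]] by simp
    have bnd: "\<bar>v x * \<phi> n x\<bar> \<le> C * \<bar>indicator (K (r + 1)) x * v x\<bar>" for v :: "real ^ 'n \<Rightarrow> real" and n x
      using \<phi>0[of x n] mult_left_mono[OF \<phi>(2)[of n x], of "\<bar>v x\<bar>"]
      by (cases "x \<in> K (r + 1)") (auto simp: abs_mult mult.commute)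
    have int\<phi>: "integrable lborel (\<lambda>x. v x * \<phi> n x)"
      if "integrable lborel (\<lambda>x. indicator (K (r + 1)) x * v x)" "v \<in> borel_measurable borel" for v :: "real ^ 'n \<Rightarrow> real" and n
    proof -
      have [measurable]: "v \<in> borel_measurable borel" by fact
      from that(1) have "integrable lborel (\<lambda>x. C * \<bar>indicator (K (r + 1)) x * v x\<bar>)" by simp
      then show ?thesis
        by (rule Bochner_Integration.integrable_bound) (use bnd[of v _ n] C in auto)
    qed
    have le: "(\<integral> x. w x * \<phi> n x \<partial>lborel) \<le> (?B + (\<integral> x. (\<phi> n x)\<^sup>2 \<partial>lborel)) / 2" for n
    proof -
      have u\<phi>: "integrable lborel (\<lambda>x. u x * \<phi> n x)" by (rule int\<phi>[OF uK[OF cK] u])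
      have uh\<phi>: "integrable lborel (\<lambda>x. u (x + h) * \<phi> n x)" by (rule int\<phi>[OF uhK]) simp
      have u\<phi>h: "integrable lborel (\<lambda>x. u x * \<phi> n (x + - h))"
        using integrable_lborel_translate[OF uh\<phi>, of "- h"] by simp
      have "(\<integral> x. w x * \<phi> n x \<partial>lborel) = (\<integral> x. u (x + h) * \<phi> n x \<partial>lborel) - (\<integral> x. u x * \<phi> n x \<partial>lborel)"
        unfolding w_def left_diff_distrib using uh\<phi> u\<phi> by (rule Bochner_Integration.integral_diff)
      also have "(\<integral> x. u (x + h) * \<phi> n x \<partial>lborel) = (\<integral> x. u x * \<phi> n (x + - h) \<partial>lborel)"
        using integral_lborel_translate[of "\<lambda>x. u x * \<phi> n (x + - h)" h] by simp
      also have "\<dots> - (\<integral> x. u x * \<phi> n x \<partial>lborel) = (\<integral> x. u x * (\<phi> n (x + - h) - \<phi> n x) \<partial>lborel)"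
        unfolding right_diff_distrib using u\<phi>h u\<phi> by (rule Bochner_Integration.integral_diff[symmetric])
      also have "\<dots> \<le> (?B + (\<integral> x. (\<phi> n x)\<^sup>2 \<partial>lborel)) / 2"
        using integral_times_translation_difference_le[OF u G loc weak G2 \<phi>(1), of n "- h"] by simp
      finally show ?thesis .
    qed
    have lim1: "(\<lambda>n. \<integral> x. w x * \<phi> n x \<partial>lborel) \<longlonglongrightarrow> (\<integral> x. w x * \<psi> x \<partial>lborel)"
    proof (rule integral_dominated_convergence[where w = "\<lambda>x. C * \<bar>indicator (K (r + 1)) x * w x\<bar>"])
      show "integrable lborel (\<lambda>x. C * \<bar>indicator (K (r + 1)) x * w x\<bar>)" using wK[of "r + 1"] by simp
      show "AE x in lborel. (\<lambda>n. w x * \<phi> n x) \<longlonglongrightarrow> w x * \<psi> x"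
        using \<phi>(4) by eventually_elim (intro tendsto_intros)
      show "AE x in lborel. norm (w x * \<phi> n x) \<le> C * \<bar>indicator (K (r + 1)) x * w x\<bar>" for n
        using bnd[of w _ n] by simp
    qed measurable
    have K1: "integrable lborel (\<lambda>x. indicator (K (r + 1)) x * C\<^sup>2)"
      using Kfin by (simp add: integrable_indicator_iff)
    have lim2: "(\<lambda>n. \<integral> x. (\<phi> n x)\<^sup>2 \<partial>lborel) \<longlonglongrightarrow> (\<integral> x. (\<psi> x)\<^sup>2 \<partial>lborel)"
    proof (rule integral_dominated_convergence[OF _ _ K1])
      show "AE x in lborel. (\<lambda>n. (\<phi> n x)\<^sup>2) \<longlonglongrightarrow> (\<psi> x)\<^sup>2"
        using \<phi>(4) by eventually_elim (intro tendsto_intros)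
      show "AE x in lborel. norm ((\<phi> n x)\<^sup>2) \<le> indicator (K (r + 1)) x * C\<^sup>2" for n
      proof (rule AE_I2)
        fix x
        show "norm ((\<phi> n x)\<^sup>2) \<le> indicator (K (r + 1)) x * C\<^sup>2"
          using \<phi>0[of x n] power_mono[OF \<phi>(2)[of n x], of 2] by (cases "x \<in> K (r + 1)") auto
      qed
    qed measurable
    have w\<psi>: "w x * \<psi> x = (\<psi> x)\<^sup>2" for x by (simp add: \<psi>_def power2_eq_square)
    have "(\<integral> x. (\<psi> x)\<^sup>2 \<partial>lborel) \<le> (?B + (\<integral> x. (\<psi> x)\<^sup>2 \<partial>lborel)) / 2"
    proof (rule LIMSEQ_le)
      show "(\<lambda>n. \<integral> x. w x * \<phi> n x \<partial>lborel) \<longlonglongrightarrow> (\<integral> x. (\<psi> x)\<^sup>2 \<partial>lborel)"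
        using lim1 by (simp only: w\<psi>)
      show "(\<lambda>n. (?B + (\<integral> x. (\<phi> n x)\<^sup>2 \<partial>lborel)) / 2) \<longlonglongrightarrow> (?B + (\<integral> x. (\<psi> x)\<^sup>2 \<partial>lborel)) / 2"
        using lim2 by (rule tendsto_divide[OF tendsto_add[OF tendsto_const] tendsto_const]) simp
    qed (use le in blast)
    moreover have "X \<le> (Y + X) / 2 \<Longrightarrow> X \<le> Y" for X Y :: real by simp
    ultimately have X: "(\<integral> x. (\<psi> x)\<^sup>2 \<partial>lborel) \<le> ?B" by blast
    have "integrable lborel (\<lambda>x. (\<psi> x)\<^sup>2)"
    proof (rule Bochner_Integration.integrable_bound)
      show "integrable lborel (\<lambda>x. indicator (K r) x * k\<^sup>2)"
        using Kfin by (simp add: integrable_indicator_iff)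
      show "AE x in lborel. norm ((\<psi> x)\<^sup>2) \<le> norm (indicator (K r) x * k\<^sup>2)"
      proof (rule AE_I2)
        fix x
        show "norm ((\<psi> x)\<^sup>2) \<le> norm (indicator (K r) x * k\<^sup>2)"
          using power_mono[OF \<psi>bdd[of x], of 2] by (cases "x \<in> K r") (auto simp: \<psi>_def)
      qed
    qed measurable
    then have "(\<integral>\<^sup>+ x. ennreal ((\<psi> x)\<^sup>2) \<partial>lborel) = ennreal (\<integral> x. (\<psi> x)\<^sup>2 \<partial>lborel)"
      by (rule nn_integral_eq_integral) simp
    then show ?thesis using X unfolding \<psi>_def by (simp add: ennreal_leI)
  qed
  define \<psi> where "\<psi> n x = (if \<bar>w x\<bar> \<le> real n \<and> x \<in> K (real (Suc n)) then w x else 0)" for n x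
  have [measurable]: "\<psi> n \<in> borel_measurable borel" for n unfolding \<psi>_def by measurable
  have "(\<integral>\<^sup>+ x. ennreal ((w x)\<^sup>2) \<partial>lborel) = (\<integral>\<^sup>+ x. liminf (\<lambda>n. ennreal ((\<psi> n x)\<^sup>2)) \<partial>lborel)"
  proof (rule nn_integral_cong)
    fix x
    obtain N where N: "max \<bar>w x\<bar> (norm x) \<le> real N" using real_arch_simple by blast
    have "eventually (\<lambda>n. ennreal ((\<psi> n x)\<^sup>2) = ennreal ((w x)\<^sup>2)) sequentially"
      using eventually_ge_at_top[of N]
    proof eventually_elim
      case (elim n)
      have "\<bar>x $ i\<bar> \<le> real (Suc n)" for i using component_le_norm_cart[of x i] N elim by simp
      moreover have "\<bar>w x\<bar> \<le> real n" using N elim by simp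
      ultimately show ?case by (simp add: \<psi>_def K)
    qed
    then have "(\<lambda>n. ennreal ((\<psi> n x)\<^sup>2)) \<longlonglongrightarrow> ennreal ((w x)\<^sup>2)" by (rule tendsto_eventually)
    from lim_imp_Liminf[OF _ this] show "ennreal ((w x)\<^sup>2) = liminf (\<lambda>n. ennreal ((\<psi> n x)\<^sup>2))" by simp
  qed
  also have "\<dots> \<le> liminf (\<lambda>n. \<integral>\<^sup>+ x. ennreal ((\<psi> n x)\<^sup>2) \<partial>lborel)"
    by (rule nn_integral_liminf) simp
  also have "\<dots> \<le> ennreal ?B"
    unfolding \<psi>_def by (intro Liminf_le always_eventually allI trunc) auto
  finally show ?thesis unfolding w_def .
qed


section \<open>Measure of superlevel sets\<close>

lemma ball_in_sets_borel[measurable]: "ball x r \<in> sets borel"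
  by simp

definition riesz_const :: "'n itself \<Rightarrow> real \<Rightarrow> real" where
  "riesz_const TYPE('n) \<beta> = Gamma ((real CARD('n) - \<beta>) / 2)
       / (Gamma (\<beta> / 2) * pi powr (real CARD('n) / 2) * 2 powr \<beta>)"

lemma riesz_kernel_eq:
  "riesz_kernel \<beta> (z :: real ^ 'n) = riesz_const TYPE('n) \<beta> / norm z powr (real CARD('n) - \<beta>)"
  by (simp add: riesz_kernel_def riesz_const_def)

lemma riesz_const_pos:
  assumes "0 < \<beta>" "\<beta> < real CARD('n)"
  shows "riesz_const TYPE('n) \<beta> > 0"
  using assms by (simp add: riesz_const_def Gamma_real_pos)

lemma riesz_kernel_nonneg:
  assumes "0 < \<beta>" "\<beta> < real CARD('n)"
  shows "riesz_kernel \<beta> (z :: real ^ 'n) \<ge> 0"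
  using riesz_const_pos[OF assms] by (simp add: riesz_kernel_eq)

lemma borel_measurable_riesz_kernel[measurable]: "riesz_kernel \<beta> \<in> borel_measurable borel"
  unfolding riesz_kernel_eq[abs_def] by measurable

lemma riesz_potential_lborel:
  "riesz_potential \<beta> f x = (\<integral>\<^sup>+ y. ennreal (riesz_kernel \<beta> (x - y) * f y) \<partial>lborel)"
  by (simp add: riesz_potential_def nn_integral_completion)

lemma borel_measurable_riesz_potential[measurable]:
  assumes [measurable]: "f \<in> borel_measurable borel"
  shows "riesz_potential \<beta> f \<in> borel_measurable borel"
proof -
  have "(\<lambda>x. \<integral>\<^sup>+ y. ennreal (riesz_kernel \<beta> (x - y) * f y) \<partial>lborel) \<in> borel_measurable lborel"
    by measurable
  then show ?thesis by (simp add: riesz_potential_lborel[abs_def])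
qed

lemma riesz_kernel_lower:
  fixes z :: "real ^ 'n"
  assumes "0 < \<beta>" "\<beta> < real CARD('n)" "z \<noteq> 0" "norm z \<le> \<rho>"
  shows "riesz_const TYPE('n) \<beta> / \<rho> powr (real CARD('n) - \<beta>) \<le> riesz_kernel \<beta> z"
proof -
  have "norm z > 0" using assms by simp
  moreover from this have "\<rho> > 0" using assms by linarith
  ultimately show ?thesis
    unfolding riesz_kernel_eq using assms riesz_const_pos[OF assms(1,2)]
    by (intro divide_left_mono powr_mono2) (auto intro!: mult_pos_pos)
qed

lemma one_le_add_imp_squares:
  fixes a b :: ennreal
  assumes "1 \<le> a + b"
  shows "1 \<le> 4 * a\<^sup>2 + 2 * b"
proof (cases "a = top \<or> b = top")
  case True
  then show ?thesis by (auto simp: power2_eq_square ennreal_mult_top ennreal_top_mult)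
next
  case False
  then obtain r s where rs: "a = ennreal r" "b = ennreal s" "r \<ge> 0" "s \<ge> 0"
    by (metis ennreal_cases)
  then have "1 \<le> r + s" using assms by (simp flip: ennreal_plus ennreal_1)
  have "1 \<le> 4 * r\<^sup>2 + 2 * s"
  proof -
    have "0 \<le> (2 * r - 1)\<^sup>2" by simp
    then have "4 * r \<le> 4 * r\<^sup>2 + 1" by (simp add: power2_eq_square algebra_simps)
    with \<open>1 \<le> r + s\<close> rs show ?thesis by linarith
  qed
  then have "ennreal 1 \<le> ennreal (4 * r\<^sup>2 + 2 * s)" by (rule ennreal_leI)
  then show ?thesis using rs by (simp add: ennreal_plus ennreal_mult ennreal_power)
qed

text \<open>
  On the ball of radius \<open>\<rho>\<close> about \<open>x\<close> the kernel is at least its value at distance \<open>\<rho>\<close>, except at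
  \<open>y = x\<close>, where it is \<open>0\<close> by convention.
\<close>

lemma nn_integral_ball_le_riesz_potential:
  fixes x :: "real ^ 'n" and f :: "real ^ 'n \<Rightarrow> real"
  assumes \<beta>: "0 < \<beta>" "\<beta> < real CARD('n)" and \<rho>: "\<rho> > 0"
    and f[measurable]: "f \<in> borel_measurable borel" and f0: "\<And>y. f y \<ge> 0"
  shows "(\<integral>\<^sup>+ y. ennreal (f y) * indicator (ball x \<rho>) y \<partial>lborel)
    \<le> ennreal (\<rho> powr (real CARD('n) - \<beta>) / riesz_const TYPE('n) \<beta>) * riesz_potential \<beta> f x"
proof -
  let ?A = "riesz_const TYPE('n) \<beta>" and ?s = "\<rho> powr (real CARD('n) - \<beta>)"
  have A: "?A > 0" by (rule riesz_const_pos[OF \<beta>])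
  have s: "?s > 0" using \<rho> by simp
  have "(\<integral>\<^sup>+ y. ennreal (f y) * indicator (ball x \<rho>) y \<partial>lborel)
     \<le> (\<integral>\<^sup>+ y. ennreal (?s / ?A) * ennreal (riesz_kernel \<beta> (x - y) * f y) \<partial>lborel)"
  proof (rule nn_integral_mono_AE)
    have "AE y in lborel. y \<noteq> x" by (rule AE_lborel_singleton)
    then show "AE y in lborel. ennreal (f y) * indicator (ball x \<rho>) y \<le> ennreal (?s / ?A) * ennreal (riesz_kernel \<beta> (x - y) * f y)"
    proof eventually_elim
      case (elim y)
      show ?case
      proof (cases "y \<in> ball x \<rho>")
        case True
        then have "?A / ?s \<le> riesz_kernel \<beta> (x - y)" using elim
          by (intro riesz_kernel_lower[OF \<beta>]) (auto simp: dist_norm)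
        then have "1 \<le> (?s / ?A) * riesz_kernel \<beta> (x - y)" using A s by (simp add: field_simps)
        then have "1 * f y \<le> (?s / ?A) * riesz_kernel \<beta> (x - y) * f y" using f0 by (rule mult_right_mono)
        then show ?thesis using True A s f0[of y] riesz_kernel_nonneg[OF \<beta>, of "x - y"]
          by (simp add: ennreal_mult[symmetric] mult.assoc ennreal_leI)
      qed simp
    qed
  qed
  also have "\<dots> = ennreal (?s / ?A) * riesz_potential \<beta> f x"
    unfolding riesz_potential_lborel by (rule nn_integral_cmult) measurable
  finally show ?thesis .
qed

text \<open>
  If \<open>\<bar>u(x)\<bar> > 2 t\<close>, every \<open>h\<close> satisfies \<open>1 \<le> t\<^sup>-\<^sup>p \<bar>u(x + h)\<bar>\<^sup>p + t\<^sup>-\<^sup>2 (u(x + h) - u(x))\<^sup>2\<close>.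
  Averaging over \<open>\<bar>h\<bar> < \<rho>\<close> gives \<open>1 \<le> a(x) + b(x)\<close> with \<open>a\<close> a multiple of the potential, so in \<open>L\<^sup>2\<close>,
  and \<open>b\<close> in \<open>L\<^sup>1\<close>.  Therefore \<open>1 \<le> 4 a\<^sup>2 + 2 b\<close> on the superlevel set, which is integrated.
\<close>

lemma emeasure_superlevel_le:
  fixes u :: "real ^ 'n \<Rightarrow> real"
  assumes \<beta>: "0 < \<beta>" "\<beta> < real CARD('n)" and \<rho>: "\<rho> > 0" and t: "t > 0" and p: "p > 0"
    and u[measurable]: "u \<in> borel_measurable borel"
    and F: "(\<integral>\<^sup>+ x. (riesz_potential \<beta> (\<lambda>y. \<bar>u y\<bar> powr p) x)\<^sup>2 \<partial>lborel) \<le> ennreal B1" and B1: "B1 \<ge> 0"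
    and tr: "\<And>h. (\<integral>\<^sup>+ x. ennreal ((u (x + h) - u x)\<^sup>2) \<partial>lborel) \<le> ennreal ((norm h)\<^sup>2 * B2)" and B2: "B2 \<ge> 0"
  shows "emeasure lborel {x. \<bar>u x\<bar> > 2 * t}
    \<le> ennreal (4 / (riesz_const TYPE('n) \<beta> * unit_ball_vol (real CARD('n)))\<^sup>2 * B1 * (t powr (- p) * \<rho> powr (- \<beta>))\<^sup>2
        + 2 * B2 * (\<rho> / t)\<^sup>2)"
proof -
  let ?N = "real CARD('n)"
  define A where "A = riesz_const TYPE('n) \<beta>"
  have A: "A > 0" unfolding A_def by (rule riesz_const_pos[OF \<beta>])
  define V where "V = unit_ball_vol ?N"
  have V: "V > 0" by (simp add: V_def)
  define m where "m = V * \<rho> ^ CARD('n)"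
  have m: "m > 0" using V \<rho> by (simp add: m_def)
  have ball: "emeasure lborel (ball x \<rho>) = ennreal m" for x :: "real ^ 'n"
    using \<rho> by (simp add: emeasure_ball m_def V_def)
  define F where "F = riesz_potential \<beta> (\<lambda>y. \<bar>u y\<bar> powr p)"
  have [measurable]: "F \<in> borel_measurable borel" unfolding F_def by measurable
  define D where "D x = (\<integral>\<^sup>+ h. ennreal ((u (x + h) - u x)\<^sup>2) * indicator (ball 0 \<rho>) h \<partial>lborel)" for x
  have [measurable]: "D \<in> borel_measurable borel"
  proof -
    have "(\<lambda>x. \<integral>\<^sup>+ h. ennreal ((u (x + h) - u x)\<^sup>2) * indicator (ball 0 \<rho>) h \<partial>lborel) \<in> borel_measurable lborel"
      by measurable
    then show ?thesis by (simp add: D_def[abs_def])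
  qed
  define c where "c = t powr (- p) * \<rho> powr (- \<beta>) / (A * V)"
  have c: "c \<ge> 0" unfolding c_def using A V by simp
  define d where "d = 1 / (t\<^sup>2 * m)"
  have d: "d \<ge> 0" unfolding d_def using m t by simp
  let ?S = "{x. \<bar>u x\<bar> > 2 * t}"
  have ab: "1 \<le> ennreal c * F x + ennreal d * D x" if "x \<in> ?S" for x
  proof -
    have "(\<integral>\<^sup>+ h. ennreal (\<bar>u (x + h)\<bar> powr p) * indicator (ball 0 \<rho>) h \<partial>lborel)
       = (\<integral>\<^sup>+ y. ennreal (\<bar>u y\<bar> powr p) * indicator (ball x \<rho>) y \<partial>lborel)"
    proof -
      have "indicator (ball 0 \<rho>) h = (indicator (ball x \<rho>) (h + x) :: ennreal)" for h
        by (simp add: indicator_def dist_norm)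
      then show ?thesis
        using nn_integral_lborel_translate[of "\<lambda>y. ennreal (\<bar>u y\<bar> powr p) * indicator (ball x \<rho>) y" x]
        by (simp add: add.commute)
    qed
    also have "\<dots> \<le> ennreal (\<rho> powr (?N - \<beta>) / A) * F x"
      unfolding A_def F_def by (rule nn_integral_ball_le_riesz_potential[OF \<beta> \<rho>]) auto
    finally have q: "(\<integral>\<^sup>+ h. ennreal (\<bar>u (x + h)\<bar> powr p) * indicator (ball 0 \<rho>) h \<partial>lborel)
       \<le> ennreal (\<rho> powr (?N - \<beta>) / A) * F x" .
    have "ennreal m = (\<integral>\<^sup>+ h. indicator (ball 0 \<rho>) h \<partial>(lborel :: (real ^ 'n) measure))"
      using ball[of 0] by simp
    also have "\<dots> \<le> (\<integral>\<^sup>+ h. ennreal (t powr (- p)) * (ennreal (\<bar>u (x + h)\<bar> powr p) * indicator (ball 0 \<rho>) h)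
        + ennreal (1 / t\<^sup>2) * (ennreal ((u (x + h) - u x)\<^sup>2) * indicator (ball 0 \<rho>) h) \<partial>lborel)"
    proof (rule nn_integral_mono)
      fix h :: "real ^ 'n"
      have "1 \<le> t powr (- p) * \<bar>u (x + h)\<bar> powr p + 1 / t\<^sup>2 * (u (x + h) - u x)\<^sup>2"
      proof (cases "\<bar>u (x + h)\<bar> \<ge> t")
        case True
        then have "t powr p \<le> \<bar>u (x + h)\<bar> powr p" using t p by (intro powr_mono2) auto
        then have "1 \<le> t powr (- p) * \<bar>u (x + h)\<bar> powr p" using t by (simp add: powr_minus field_simps)
        moreover have "0 \<le> 1 / t\<^sup>2 * (u (x + h) - u x)\<^sup>2" by simp
        ultimately show ?thesis by linarith
      next
        case False
        then have "t \<le> \<bar>u (x + h) - u x\<bar>" using that by auto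
        then have "t\<^sup>2 \<le> \<bar>u (x + h) - u x\<bar>\<^sup>2" using t by (intro power_mono) auto
        then have "1 \<le> 1 / t\<^sup>2 * (u (x + h) - u x)\<^sup>2" using t by (simp add: field_simps)
        moreover have "0 \<le> t powr (- p) * \<bar>u (x + h)\<bar> powr p" by simp
        ultimately show ?thesis by linarith
      qed
      then have "ennreal 1 \<le> ennreal (t powr (- p) * \<bar>u (x + h)\<bar> powr p + 1 / t\<^sup>2 * (u (x + h) - u x)\<^sup>2)"
        by (rule ennreal_leI)
      also have "\<dots> = ennreal (t powr (- p)) * ennreal (\<bar>u (x + h)\<bar> powr p) + ennreal (1 / t\<^sup>2) * ennreal ((u (x + h) - u x)\<^sup>2)"
        by (subst ennreal_plus) (simp_all flip: ennreal_mult)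
      finally show "indicator (ball 0 \<rho>) h \<le> ennreal (t powr (- p)) * (ennreal (\<bar>u (x + h)\<bar> powr p) * indicator (ball 0 \<rho>) h)
        + ennreal (1 / t\<^sup>2) * (ennreal ((u (x + h) - u x)\<^sup>2) * indicator (ball 0 \<rho>) h)"
        by (cases "h \<in> ball 0 \<rho>") auto
    qed
    also have "\<dots> = ennreal (t powr (- p)) * (\<integral>\<^sup>+ h. ennreal (\<bar>u (x + h)\<bar> powr p) * indicator (ball 0 \<rho>) h \<partial>lborel)
        + ennreal (1 / t\<^sup>2) * D x"
      unfolding D_def by (subst nn_integral_add) (simp_all add: nn_integral_cmult)
    also have "\<dots> \<le> ennreal (t powr (- p)) * (ennreal (\<rho> powr (?N - \<beta>) / A) * F x) + ennreal (1 / t\<^sup>2) * D x"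
      by (intro add_right_mono mult_left_mono q) simp
    finally have "ennreal m \<le> ennreal (t powr (- p)) * (ennreal (\<rho> powr (?N - \<beta>) / A) * F x) + ennreal (1 / t\<^sup>2) * D x" .
    then have "ennreal (1 / m) * ennreal m \<le> ennreal (1 / m) * (ennreal (t powr (- p)) * (ennreal (\<rho> powr (?N - \<beta>) / A) * F x) + ennreal (1 / t\<^sup>2) * D x)"
      by (rule mult_left_mono) simp
    also have "ennreal (1 / m) * ennreal m = 1" using m by (simp flip: ennreal_mult)
    also have "ennreal (1 / m) * (ennreal (t powr (- p)) * (ennreal (\<rho> powr (?N - \<beta>) / A) * F x) + ennreal (1 / t\<^sup>2) * D x)
      = ennreal (1 / m * t powr (- p) * (\<rho> powr (?N - \<beta>) / A)) * F x + ennreal (1 / m * (1 / t\<^sup>2)) * D x"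
    proof -
      have "0 \<le> 1 / m" "0 \<le> t powr (- p)" "0 \<le> \<rho> powr (?N - \<beta>) / A" "0 \<le> 1 / t\<^sup>2"
        using m A by auto
      then show ?thesis by (simp only: ennreal_mult mult_nonneg_nonneg distrib_left mult.assoc)
    qed
    also have "1 / m * t powr (- p) * (\<rho> powr (?N - \<beta>) / A) = c"
      unfolding c_def m_def using \<rho> by (simp add: powr_diff powr_minus powr_realpow field_simps)
    also have "1 / m * (1 / t\<^sup>2) = d" by (simp add: d_def)
    finally show ?thesis .
  qed
  have "emeasure lborel ?S = (\<integral>\<^sup>+ x. indicator ?S x \<partial>lborel)" by simp
  also have "\<dots> \<le> (\<integral>\<^sup>+ x. 4 * (ennreal c * F x)\<^sup>2 + 2 * (ennreal d * D x) \<partial>lborel)"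
  proof (rule nn_integral_mono)
    fix x show "indicator ?S x \<le> 4 * (ennreal c * F x)\<^sup>2 + 2 * (ennreal d * D x)"
      using one_le_add_imp_squares[OF ab[of x]] by (cases "x \<in> ?S") auto
  qed
  also have "\<dots> = 4 * ennreal (c\<^sup>2) * (\<integral>\<^sup>+ x. (F x)\<^sup>2 \<partial>lborel) + 2 * ennreal d * (\<integral>\<^sup>+ x. D x \<partial>lborel)"
    using c by (subst nn_integral_add) (simp_all add: power_mult_distrib ennreal_power mult.assoc[symmetric] nn_integral_cmult)
  also have "\<dots> \<le> 4 * ennreal (c\<^sup>2) * ennreal B1 + 2 * ennreal d * ennreal (m * \<rho>\<^sup>2 * B2)"
  proof (intro add_mono mult_left_mono)
    show "(\<integral>\<^sup>+ x. (F x)\<^sup>2 \<partial>lborel) \<le> ennreal B1" using F by (simp add: F_def)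
    have "(\<integral>\<^sup>+ x. D x \<partial>lborel) = (\<integral>\<^sup>+ h. (\<integral>\<^sup>+ x. ennreal ((u (x + h) - u x)\<^sup>2) * indicator (ball 0 \<rho>) h \<partial>lborel) \<partial>lborel)"
      unfolding D_def by (rule lborel_pair.Fubini') measurable
    also have "\<dots> \<le> (\<integral>\<^sup>+ h. ennreal (\<rho>\<^sup>2 * B2) * indicator (ball (0 :: real ^ 'n) \<rho>) h \<partial>lborel)"
    proof (rule nn_integral_mono)
      fix h :: "real ^ 'n"
      have "(\<integral>\<^sup>+ x. ennreal ((u (x + h) - u x)\<^sup>2) * indicator (ball 0 \<rho>) h \<partial>lborel) \<le> ennreal ((norm h)\<^sup>2 * B2) * indicator (ball 0 \<rho>) h"
        using tr[of h] by (simp add: nn_integral_multc mult_right_mono)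
      also have "\<dots> \<le> ennreal (\<rho>\<^sup>2 * B2) * indicator (ball 0 \<rho>) h"
        using B2 by (auto simp: indicator_def intro!: ennreal_leI mult_right_mono power_mono)
      finally show "(\<integral>\<^sup>+ x. ennreal ((u (x + h) - u x)\<^sup>2) * indicator (ball 0 \<rho>) h \<partial>lborel) \<le> ennreal (\<rho>\<^sup>2 * B2) * indicator (ball 0 \<rho>) h" .
    qed
    also have "\<dots> = ennreal (\<rho>\<^sup>2 * B2) * ennreal m" by (simp add: nn_integral_cmult ball)
    also have "\<dots> = ennreal (m * \<rho>\<^sup>2 * B2)" using B2 m by (simp add: mult_ac flip: ennreal_mult)
    finally show "(\<integral>\<^sup>+ x. D x \<partial>lborel) \<le> ennreal (m * \<rho>\<^sup>2 * B2)" .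
  qed auto
  also have "\<dots> = ennreal (4 * c\<^sup>2 * B1 + 2 * d * (m * \<rho>\<^sup>2 * B2))"
    using c d B1 B2 m by (simp add: ennreal_plus ennreal_mult)
  also have "4 * c\<^sup>2 * B1 + 2 * d * (m * \<rho>\<^sup>2 * B2) = 4 / (A * V)\<^sup>2 * B1 * (t powr (- p) * \<rho> powr (- \<beta>))\<^sup>2 + 2 * B2 * (\<rho> / t)\<^sup>2"
    using m unfolding c_def d_def by (simp add: power_divide power_mult_distrib mult_ac)
  finally show ?thesis unfolding A_def V_def .
qed

text \<open>
  The choice \<open>\<rho> = s\<^bsup>(1 - p) / (1 + \<beta>)\<^esup>\<close>, \<open>s = t / 2\<close>, makes both terms of the previous bound
  proportional to \<open>s\<^sup>-\<^sup>q\<close>.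
\<close>

lemma emeasure_superlevel_le_powr:
  fixes u :: "real ^ 'n \<Rightarrow> real"
  assumes \<beta>: "0 < \<beta>" "\<beta> < real CARD('n)" and t: "t > 0" and p: "p > 0"
    and u: "u \<in> borel_measurable borel"
    and F: "(\<integral>\<^sup>+ x. (riesz_potential \<beta> (\<lambda>y. \<bar>u y\<bar> powr p) x)\<^sup>2 \<partial>lborel) \<le> ennreal B1" and B1: "B1 \<ge> 0"
    and tr: "\<And>h. (\<integral>\<^sup>+ x. ennreal ((u (x + h) - u x)\<^sup>2) \<partial>lborel) \<le> ennreal ((norm h)\<^sup>2 * B2)" and B2: "B2 \<ge> 0"
    and q: "q = 2 * (p + \<beta>) / (1 + \<beta>)"
  shows "emeasure lborel {x. \<bar>u x\<bar> > t}
    \<le> ennreal ((4 / (riesz_const TYPE('n) \<beta> * unit_ball_vol (real CARD('n)))\<^sup>2 * B1 + 2 * B2) * 2 powr q * t powr (- q))"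
proof -
  define s where "s = t / 2"
  have s: "s > 0" "t = 2 * s" using t by (auto simp: s_def)
  define \<rho> where "\<rho> = s powr ((1 - p) / (1 + \<beta>))"
  have \<rho>: "\<rho> > 0" using s by (simp add: \<rho>_def)
  have e1: "(s powr (- p) * \<rho> powr (- \<beta>))\<^sup>2 = s powr (- q)"
  proof -
    have "(s powr (- p) * \<rho> powr (- \<beta>))\<^sup>2 = s powr (2 * (- p + (1 - p) / (1 + \<beta>) * (- \<beta>)))"
      unfolding \<rho>_def powr_powr using s by (simp add: powr_add[symmetric] power2_eq_square algebra_simps)
    also have "2 * (- p + (1 - p) / (1 + \<beta>) * (- \<beta>)) = - q" unfolding q using \<beta> by (simp add: field_simps)
    finally show ?thesis .
  qed
  have e2: "(\<rho> / s)\<^sup>2 = s powr (- q)"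
  proof -
    have "(\<rho> / s)\<^sup>2 = (s powr ((1 - p) / (1 + \<beta>) - 1))\<^sup>2"
      unfolding \<rho>_def using s by (simp add: powr_diff)
    also have "\<dots> = s powr (2 * ((1 - p) / (1 + \<beta>) - 1))"
      using s by (simp add: powr_add[symmetric] power2_eq_square)
    also have "2 * ((1 - p) / (1 + \<beta>) - 1) = - q" unfolding q using \<beta> by (simp add: field_simps)
    finally show ?thesis .
  qed
  have e3: "2 powr q * t powr (- q) = s powr (- q)"
    unfolding s(2) using s(1) by (simp add: powr_mult powr_minus field_simps)
  show ?thesis
    using emeasure_superlevel_le[OF \<beta> \<rho> s(1) p u F B1 tr B2]
    unfolding e1 e2 s(2)[symmetric] mult.assoc e3 by (simp add: algebra_simps)
qed

lemma ennreal_le_suminf: "g k \<le> (\<Sum>k. g k :: ennreal)"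
  using sum_le_suminf[of g "{k}"] by simp

text \<open>
  Decompose dyadically: where \<open>2\<^sup>k t < f \<le> 2\<^sup>k\<^sup>+\<^sup>1 t\<close>, the integrand is at most \<open>(2\<^sup>k\<^sup>+\<^sup>1 t)\<^sup>p\<close>, and the
  resulting geometric series converges because \<open>p < q\<close>.
\<close>

lemma nn_integral_powr_tail_le:
  fixes f :: "'a \<Rightarrow> real"
  assumes f[measurable]: "f \<in> borel_measurable M"
    and weak: "\<And>t. t > 0 \<Longrightarrow> emeasure M {x \<in> space M. f x > t} \<le> ennreal (K * t powr (- q))"
    and K: "K \<ge> 0" and p: "0 < p" "p < q" and t: "t > 0"
  shows "(\<integral>\<^sup>+ x. ennreal (f x powr p) * indicator {x. f x > t} x \<partial>M)
    \<le> ennreal (K * 2 powr p / (1 - 2 powr (p - q)) * t powr (p - q))"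
proof -
  define r where "r = (2::real) powr (p - q)"
  have r: "0 < r" "r < 1" using p powr_less_mono[of "p - q" 0 2] by (auto simp: r_def)
  have "(\<integral>\<^sup>+ x. ennreal (f x powr p) * indicator {x. f x > t} x \<partial>M)
    \<le> (\<integral>\<^sup>+ x. (\<Sum>k. ennreal ((2 ^ Suc k * t) powr p) * indicator {x \<in> space M. f x > 2 ^ k * t} x) \<partial>M)"
  proof (rule nn_integral_mono)
    fix x assume x: "x \<in> space M"
    show "ennreal (f x powr p) * indicator {x. f x > t} x
      \<le> (\<Sum>k. ennreal ((2 ^ Suc k * t) powr p) * indicator {x \<in> space M. f x > 2 ^ k * t} x)"
    proof (cases "f x > t")
      case True
      obtain k0 where "f x / t < 2 ^ k0" using real_arch_pow[of 2 "f x / t"] by auto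
      then have "\<exists>k. f x \<le> 2 ^ Suc k * t" using t
        by (intro exI[of _ k0]) (auto simp: divide_less_eq intro: order_trans[OF less_imp_le])
      define k where "k = (LEAST k. f x \<le> 2 ^ Suc k * t)"
      have le: "f x \<le> 2 ^ Suc k * t" unfolding k_def by (rule LeastI_ex) fact
      have gt: "f x > 2 ^ k * t"
      proof (cases k)
        case (Suc j)
        then have "\<not> f x \<le> 2 ^ Suc j * t" using not_less_Least[of j "\<lambda>k. f x \<le> 2 ^ Suc k * t"] unfolding k_def by simp
        then show ?thesis using Suc by simp
      qed (use True in simp)
      have "ennreal (f x powr p) \<le> ennreal ((2 ^ Suc k * t) powr p) * indicator {x \<in> space M. f x > 2 ^ k * t} x"
        using x gt le True t p by (auto intro!: ennreal_leI powr_mono2)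
      also have "\<dots> \<le> (\<Sum>k. ennreal ((2 ^ Suc k * t) powr p) * indicator {x \<in> space M. f x > 2 ^ k * t} x)"
        by (rule ennreal_le_suminf)
      finally show ?thesis using True by simp
    qed simp
  qed
  also have "\<dots> = (\<Sum>k. \<integral>\<^sup>+ x. ennreal ((2 ^ Suc k * t) powr p) * indicator {x \<in> space M. f x > 2 ^ k * t} x \<partial>M)"
    by (rule nn_integral_suminf) measurable
  also have "\<dots> \<le> (\<Sum>k. ennreal (K * 2 powr p * t powr (p - q) * r ^ k))"
  proof (rule suminf_le)
    fix k
    have "(\<integral>\<^sup>+ x. ennreal ((2 ^ Suc k * t) powr p) * indicator {x \<in> space M. f x > 2 ^ k * t} x \<partial>M)
      = ennreal ((2 ^ Suc k * t) powr p) * emeasure M {x \<in> space M. f x > 2 ^ k * t}"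
      by (simp add: nn_integral_cmult_indicator)
    also have "\<dots> \<le> ennreal ((2 ^ Suc k * t) powr p) * ennreal (K * (2 ^ k * t) powr (- q))"
      using t by (intro mult_left_mono weak) auto
    also have "\<dots> = ennreal ((2 ^ Suc k * t) powr p * (K * (2 ^ k * t) powr (- q)))"
      using K by (simp add: ennreal_mult)
    also have "(2 ^ Suc k * t) powr p * (K * (2 ^ k * t) powr (- q)) = K * 2 powr p * t powr (p - q) * r ^ k"
    proof -
      have "r ^ k = (2 ^ k) powr (p - q)"
        unfolding r_def by (simp add: powr_power powr_realpow[symmetric] powr_powr mult.commute)
      then show ?thesis using t by (simp add: powr_mult powr_diff powr_minus field_simps)
    qed
    finally show "(\<integral>\<^sup>+ x. ennreal ((2 ^ Suc k * t) powr p) * indicator {x \<in> space M. f x > 2 ^ k * t} x \<partial>M)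
      \<le> ennreal (K * 2 powr p * t powr (p - q) * r ^ k)" .
  qed auto
  also have "\<dots> = ennreal (K * 2 powr p * t powr (p - q) * (1 / (1 - r)))"
    using r K t by (intro suminf_ennreal_eq sums_mult geometric_sums) auto
  finally show ?thesis unfolding r_def by (simp add: mult_ac)
qed

text \<open>
  The function \<open>1 / \<bar>z\<bar>\<close> satisfies a weak bound with exponent \<open>N\<close>, and the kernel is its power
  \<open>N - \<beta> < N\<close>; so this is an instance of the tail estimate.
\<close>

lemma riesz_kernel_locally_integrable:
  assumes \<beta>: "0 < \<beta>" "\<beta> < real CARD('n)" and r: "r > 0"
  shows "(\<integral>\<^sup>+ z. ennreal (riesz_kernel \<beta> z) * indicator (ball 0 r) (z :: real ^ 'n) \<partial>lborel) < \<infinity>"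
proof -
  let ?N = "real CARD('n)"
  define f where "f z = 1 / norm z" for z :: "real ^ 'n"
  have [measurable]: "f \<in> borel_measurable borel" unfolding f_def by measurable
  have "(\<integral>\<^sup>+ z. ennreal (riesz_kernel \<beta> z) * indicator (ball 0 r) (z :: real ^ 'n) \<partial>lborel)
     \<le> (\<integral>\<^sup>+ z. ennreal (riesz_const TYPE('n) \<beta>) * (ennreal (f z powr (?N - \<beta>)) * indicator {z. f z > 1 / r} z) \<partial>lborel)"
  proof (rule nn_integral_mono)
    fix z :: "real ^ 'n"
    show "ennreal (riesz_kernel \<beta> z) * indicator (ball 0 r) z
      \<le> ennreal (riesz_const TYPE('n) \<beta>) * (ennreal (f z powr (?N - \<beta>)) * indicator {z. f z > 1 / r} z)"
    proof (cases "z \<in> ball 0 r \<and> z \<noteq> 0")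
      case True
      then have "f z > 1 / r" using r by (simp add: f_def field_simps)
      moreover have "riesz_kernel \<beta> z = riesz_const TYPE('n) \<beta> * f z powr (?N - \<beta>)"
        by (simp add: riesz_kernel_eq f_def powr_divide)
      ultimately show ?thesis using True riesz_const_pos[OF \<beta>] by (simp add: ennreal_mult)
    next
      case False
      then show ?thesis by (auto simp: riesz_kernel_def)
    qed
  qed
  also have "\<dots> = ennreal (riesz_const TYPE('n) \<beta>) * (\<integral>\<^sup>+ z. ennreal (f z powr (?N - \<beta>)) * indicator {z. f z > 1 / r} z \<partial>lborel)"
    by (rule nn_integral_cmult) measurable
  also have "\<dots> < \<infinity>"
  proof -
    have "(\<integral>\<^sup>+ z. ennreal (f z powr (?N - \<beta>)) * indicator {z. f z > 1 / r} z \<partial>lborel)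
      \<le> ennreal (unit_ball_vol ?N * 2 powr (?N - \<beta>) / (1 - 2 powr ((?N - \<beta>) - ?N)) * (1 / r) powr ((?N - \<beta>) - ?N))"
    proof (rule nn_integral_powr_tail_le)
      fix t :: real assume t: "t > 0"
      have "emeasure lborel {z \<in> space lborel. f z > t} \<le> emeasure lborel (ball (0 :: real ^ 'n) (1 / t))"
      proof (rule emeasure_mono)
        show "{z \<in> space lborel. f z > t} \<subseteq> ball 0 (1 / t)"
        proof
          fix z :: "real ^ 'n" assume "z \<in> {z \<in> space lborel. f z > t}"
          then have z: "1 / norm z > t" by (simp add: f_def)
          then have "norm z > 0" using t by (cases "z = 0") auto
          with z t show "z \<in> ball 0 (1 / t)" by (simp add: field_simps)
        qed
      qed simp
      also have "\<dots> = ennreal (unit_ball_vol ?N * t powr (- ?N))"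
        using t by (simp add: emeasure_ball powr_minus powr_realpow power_one_over field_simps)
      finally show "emeasure lborel {z \<in> space lborel. f z > t} \<le> ennreal (unit_ball_vol ?N * t powr (- ?N))" .
    qed (use \<beta> r in auto)
    from le_less_trans[OF this ennreal_less_top] show ?thesis by (simp add: ennreal_mult_less_top)
  qed
  finally show ?thesis .
qed


section \<open>Local and weak convergence of potentials\<close>

lemma tendsto_zero_ennreal_approx:
  fixes x :: "nat \<Rightarrow> ennreal"
  assumes B: "B \<ge> 0"
    and approx: "\<And>\<delta>. \<delta> > 0 \<Longrightarrow> \<exists>a. a \<longlonglongrightarrow> 0 \<and> (\<forall>n. x n \<le> a n + ennreal (\<delta> * B))"
  shows "x \<longlonglongrightarrow> 0"
proof (rule tendsto_zero_ennreal)
  fix r :: real assume r: "r > 0"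
  define \<delta> where "\<delta> = r / (2 * (B + 1))"
  have \<delta>: "\<delta> > 0" using r B by (simp add: \<delta>_def)
  have \<delta>B: "\<delta> * B \<le> r / 2" unfolding \<delta>_def using r B by (simp add: field_simps)
  obtain a where a: "a \<longlonglongrightarrow> 0" "\<And>n. x n \<le> a n + ennreal (\<delta> * B)" using approx[OF \<delta>] by blast
  have "\<forall>\<^sub>F n in sequentially. a n < ennreal (r / 2)"
    using order_tendstoD(2)[OF a(1), of "ennreal (r / 2)"] r by simp
  then show "\<forall>\<^sub>F n in sequentially. x n < ennreal r"
  proof eventually_elim
    case (elim n)
    have "x n \<le> a n + ennreal (r / 2)" using a(2)[of n] \<delta>B by (meson add_left_mono ennreal_leI order_trans)
    also have "\<dots> < ennreal (r / 2) + ennreal (r / 2)" using elim by (subst add.commute, subst ennreal_add_left_cancel_less) auto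
    also have "\<dots> = ennreal r" using r by (simp flip: ennreal_plus)
    finally show ?case .
  qed
qed

lemma ennreal_mult_le_squares:
  fixes a b :: ennreal
  assumes "\<delta> > 0"
  shows "a * b \<le> ennreal \<delta> * b\<^sup>2 + ennreal (1 / \<delta>) * a\<^sup>2"
proof (cases "a = top \<or> b = top")
  case True
  then show ?thesis using assms by (auto simp: power2_eq_square ennreal_mult_top)
next
  case False
  then obtain r s where rs: "a = ennreal r" "b = ennreal s" "r \<ge> 0" "s \<ge> 0"
    by (metis ennreal_cases)
  have "r * s \<le> \<delta> * s\<^sup>2 + 1 / \<delta> * r\<^sup>2"
  proof -
    have "0 \<le> (\<delta> * s - r)\<^sup>2" by simp
    then have "2 * (\<delta> * (r * s)) \<le> \<delta>\<^sup>2 * s\<^sup>2 + r\<^sup>2" by (simp add: power2_eq_square algebra_simps)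
    moreover have "0 \<le> \<delta> * (r * s)" using rs assms by simp
    ultimately have "\<delta> * (r * s) \<le> \<delta>\<^sup>2 * s\<^sup>2 + r\<^sup>2" by linarith
    then have "\<delta> * (r * s) / \<delta> \<le> (\<delta>\<^sup>2 * s\<^sup>2 + r\<^sup>2) / \<delta>" using assms by (intro divide_right_mono) auto
    then show ?thesis using assms by (simp add: add_divide_distrib power2_eq_square)
  qed
  then have "ennreal (r * s) \<le> ennreal (\<delta> * s\<^sup>2 + 1 / \<delta> * r\<^sup>2)" by (rule ennreal_leI)
  also have "\<dots> = ennreal \<delta> * (ennreal s)\<^sup>2 + ennreal (1 / \<delta>) * (ennreal r)\<^sup>2"
    using rs assms ennreal_mult[of "1 / \<delta>" "r\<^sup>2"]
    by (simp only: ennreal_power) (subst ennreal_plus, auto simp: ennreal_mult)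
  finally show ?thesis using rs by (simp add: ennreal_mult)
qed

lemma AE_finite_of_square_integrable:
  fixes f :: "'a \<Rightarrow> ennreal"
  assumes [measurable]: "f \<in> borel_measurable M" and "(\<integral>\<^sup>+ x. (f x)\<^sup>2 \<partial>M) < \<infinity>"
  shows "AE x in M. f x < \<infinity>"
proof -
  have "AE x in M. (f x)\<^sup>2 \<noteq> \<infinity>" using assms(2) by (intro nn_integral_PInf_AE) auto
  then show ?thesis
  proof eventually_elim
    case (elim x)
    then show ?case by (cases "f x = top") (auto simp: power2_eq_square ennreal_mult_top less_top)
  qed
qed

lemma riesz_potential_mono:
  assumes \<beta>: "0 < \<beta>" "\<beta> < real CARD('n)" and "\<And>y :: real ^ 'n. f y \<le> g y"
  shows "riesz_potential \<beta> f x \<le> riesz_potential \<beta> g x"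
  unfolding riesz_potential_def
  using assms(3) by (intro nn_integral_mono ennreal_leI mult_left_mono riesz_kernel_nonneg[OF \<beta>])

lemma riesz_potential_add:
  assumes \<beta>: "0 < \<beta>" "\<beta> < real CARD('n)"
    and [measurable]: "f \<in> borel_measurable borel" "g \<in> borel_measurable borel"
    and "\<And>y :: real ^ 'n. f y \<ge> 0" "\<And>y. g y \<ge> 0"
  shows "riesz_potential \<beta> (\<lambda>y. f y + g y) x = riesz_potential \<beta> f x + riesz_potential \<beta> g x"
  unfolding riesz_potential_lborel distrib_left
  using assms(5,6) riesz_kernel_nonneg[OF \<beta>]
  by (subst nn_integral_add[symmetric]) (auto simp: ennreal_plus)

lemma riesz_potential_cmult:
  assumes "c \<ge> 0" and [measurable]: "f \<in> borel_measurable borel"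
  shows "riesz_potential \<beta> (\<lambda>y. c * f y) x = ennreal c * riesz_potential \<beta> f x"
  unfolding riesz_potential_lborel using assms(1)
  by (subst nn_integral_cmult[symmetric]) (auto simp: ennreal_mult' mult.left_commute)

lemma integral_riesz_potential_ball_le:
  fixes v :: "real ^ 'n \<Rightarrow> real"
  assumes \<beta>: "0 < \<beta>" "\<beta> < real CARD('n)" and v[measurable]: "v \<in> borel_measurable borel"
    and v0: "\<And>y. v y \<ge> 0" and supp: "\<And>y. y \<notin> ball 0 R \<Longrightarrow> v y = 0"
  shows "(\<integral>\<^sup>+ x. riesz_potential \<beta> v x * indicator (ball 0 r) x \<partial>lborel)
    \<le> (\<integral>\<^sup>+ z. ennreal (riesz_kernel \<beta> z) * indicator (ball (0 :: real ^ 'n) (r + R)) z \<partial>lborel)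
       * (\<integral>\<^sup>+ y. ennreal (v y) \<partial>lborel)" (is "_ \<le> ?\<kappa> * _")
proof -
  have "(\<integral>\<^sup>+ x. riesz_potential \<beta> v x * indicator (ball 0 r) x \<partial>lborel)
    = (\<integral>\<^sup>+ x. (\<integral>\<^sup>+ y. ennreal (riesz_kernel \<beta> (x - y) * v y) * indicator (ball 0 r) x \<partial>lborel) \<partial>lborel)"
    unfolding riesz_potential_lborel by (simp add: nn_integral_multc)
  also have "\<dots> = (\<integral>\<^sup>+ y. (\<integral>\<^sup>+ x. ennreal (riesz_kernel \<beta> (x - y) * v y) * indicator (ball 0 r) x \<partial>lborel) \<partial>lborel)"
    by (rule lborel_pair.Fubini') measurable
  also have "\<dots> \<le> (\<integral>\<^sup>+ y. ?\<kappa> * ennreal (v y) \<partial>lborel)"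
  proof (rule nn_integral_mono)
    fix y :: "real ^ 'n"
    show "(\<integral>\<^sup>+ x. ennreal (riesz_kernel \<beta> (x - y) * v y) * indicator (ball 0 r) x \<partial>lborel) \<le> ?\<kappa> * ennreal (v y)"
    proof (cases "y \<in> ball 0 R")
      case True
      have "(\<integral>\<^sup>+ x. ennreal (riesz_kernel \<beta> (x - y) * v y) * indicator (ball 0 r) x \<partial>lborel)
        \<le> (\<integral>\<^sup>+ x. (ennreal (riesz_kernel \<beta> (x - y)) * indicator (ball 0 (r + R)) (x - y)) * ennreal (v y) \<partial>lborel)"
      proof (rule nn_integral_mono)
        fix x :: "real ^ 'n"
        show "ennreal (riesz_kernel \<beta> (x - y) * v y) * indicator (ball 0 r) x
          \<le> (ennreal (riesz_kernel \<beta> (x - y)) * indicator (ball 0 (r + R)) (x - y)) * ennreal (v y)"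
        proof (cases "x \<in> ball 0 r")
          case x: True
          then have "x - y \<in> ball 0 (r + R)" using True norm_triangle_ineq4[of x y] by simp
          then show ?thesis using x v0[of y] riesz_kernel_nonneg[OF \<beta>, of "x - y"] by (simp add: ennreal_mult)
        qed simp
      qed
      also have "\<dots> = (\<integral>\<^sup>+ x. ennreal (riesz_kernel \<beta> (x - y)) * indicator (ball 0 (r + R)) (x - y) \<partial>lborel) * ennreal (v y)"
        by (rule nn_integral_multc) measurable
      also have "(\<integral>\<^sup>+ x. ennreal (riesz_kernel \<beta> (x - y)) * indicator (ball 0 (r + R)) (x - y) \<partial>lborel) = ?\<kappa>"
        using nn_integral_lborel_translate[of "\<lambda>z. ennreal (riesz_kernel \<beta> z) * indicator (ball 0 (r + R)) z" "- y"]
        by simp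
      finally show ?thesis .
    qed (simp add: supp)
  qed
  also have "\<dots> = ?\<kappa> * (\<integral>\<^sup>+ y. ennreal (v y) \<partial>lborel)"
    by (rule nn_integral_cmult) measurable
  finally show ?thesis .
qed

text \<open>
  If \<open>x, x'\<close> lie within \<open>R / 2\<close> of the origin and \<open>\<bar>y\<bar> \<ge> R\<close>, then \<open>\<bar>x' - y\<bar> \<le> 3 \<bar>x - y\<bar>\<close>, so the
  kernels at \<open>x\<close> and \<open>x'\<close> are comparable.
\<close>

lemma riesz_potential_exterior_comparison:
  fixes v :: "real ^ 'n \<Rightarrow> real"
  assumes \<beta>: "0 < \<beta>" "\<beta> < real CARD('n)" and v[measurable]: "v \<in> borel_measurable borel"
    and v0: "\<And>y. v y \<ge> 0" and x: "norm x < R / 2" "norm x' < R / 2"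
  shows "riesz_potential \<beta> (\<lambda>y. v y * indicator (- ball 0 R) y) x
    \<le> ennreal (3 powr (real CARD('n) - \<beta>)) * riesz_potential \<beta> v x'"
proof -
  let ?c = "3 powr (real CARD('n) - \<beta>)"
  have "riesz_potential \<beta> (\<lambda>y. v y * indicator (- ball 0 R) y) x
      \<le> (\<integral>\<^sup>+ y. ennreal ?c * ennreal (riesz_kernel \<beta> (x' - y) * v y) \<partial>lborel)"
    unfolding riesz_potential_lborel
  proof (rule nn_integral_mono)
    fix y :: "real ^ 'n"
    show "ennreal (riesz_kernel \<beta> (x - y) * (v y * indicator (- ball 0 R) y)) \<le> ennreal ?c * ennreal (riesz_kernel \<beta> (x' - y) * v y)"
    proof (cases "norm y \<ge> R")
      case True
      have "norm y \<le> norm x + norm (x - y)" "norm y \<le> norm x' + norm (x' - y)"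
        using norm_triangle_ineq4[of x "x - y"] norm_triangle_ineq4[of x' "x' - y"] by auto
      then have pos: "R / 2 < norm (x - y)" "R / 2 < norm (x' - y)" using True x by auto
      have R: "R > 0" using x norm_ge_zero[of x] by linarith
      have "norm (x' - y) \<le> norm x' + norm x + norm (x - y)"
        using norm_triangle_ineq[of "x' - x" "x - y"] norm_triangle_ineq4[of x' x] by simp
      then have "norm (x' - y) \<le> 3 * norm (x - y)" using pos x by linarith
      then have "norm (x' - y) powr (real CARD('n) - \<beta>) \<le> (3 * norm (x - y)) powr (real CARD('n) - \<beta>)"
        using \<beta> by (intro powr_mono2) auto
      then have le: "norm (x' - y) powr (real CARD('n) - \<beta>) \<le> ?c * norm (x - y) powr (real CARD('n) - \<beta>)"
        by (simp add: powr_mult)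
      have "norm (x' - y) > 0" "norm (x - y) > 0" using pos R by linarith+
      then have p: "norm (x' - y) powr (real CARD('n) - \<beta>) > 0" "norm (x - y) powr (real CARD('n) - \<beta>) > 0"
        by auto
      have "riesz_kernel \<beta> (x - y) \<le> ?c * riesz_kernel \<beta> (x' - y)"
        unfolding riesz_kernel_eq using le p riesz_const_pos[OF \<beta>] by (simp add: field_simps)
      then have "riesz_kernel \<beta> (x - y) * v y \<le> ?c * riesz_kernel \<beta> (x' - y) * v y"
        using v0 by (rule mult_right_mono)
      then show ?thesis using True v0[of y] riesz_kernel_nonneg[OF \<beta>, of "x' - y"]
        by (simp add: ennreal_mult[symmetric] mult.assoc ennreal_leI)
    qed simp
  qed
  also have "\<dots> = ennreal ?c * riesz_potential \<beta> v x'"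
    unfolding riesz_potential_lborel by (rule nn_integral_cmult) measurable
  finally show ?thesis .
qed

text \<open>
  Average the comparison over \<open>x'\<close> in the ball of radius \<open>R / 2\<close>, and bound the potential at \<open>x'\<close>
  by \<open>\<delta>\<close> plus its square over \<open>\<delta>\<close>.  The condition on \<open>R\<close> makes the measure of the ball so large that
  the square contributes at most another \<open>\<delta>\<close>.
\<close>

lemma riesz_potential_exterior_le:
  fixes v :: "real ^ 'n \<Rightarrow> real"
  assumes \<beta>: "0 < \<beta>" "\<beta> < real CARD('n)" and v[measurable]: "v \<in> borel_measurable borel"
    and v0: "\<And>y. v y \<ge> 0" and x: "norm x < R / 2" and \<delta>: "\<delta> > 0"
    and G: "(\<integral>\<^sup>+ x. (riesz_potential \<beta> v x)\<^sup>2 \<partial>lborel) \<le> ennreal B" and B: "B \<ge> 0"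
    and R: "B \<le> \<delta>\<^sup>2 * (unit_ball_vol (real CARD('n)) * (R / 2) ^ CARD('n))"
  shows "riesz_potential \<beta> (\<lambda>y. v y * indicator (- ball 0 R) y) x
    \<le> ennreal (3 powr (real CARD('n) - \<beta>) * (2 * \<delta>))"
proof -
  let ?c = "3 powr (real CARD('n) - \<beta>)"
  define m where "m = unit_ball_vol (real CARD('n)) * (R / 2) ^ CARD('n)"
  have R0: "R > 0" using x norm_ge_zero[of x] by linarith
  then have m: "m > 0" by (simp add: m_def)
  have ball: "emeasure lborel (ball (0 :: real ^ 'n) (R / 2)) = ennreal m"
    using R0 by (simp add: emeasure_ball m_def)
  let ?W = "riesz_potential \<beta> (\<lambda>y. v y * indicator (- ball 0 R) y) x"
  have "?W * ennreal m = (\<integral>\<^sup>+ x'. ?W * indicator (ball (0 :: real ^ 'n) (R / 2)) x' \<partial>lborel)"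
    by (simp add: nn_integral_cmult ball)
  also have "\<dots> \<le> (\<integral>\<^sup>+ x'. ennreal ?c * (ennreal \<delta> * indicator (ball 0 (R / 2)) x' + ennreal (1 / \<delta>) * (riesz_potential \<beta> v x')\<^sup>2) \<partial>lborel)"
  proof (rule nn_integral_mono)
    fix x' :: "real ^ 'n"
    show "?W * indicator (ball (0 :: real ^ 'n) (R / 2)) x' \<le> ennreal ?c * (ennreal \<delta> * indicator (ball 0 (R / 2)) x' + ennreal (1 / \<delta>) * (riesz_potential \<beta> v x')\<^sup>2)"
    proof (cases "x' \<in> ball 0 (R / 2)")
      case True
      then have "?W \<le> ennreal ?c * riesz_potential \<beta> v x'"
        by (intro riesz_potential_exterior_comparison[OF \<beta> v v0 x]) simp
      also have "riesz_potential \<beta> v x' \<le> ennreal \<delta> + ennreal (1 / \<delta>) * (riesz_potential \<beta> v x')\<^sup>2"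
        using ennreal_mult_le_squares[OF \<delta>, of "riesz_potential \<beta> v x'" 1] by simp
      finally show ?thesis using True by (simp add: mult_left_mono)
    qed simp
  qed
  also have "\<dots> = ennreal ?c * (ennreal \<delta> * ennreal m + ennreal (1 / \<delta>) * (\<integral>\<^sup>+ x. (riesz_potential \<beta> v x)\<^sup>2 \<partial>lborel))"
    by (simp add: nn_integral_cmult nn_integral_add ball)
  also have "\<dots> \<le> ennreal ?c * (ennreal \<delta> * ennreal m + ennreal (1 / \<delta>) * ennreal B)"
    by (intro mult_left_mono add_left_mono G) auto
  also have "\<dots> = ennreal (?c * (\<delta> * m + 1 / \<delta> * B))"
  proof -
    have "0 \<le> \<delta>" "0 \<le> m" "0 \<le> 1 / \<delta>" "0 \<le> ?c" using \<delta> m by auto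
    with B show ?thesis by (simp only: ennreal_mult ennreal_plus mult_nonneg_nonneg add_nonneg_nonneg)
  qed
  also have "\<dots> \<le> ennreal (?c * (2 * \<delta>) * m)"
  proof (rule ennreal_leI)
    have "B / \<delta> \<le> \<delta>\<^sup>2 * m / \<delta>" using R \<delta> unfolding m_def by (intro divide_right_mono) auto
    then have "\<delta> * m + 1 / \<delta> * B \<le> 2 * \<delta> * m" using \<delta> by (simp add: power2_eq_square)
    from mult_left_mono[OF this, of ?c] show "?c * (\<delta> * m + 1 / \<delta> * B) \<le> ?c * (2 * \<delta>) * m"
      by (simp add: mult.assoc)
  qed
  also have "\<dots> = ennreal (?c * (2 * \<delta>)) * ennreal m" using m \<delta> by (simp add: ennreal_mult)
  finally have "?W * ennreal m \<le> ennreal (?c * (2 * \<delta>)) * ennreal m" .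
  from mult_right_mono[OF this, of "ennreal (1 / m)"] m show ?thesis
    by (simp add: mult.assoc flip: ennreal_mult)
qed

text \<open>
  Cut \<open>v\<^sub>n\<close> at a large sphere: the inner part has a potential controlled by its integral, because the
  kernel is locally integrable; the outer part is uniformly small by the preceding lemma.
\<close>

lemma riesz_potential_tendsto_zero_L1_loc:
  fixes v :: "nat \<Rightarrow> real ^ 'n \<Rightarrow> real"
  assumes \<beta>: "0 < \<beta>" "\<beta> < real CARD('n)" and v[measurable]: "\<And>n. v n \<in> borel_measurable borel"
    and v0: "\<And>n y. v n y \<ge> 0"
    and lim: "\<And>R. (\<lambda>n. \<integral>\<^sup>+ y. ennreal (v n y) * indicator (ball 0 R) y \<partial>lborel) \<longlonglongrightarrow> 0"
    and G: "\<And>n. (\<integral>\<^sup>+ x. (riesz_potential \<beta> (v n) x)\<^sup>2 \<partial>lborel) \<le> ennreal B" and B: "B \<ge> 0"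
    and r: "r > 0"
  shows "(\<lambda>n. \<integral>\<^sup>+ x. riesz_potential \<beta> (v n) x * indicator (ball 0 r) x \<partial>lborel) \<longlonglongrightarrow> 0"
proof -
  let ?N = "real CARD('n)"
  define V where "V = unit_ball_vol ?N"
  have V: "V > 0" by (simp add: V_def)
  let ?c = "3 powr (?N - \<beta>)"
  define m where "m = V * r ^ CARD('n)"
  have ball: "emeasure lborel (ball (0 :: real ^ 'n) r) = ennreal m"
    using r by (simp add: emeasure_ball m_def V_def)
  have m: "m \<ge> 0" using V r by (simp add: m_def)
  show ?thesis
  proof (rule tendsto_zero_ennreal_approx)
    show "2 * ?c * m \<ge> 0" using m by simp
    fix \<delta> :: real assume \<delta>: "\<delta> > 0"
    (* the cut is at radius 2 S; S \<ge> 1 gives S \<le> S^N, so S is large enough for the exterior bound *)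
    define S where "S = max (max r 1) (B / (\<delta>\<^sup>2 * V))"
    have S: "S \<ge> r" "S \<ge> 1" "S \<ge> B / (\<delta>\<^sup>2 * V)" by (auto simp: S_def)
    have "S \<le> S ^ CARD('n)" using S(2) by (intro self_le_power) auto
    with S(3) have "B / (\<delta>\<^sup>2 * V) \<le> S ^ CARD('n)" by linarith
    then have RB: "B \<le> \<delta>\<^sup>2 * (V * (2 * S / 2) ^ CARD('n))" using \<delta> V by (simp add: field_simps)
    define \<kappa> where "\<kappa> = (\<integral>\<^sup>+ z. ennreal (riesz_kernel \<beta> z) * indicator (ball (0 :: real ^ 'n) (r + 2 * S)) z \<partial>lborel)"
    have \<kappa>: "\<kappa> < \<infinity>" unfolding \<kappa>_def using r S by (intro riesz_kernel_locally_integrable[OF \<beta>]) auto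
    define a where "a n = \<kappa> * (\<integral>\<^sup>+ y. ennreal (v n y) * indicator (ball 0 (2 * S)) y \<partial>lborel)" for n
    have "a \<longlonglongrightarrow> \<kappa> * 0" unfolding a_def using \<kappa> by (intro ennreal_tendsto_cmult lim) auto
    moreover have "(\<integral>\<^sup>+ x. riesz_potential \<beta> (v n) x * indicator (ball 0 r) x \<partial>lborel) \<le> a n + ennreal (\<delta> * (2 * ?c * m))" for n
    proof -
      define vn where "vn y = v n y * indicator (ball 0 (2 * S)) y" for y
      define vf where "vf y = v n y * indicator (- ball 0 (2 * S)) y" for y
      have [measurable]: "vn \<in> borel_measurable borel" "vf \<in> borel_measurable borel"
        unfolding vn_def vf_def by measurable
      have "v n = (\<lambda>y. vn y + vf y)" unfolding vn_def vf_def by (auto simp: indicator_def)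
      then have split: "riesz_potential \<beta> (v n) x = riesz_potential \<beta> vn x + riesz_potential \<beta> vf x" for x
        using riesz_potential_add[OF \<beta>, of vn vf x] v0 by (simp add: vn_def vf_def)
      have "(\<integral>\<^sup>+ x. riesz_potential \<beta> (v n) x * indicator (ball 0 r) x \<partial>lborel)
        = (\<integral>\<^sup>+ x. riesz_potential \<beta> vn x * indicator (ball 0 r) x \<partial>lborel)
        + (\<integral>\<^sup>+ x. riesz_potential \<beta> vf x * indicator (ball 0 r) x \<partial>lborel)"
        unfolding split distrib_right by (rule nn_integral_add) measurable
      also have "\<dots> \<le> a n + ennreal (\<delta> * (2 * ?c * m))"
      proof (rule add_mono)
        have "(\<integral>\<^sup>+ x. riesz_potential \<beta> vn x * indicator (ball 0 r) x \<partial>lborel) \<le> \<kappa> * (\<integral>\<^sup>+ y. ennreal (vn y) \<partial>lborel)"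
          unfolding \<kappa>_def by (rule integral_riesz_potential_ball_le[OF \<beta>]) (auto simp: vn_def v0)
        also have "(\<integral>\<^sup>+ y. ennreal (vn y) \<partial>lborel) = (\<integral>\<^sup>+ y. ennreal (v n y) * indicator (ball 0 (2 * S)) y \<partial>lborel)"
          by (intro nn_integral_cong) (auto simp: vn_def indicator_def)
        finally show "(\<integral>\<^sup>+ x. riesz_potential \<beta> vn x * indicator (ball 0 r) x \<partial>lborel) \<le> a n" unfolding a_def .
        have "(\<integral>\<^sup>+ x. riesz_potential \<beta> vf x * indicator (ball 0 r) x \<partial>lborel)
          \<le> (\<integral>\<^sup>+ x. ennreal (?c * (2 * \<delta>)) * indicator (ball (0 :: real ^ 'n) r) x \<partial>lborel)"
        proof (rule nn_integral_mono)
          fix x :: "real ^ 'n"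
          show "riesz_potential \<beta> vf x * indicator (ball 0 r) x \<le> ennreal (?c * (2 * \<delta>)) * indicator (ball (0 :: real ^ 'n) r) x"
          proof (cases "x \<in> ball 0 r")
            case True
            then have "norm x < 2 * S / 2" using S by simp
            from riesz_potential_exterior_le[OF \<beta> v v0 this \<delta> G B RB[unfolded V_def]]
            show ?thesis using True by (simp add: vf_def[abs_def])
          qed simp
        qed
        also have "\<dots> = ennreal (?c * (2 * \<delta>)) * ennreal m" by (simp add: nn_integral_cmult ball)
        also have "\<dots> = ennreal (\<delta> * (2 * ?c * m))" using \<delta> m by (simp add: mult_ac flip: ennreal_mult)
        finally show "(\<integral>\<^sup>+ x. riesz_potential \<beta> vf x * indicator (ball 0 r) x \<partial>lborel) \<le> ennreal (\<delta> * (2 * ?c * m))" .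
      qed
      finally show ?thesis .
    qed
    ultimately show "\<exists>a. a \<longlonglongrightarrow> 0 \<and> (\<forall>n. (\<integral>\<^sup>+ x. riesz_potential \<beta> (v n) x * indicator (ball 0 r) x \<partial>lborel) \<le> a n + ennreal (\<delta> * (2 * ?c * m)))"
      by (intro exI[of _ a]) auto
  qed
qed

text \<open>
  \<open>T k\<close> is what remains of \<open>F\<close> after removing its bounded part on a ball.  The removed part pairs
  with \<open>G\<^sub>n\<close> to \<open>0\<close> by local convergence, and \<open>T k\<close> is small in \<open>L\<^sup>2\<close>.
\<close>

lemma nn_integral_mult_tendsto_zero:
  fixes F :: "'a::euclidean_space \<Rightarrow> ennreal"
  assumes F[measurable]: "F \<in> borel_measurable borel" and F2: "(\<integral>\<^sup>+ x. (F x)\<^sup>2 \<partial>lborel) < \<infinity>"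
    and G[measurable]: "\<And>n. G n \<in> borel_measurable borel"
    and G2: "\<And>n. (\<integral>\<^sup>+ x. (G n x)\<^sup>2 \<partial>lborel) \<le> ennreal B" and B: "B \<ge> 0"
    and lim: "\<And>r. r > 0 \<Longrightarrow> (\<lambda>n. \<integral>\<^sup>+ x. G n x * indicator (ball 0 r) x \<partial>lborel) \<longlonglongrightarrow> 0"
  shows "(\<lambda>n. \<integral>\<^sup>+ x. F x * G n x \<partial>lborel) \<longlonglongrightarrow> 0"
proof -
  define T where "T k x = (if norm x < real k \<and> F x \<le> of_nat k then 0 else F x)" for k x
  have [measurable]: "T k \<in> borel_measurable borel" for k unfolding T_def by measurable
  have "(\<lambda>k. \<integral>\<^sup>+ x. (T k x)\<^sup>2 \<partial>lborel) \<longlonglongrightarrow> (\<integral>\<^sup>+ x. 0 \<partial>(lborel :: 'a measure))"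
  proof (rule nn_integral_dominated_convergence[OF _ _ _ _ F2])
    show "AE x in lborel. (T k x)\<^sup>2 \<le> (F x)\<^sup>2" for k by (rule AE_I2) (auto simp: T_def)
    have "AE x in lborel. F x < \<infinity>" using F2 by (intro AE_finite_of_square_integrable) auto
    then show "AE x in lborel. (\<lambda>k. (T k x)\<^sup>2) \<longlonglongrightarrow> 0"
    proof eventually_elim
      case (elim x)
      then obtain f where f: "F x = ennreal f" "f \<ge> 0" by (metis ennreal_cases less_irrefl infinity_ennreal_def)
      obtain k0 where k0: "max f (norm x + 1) \<le> real k0" using real_arch_simple by blast
      have "\<forall>\<^sub>F k in sequentially. (T k x)\<^sup>2 = 0"
        using eventually_ge_at_top[of k0]
      proof eventually_elim
        case (elim k)
        then have "norm x < real k" "f \<le> real k" using k0 by auto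
        then show ?case using f by (simp add: T_def ennreal_of_nat_eq_real_of_nat)
      qed
      then show ?case by (rule tendsto_eventually)
    qed
  qed auto
  then have T: "(\<lambda>k. \<integral>\<^sup>+ x. (T k x)\<^sup>2 \<partial>lborel) \<longlonglongrightarrow> 0" by simp
  show ?thesis
  proof (rule tendsto_zero_ennreal_approx)
    show "B + 1 \<ge> 0" using B by simp
    fix \<delta> :: real assume \<delta>: "\<delta> > 0"
    have "\<forall>\<^sub>F k in sequentially. (\<integral>\<^sup>+ x. (T k x)\<^sup>2 \<partial>lborel) < ennreal (\<delta>\<^sup>2)"
      using order_tendstoD(2)[OF T, of "ennreal (\<delta>\<^sup>2)"] \<delta> by simp
    with eventually_gt_at_top[of 0] have "\<forall>\<^sub>F k in sequentially. k > 0 \<and> (\<integral>\<^sup>+ x. (T k x)\<^sup>2 \<partial>lborel) < ennreal (\<delta>\<^sup>2)"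
      by (rule eventually_conj)
    from eventually_happens'[OF sequentially_bot this]
    obtain k where k: "k > 0" "(\<integral>\<^sup>+ x. (T k x)\<^sup>2 \<partial>lborel) < ennreal (\<delta>\<^sup>2)"
      by blast
    define a where "a n = of_nat k * (\<integral>\<^sup>+ x. G n x * indicator (ball 0 (real k)) x \<partial>lborel)" for n
    have "a \<longlonglongrightarrow> of_nat k * 0" unfolding a_def using k by (intro ennreal_tendsto_cmult lim) (auto simp: of_nat_less_top)
    moreover have "(\<integral>\<^sup>+ x. F x * G n x \<partial>lborel) \<le> a n + ennreal (\<delta> * (B + 1))" for n
    proof -
      have "(\<integral>\<^sup>+ x. F x * G n x \<partial>lborel) \<le> (\<integral>\<^sup>+ x. of_nat k * (G n x * indicator (ball 0 (real k)) x)
          + (ennreal \<delta> * (G n x)\<^sup>2 + ennreal (1 / \<delta>) * (T k x)\<^sup>2) \<partial>lborel)"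
      proof (rule nn_integral_mono)
        fix x :: 'a
        show "F x * G n x \<le> of_nat k * (G n x * indicator (ball 0 (real k)) x)
          + (ennreal \<delta> * (G n x)\<^sup>2 + ennreal (1 / \<delta>) * (T k x)\<^sup>2)"
        proof (cases "norm x < real k \<and> F x \<le> of_nat k")
          case True
          then have "F x * G n x \<le> of_nat k * (G n x * indicator (ball 0 (real k)) x)"
            by (auto intro: mult_right_mono)
          then show ?thesis by (rule order_trans) simp
        next
          case False
          then have "F x * G n x = T k x * G n x" by (auto simp: T_def)
          also have "\<dots> \<le> ennreal \<delta> * (G n x)\<^sup>2 + ennreal (1 / \<delta>) * (T k x)\<^sup>2"
            by (rule ennreal_mult_le_squares[OF \<delta>])
          finally show ?thesis by (rule order_trans) simp
        qed
      qed
      also have "\<dots> = a n + (ennreal \<delta> * (\<integral>\<^sup>+ x. (G n x)\<^sup>2 \<partial>lborel) + ennreal (1 / \<delta>) * (\<integral>\<^sup>+ x. (T k x)\<^sup>2 \<partial>lborel))"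
        unfolding a_def by (simp add: nn_integral_add nn_integral_cmult)
      also have "\<dots> \<le> a n + (ennreal \<delta> * ennreal B + ennreal (1 / \<delta>) * ennreal (\<delta>\<^sup>2))"
        using k(2) by (intro add_left_mono add_mono mult_left_mono G2) auto
      also have "ennreal \<delta> * ennreal B + ennreal (1 / \<delta>) * ennreal (\<delta>\<^sup>2) = ennreal (\<delta> * B + 1 / \<delta> * \<delta>\<^sup>2)"
      proof -
        have "0 \<le> \<delta>" "0 \<le> 1 / \<delta>" "0 \<le> \<delta>\<^sup>2" using \<delta> by auto
        with B show ?thesis by (simp only: ennreal_mult ennreal_plus mult_nonneg_nonneg)
      qed
      also have "\<delta> * B + 1 / \<delta> * \<delta>\<^sup>2 = \<delta> * (B + 1)" using \<delta> by (simp add: power2_eq_square algebra_simps)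
      finally show ?thesis .
    qed
    ultimately show "\<exists>a. a \<longlonglongrightarrow> 0 \<and> (\<forall>n. (\<integral>\<^sup>+ x. F x * G n x \<partial>lborel) \<le> a n + ennreal (\<delta> * (B + 1)))"
      by (intro exI[of _ a]) auto
  qed
qed


section \<open>The Brezis-Lieb splitting\<close>

lemma tendsto_ennreal_of_close:
  fixes L :: "nat \<Rightarrow> ennreal"
  assumes J: "J < \<infinity>" and e: "e \<longlonglongrightarrow> 0"
    and "\<And>n. L n \<le> J + e n" "\<And>n. J \<le> L n + e n"
  shows "L \<longlonglongrightarrow> J"
proof (rule tendsto_sandwich)
  show "(\<lambda>n. J - e n) \<longlonglongrightarrow> J" using tendsto_diff_ennreal[OF tendsto_const e, of J] J by simp
  show "(\<lambda>n. J + e n) \<longlonglongrightarrow> J" using tendsto_add[OF tendsto_const e, of J] by simp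
  show "\<forall>\<^sub>F n in sequentially. J - e n \<le> L n"
    using assms(4) J by (auto simp: ennreal_minus_le_iff add.commute intro!: always_eventually)
  show "\<forall>\<^sub>F n in sequentially. L n \<le> J + e n" using assms(3) by simp
qed

lemma ennreal_add_square_le: "(a + b)\<^sup>2 \<le> 2 * a\<^sup>2 + 2 * (b :: ennreal)\<^sup>2"
proof (cases "a = top \<or> b = top")
  case True
  then show ?thesis by (auto simp: power2_eq_square ennreal_mult_top)
next
  case False
  then obtain r s where rs: "a = ennreal r" "b = ennreal s" "r \<ge> 0" "s \<ge> 0"
    by (metis ennreal_cases)
  have "(r + s)\<^sup>2 \<le> 2 * r\<^sup>2 + 2 * s\<^sup>2" using sum_squares_bound[of r s] by (simp add: power2_eq_square algebra_simps)
  then have "ennreal ((r + s)\<^sup>2) \<le> ennreal (2 * r\<^sup>2 + 2 * s\<^sup>2)" by (rule ennreal_leI)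
  also have "\<dots> = 2 * (ennreal r)\<^sup>2 + 2 * (ennreal s)\<^sup>2"
    using rs by (simp add: ennreal_plus ennreal_mult ennreal_power)
  also have "ennreal ((r + s)\<^sup>2) = (a + b)\<^sup>2" using rs by (simp add: ennreal_power flip: ennreal_plus)
  finally show ?thesis using rs by simp
qed

lemma abs_add_powr_le:
  fixes a b p \<delta> :: real
  assumes p: "p > 0" and \<delta>: "\<delta> > 0"
  shows "\<bar>a + b\<bar> powr p \<le> (1 + \<delta>) powr p * \<bar>a\<bar> powr p + (1 + 1 / \<delta>) powr p * \<bar>b\<bar> powr p"
proof (cases "\<bar>b\<bar> \<le> \<delta> * \<bar>a\<bar>")
  case True
  then have "\<bar>a + b\<bar> \<le> (1 + \<delta>) * \<bar>a\<bar>" using abs_triangle_ineq[of a b] by (simp add: algebra_simps)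
  then have "\<bar>a + b\<bar> powr p \<le> ((1 + \<delta>) * \<bar>a\<bar>) powr p" using p by (intro powr_mono2) auto
  also have "\<dots> = (1 + \<delta>) powr p * \<bar>a\<bar> powr p" using \<delta> by (simp add: powr_mult)
  finally show ?thesis by (rule order_trans) simp
next
  case False
  then have "\<bar>a\<bar> \<le> 1 / \<delta> * \<bar>b\<bar>" using \<delta> by (simp add: field_simps)
  then have "\<bar>a + b\<bar> \<le> (1 + 1 / \<delta>) * \<bar>b\<bar>" using abs_triangle_ineq[of a b] by (simp add: algebra_simps)
  then have "\<bar>a + b\<bar> powr p \<le> ((1 + 1 / \<delta>) * \<bar>b\<bar>) powr p" using p by (intro powr_mono2) auto
  also have "\<dots> = (1 + 1 / \<delta>) powr p * \<bar>b\<bar> powr p" using \<delta> by (intro powr_mult)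
  finally show ?thesis by (rule order_trans) simp
qed

text \<open>
  Choose \<open>\<delta>\<close> with \<open>(1 + \<delta>)\<^sup>p = 1 + \<epsilon>\<close> in the preceding inequality, and apply it to \<open>a + b\<close> and to
  \<open>a = (a + b) - b\<close>.
\<close>

lemma abs_powr_splitting:
  fixes p \<epsilon> :: real
  assumes p: "p > 0" and \<epsilon>: "\<epsilon> > 0"
  obtains C where "C \<ge> 0"
    "\<And>a b :: real. \<bar>\<bar>a + b\<bar> powr p - \<bar>a\<bar> powr p - \<bar>b\<bar> powr p\<bar> \<le> \<epsilon> * \<bar>a\<bar> powr p + C * \<bar>b\<bar> powr p"
proof -
  define \<delta> where "\<delta> = (1 + \<epsilon>) powr (1 / p) - 1"
  have "1 < (1 + \<epsilon>) powr (1 / p)" using \<epsilon> p by (intro gr_one_powr) auto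
  then have \<delta>: "\<delta> > 0" by (simp add: \<delta>_def)
  have \<delta>p: "(1 + \<delta>) powr p = 1 + \<epsilon>" using \<epsilon> p by (simp add: \<delta>_def powr_powr)
  define C where "C = (1 + 1 / \<delta>) powr p"
  have C: "C \<ge> 0" by (simp add: C_def)
  have up: "\<bar>a + b\<bar> powr p \<le> (1 + \<epsilon>) * \<bar>a\<bar> powr p + C * \<bar>b\<bar> powr p" for a b
    using abs_add_powr_le[OF p \<delta>, of a b] unfolding \<delta>p C_def .
  have "\<bar>\<bar>a + b\<bar> powr p - \<bar>a\<bar> powr p - \<bar>b\<bar> powr p\<bar> \<le> \<epsilon> * \<bar>a\<bar> powr p + (C + 1) * \<bar>b\<bar> powr p" for a b
  proof -
    define X Y Z where "X = \<bar>a\<bar> powr p" and "Y = \<bar>b\<bar> powr p" and "Z = \<bar>a + b\<bar> powr p"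
    have nn: "X \<ge> 0" "Y \<ge> 0" "Z \<ge> 0" by (auto simp: X_def Y_def Z_def)
    have 1: "Z \<le> (1 + \<epsilon>) * X + C * Y" using up[of a b] by (simp add: X_def Y_def Z_def)
    have 2: "X \<le> (1 + \<epsilon>) * Z + C * Y" using up[of "a + b" "- b"] by (simp add: X_def Y_def Z_def)
    have "X - Z \<le> \<epsilon> * X + C * Y"
    proof (cases "X \<le> Z")
      case True
      then show ?thesis using nn C \<epsilon> by (smt (verit) mult_nonneg_nonneg)
    next
      case False
      then have "\<epsilon> * Z \<le> \<epsilon> * X" using \<epsilon> by (intro mult_left_mono) auto
      then show ?thesis using 2 by (simp add: algebra_simps)
    qed
    moreover have "Z - X \<le> \<epsilon> * X + C * Y" using 1 by (simp add: algebra_simps)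
    moreover have "(C + 1) * Y = C * Y + Y" by (simp add: algebra_simps)
    ultimately have "\<bar>Z - X - Y\<bar> \<le> \<epsilon> * X + (C + 1) * Y" using nn by linarith
    then show ?thesis by (simp add: X_def Y_def Z_def)
  qed
  then show thesis using that[of "C + 1"] C by simp
qed

lemma tendsto_abs_powr:
  fixes p :: real
  assumes "p > 0" "f \<longlonglongrightarrow> a"
  shows "(\<lambda>n. \<bar>f n\<bar> powr p) \<longlonglongrightarrow> \<bar>a :: real\<bar> powr p"
  using assms by (intro tendsto_powr' tendsto_intros) auto

text \<open>
  The excess \<open>g\<^sub>n\<close> of the defect over \<open>\<epsilon> \<bar>u\<^sub>n - w\<bar>\<^sup>p\<close> is dominated by a multiple of \<open>\<bar>w\<bar>\<^sup>p\<close> and tends to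
  \<open>0\<close> almost everywhere.  Dominated convergence, first in the integral defining the potential and
  then in the integral of its square, disposes of \<open>g\<^sub>n\<close>; the rest costs \<open>2 \<epsilon>\<^sup>2 B\<close>.
\<close>

lemma nn_integral_square_riesz_potential_defect_tendsto_zero:
  fixes u :: "nat \<Rightarrow> real ^ 'n \<Rightarrow> real" and w :: "real ^ 'n \<Rightarrow> real"
  assumes \<beta>: "0 < \<beta>" "\<beta> < real CARD('n)" and p: "p > 0"
    and u[measurable]: "\<And>n. u n \<in> borel_measurable borel" and w[measurable]: "w \<in> borel_measurable borel"
    and lim: "AE x in lborel. (\<lambda>n. u n x) \<longlonglongrightarrow> w x"
    and F: "(\<integral>\<^sup>+ x. (riesz_potential \<beta> (\<lambda>y. \<bar>w y\<bar> powr p) x)\<^sup>2 \<partial>lborel) < \<infinity>"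
    and G: "\<And>n. (\<integral>\<^sup>+ x. (riesz_potential \<beta> (\<lambda>y. \<bar>u n y - w y\<bar> powr p) x)\<^sup>2 \<partial>lborel) \<le> ennreal B" and B: "B \<ge> 0"
  shows "(\<lambda>n. \<integral>\<^sup>+ x. (riesz_potential \<beta> (\<lambda>y. \<bar>\<bar>u n y\<bar> powr p - \<bar>u n y - w y\<bar> powr p - \<bar>w y\<bar> powr p\<bar>) x)\<^sup>2 \<partial>lborel) \<longlonglongrightarrow> 0"
proof (rule tendsto_zero_ennreal_approx)
  show "2 * B \<ge> 0" using B by simp
  fix \<delta> :: real assume \<delta>: "\<delta> > 0"
  define f where "f n y = \<bar>\<bar>u n y\<bar> powr p - \<bar>u n y - w y\<bar> powr p - \<bar>w y\<bar> powr p\<bar>" for n y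
  define v where "v n y = \<bar>u n y - w y\<bar> powr p" for n y
  define U where "U y = \<bar>w y\<bar> powr p" for y
  have [measurable]: "f n \<in> borel_measurable borel" "v n \<in> borel_measurable borel" "U \<in> borel_measurable borel" for n
    unfolding f_def v_def U_def by measurable
  (* the square of the potential carries epsilon^2, which is to be \<delta> *)
  define \<epsilon> where "\<epsilon> = sqrt \<delta>"
  have \<epsilon>: "\<epsilon> > 0" "\<epsilon>\<^sup>2 = \<delta>" using \<delta> by (auto simp: \<epsilon>_def)
  obtain C where C: "C \<ge> 0"
    and split: "\<And>a b :: real. \<bar>\<bar>a + b\<bar> powr p - \<bar>a\<bar> powr p - \<bar>b\<bar> powr p\<bar> \<le> \<epsilon> * \<bar>a\<bar> powr p + C * \<bar>b\<bar> powr p"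
    using abs_powr_splitting[OF p \<epsilon>(1)] by metis
  have fle: "f n y \<le> \<epsilon> * v n y + C * U y" for n y
    using split[of "u n y - w y" "w y"] by (simp add: f_def v_def U_def)
  define g where "g n y = max 0 (f n y - \<epsilon> * v n y)" for n y
  have [measurable]: "g n \<in> borel_measurable borel" for n unfolding g_def by measurable
  have g0: "g n y \<ge> 0" for n y by (simp add: g_def)
  have gle: "g n y \<le> C * U y" for n y using fle[of n y] C by (auto simp: g_def U_def)
  have glim: "AE y in lborel. (\<lambda>n. g n y) \<longlonglongrightarrow> 0"
    using lim
  proof eventually_elim
    case (elim y)
    have v: "(\<lambda>n. v n y) \<longlonglongrightarrow> 0"
      unfolding v_def using tendsto_abs_powr[OF p tendsto_diff[OF elim tendsto_const[of "w y"]]] p by simp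
    have "(\<lambda>n. \<bar>\<bar>u n y\<bar> powr p - v n y - \<bar>w y\<bar> powr p\<bar>) \<longlonglongrightarrow> \<bar>\<bar>w y\<bar> powr p - 0 - \<bar>w y\<bar> powr p\<bar>"
      by (rule tendsto_rabs[OF tendsto_diff[OF tendsto_diff[OF tendsto_abs_powr[OF p elim] v] tendsto_const]])
    then have "(\<lambda>n. f n y) \<longlonglongrightarrow> 0" by (simp add: f_def v_def)
    from tendsto_max[OF tendsto_const tendsto_diff[OF this tendsto_mult[OF tendsto_const v]], of 0 \<epsilon>]
    show ?case by (simp add: g_def)
  qed
  define J where "J n = riesz_potential \<beta> (g n)" for n
  define FF where "FF = riesz_potential \<beta> U"
  have [measurable]: "J n \<in> borel_measurable borel" "FF \<in> borel_measurable borel" for n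
    unfolding J_def FF_def by measurable
  have Jle: "J n x \<le> ennreal C * FF x" for n x
  proof -
    have "J n x \<le> riesz_potential \<beta> (\<lambda>y. C * U y) x" unfolding J_def by (rule riesz_potential_mono[OF \<beta> gle])
    also have "\<dots> = ennreal C * FF x" unfolding FF_def by (rule riesz_potential_cmult[OF C]) measurable
    finally show ?thesis .
  qed
  have F': "(\<integral>\<^sup>+ x. (FF x)\<^sup>2 \<partial>lborel) < \<infinity>" using F by (simp add: FF_def U_def[abs_def])
  have Fin: "AE x in lborel. FF x < \<infinity>" using F' by (intro AE_finite_of_square_integrable) auto
  have Jlim: "AE x in lborel. (\<lambda>n. J n x) \<longlonglongrightarrow> 0"
    using Fin
  proof eventually_elim
    case (elim x)
    have "(\<lambda>n. \<integral>\<^sup>+ y. ennreal (riesz_kernel \<beta> (x - y) * g n y) \<partial>lborel) \<longlonglongrightarrow> (\<integral>\<^sup>+ y. 0 \<partial>(lborel :: (real ^ 'n) measure))"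
    proof (rule nn_integral_dominated_convergence[where w = "\<lambda>y. ennreal (riesz_kernel \<beta> (x - y) * (C * U y))"])
      show "AE y in lborel. ennreal (riesz_kernel \<beta> (x - y) * g n y) \<le> ennreal (riesz_kernel \<beta> (x - y) * (C * U y))" for n
        using gle riesz_kernel_nonneg[OF \<beta>] by (intro AE_I2 ennreal_leI mult_left_mono)
      have "(\<integral>\<^sup>+ y. ennreal (riesz_kernel \<beta> (x - y) * (C * U y)) \<partial>lborel) = ennreal C * FF x"
        unfolding riesz_potential_lborel[symmetric] FF_def by (rule riesz_potential_cmult[OF C]) measurable
      also have "\<dots> < \<infinity>" using elim by (simp add: ennreal_mult_less_top less_top)
      finally show "(\<integral>\<^sup>+ y. ennreal (riesz_kernel \<beta> (x - y) * (C * U y)) \<partial>lborel) < \<infinity>" .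
      show "AE y in lborel. (\<lambda>n. ennreal (riesz_kernel \<beta> (x - y) * g n y)) \<longlonglongrightarrow> 0"
        using glim
      proof eventually_elim
        case (elim y)
        have "(\<lambda>n. ennreal (riesz_kernel \<beta> (x - y) * g n y)) \<longlonglongrightarrow> ennreal (riesz_kernel \<beta> (x - y) * 0)"
          by (intro tendsto_ennrealI tendsto_mult tendsto_const elim)
        then show ?case by simp
      qed
    qed measurable
    then show ?case by (simp add: J_def riesz_potential_lborel)
  qed
  have J2: "(\<lambda>n. \<integral>\<^sup>+ x. (J n x)\<^sup>2 \<partial>lborel) \<longlonglongrightarrow> (\<integral>\<^sup>+ x. 0 \<partial>(lborel :: (real ^ 'n) measure))"
  proof (rule nn_integral_dominated_convergence[where w = "\<lambda>x. (ennreal C * FF x)\<^sup>2"])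
    show "AE x in lborel. (J n x)\<^sup>2 \<le> (ennreal C * FF x)\<^sup>2" for n
      by (intro AE_I2 power_mono Jle) simp
    show "(\<integral>\<^sup>+ x. (ennreal C * FF x)\<^sup>2 \<partial>lborel) < \<infinity>"
      using F' C by (simp add: power_mult_distrib nn_integral_cmult ennreal_mult_less_top ennreal_power)
    show "AE x in lborel. (\<lambda>n. (J n x)\<^sup>2) \<longlonglongrightarrow> 0"
      using Jlim
    proof eventually_elim
      case (elim x)
      from tendsto_mult_ennreal[OF elim elim] show ?case by (simp add: power2_eq_square)
    qed
  qed auto
  define a where "a n = 2 * (\<integral>\<^sup>+ x. (J n x)\<^sup>2 \<partial>lborel)" for n
  have "a \<longlonglongrightarrow> 2 * 0" unfolding a_def using J2 by (intro ennreal_tendsto_cmult) auto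
  moreover have "(\<integral>\<^sup>+ x. (riesz_potential \<beta> (f n) x)\<^sup>2 \<partial>lborel) \<le> a n + ennreal (\<delta> * (2 * B))" for n
  proof -
    have "(\<integral>\<^sup>+ x. (riesz_potential \<beta> (f n) x)\<^sup>2 \<partial>lborel)
      \<le> (\<integral>\<^sup>+ x. 2 * (J n x)\<^sup>2 + 2 * (ennreal \<delta> * (riesz_potential \<beta> (v n) x)\<^sup>2) \<partial>lborel)"
    proof (rule nn_integral_mono)
      fix x
      have "riesz_potential \<beta> (f n) x \<le> riesz_potential \<beta> (\<lambda>y. g n y + \<epsilon> * v n y) x"
        by (rule riesz_potential_mono[OF \<beta>]) (auto simp: g_def)
      also have "\<dots> = J n x + riesz_potential \<beta> (\<lambda>y. \<epsilon> * v n y) x"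
        unfolding J_def using g0 \<epsilon> by (intro riesz_potential_add[OF \<beta>]) (auto simp: v_def)
      also have "riesz_potential \<beta> (\<lambda>y. \<epsilon> * v n y) x = ennreal \<epsilon> * riesz_potential \<beta> (v n) x"
        using \<epsilon> by (intro riesz_potential_cmult) auto
      finally have "(riesz_potential \<beta> (f n) x)\<^sup>2 \<le> (J n x + ennreal \<epsilon> * riesz_potential \<beta> (v n) x)\<^sup>2"
        by (rule power_mono) simp
      also have "\<dots> \<le> 2 * (J n x)\<^sup>2 + 2 * (ennreal \<epsilon> * riesz_potential \<beta> (v n) x)\<^sup>2"
        by (rule ennreal_add_square_le)
      also have "(ennreal \<epsilon> * riesz_potential \<beta> (v n) x)\<^sup>2 = ennreal \<delta> * (riesz_potential \<beta> (v n) x)\<^sup>2"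
        using \<epsilon> by (simp add: power_mult_distrib ennreal_power)
      finally show "(riesz_potential \<beta> (f n) x)\<^sup>2 \<le> 2 * (J n x)\<^sup>2 + 2 * (ennreal \<delta> * (riesz_potential \<beta> (v n) x)\<^sup>2)" .
    qed
    also have "\<dots> = a n + 2 * (ennreal \<delta> * (\<integral>\<^sup>+ x. (riesz_potential \<beta> (v n) x)\<^sup>2 \<partial>lborel))"
      unfolding a_def by (simp add: nn_integral_add nn_integral_cmult)
    also have "\<dots> \<le> a n + 2 * (ennreal \<delta> * ennreal B)"
      using G[of n] by (intro add_left_mono mult_left_mono) (simp_all add: v_def[abs_def])
    also have "2 * (ennreal \<delta> * ennreal B) = ennreal (\<delta> * (2 * B))"
      using \<delta> B by (simp add: ennreal_mult mult.left_commute)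
    finally show ?thesis .
  qed
  ultimately show "\<exists>a. a \<longlonglongrightarrow> 0 \<and> (\<forall>n. (\<integral>\<^sup>+ x. (riesz_potential \<beta> (\<lambda>y. \<bar>\<bar>u n y\<bar> powr p - \<bar>u n y - w y\<bar> powr p - \<bar>w y\<bar> powr p\<bar>) x)\<^sup>2 \<partial>lborel) \<le> a n + ennreal (\<delta> * (2 * B)))"
    unfolding f_def[symmetric] by (intro exI[of _ a]) auto
qed

text \<open>
  With \<open>K = G + F + r\<close>, \<open>\<bar>r\<bar> \<le> H\<close>, one has \<open>K\<^sup>2 - G\<^sup>2 - F\<^sup>2 = 2 F G + 2 r (F + G) + r\<^sup>2\<close>; the middle
  term is at most \<open>H\<^sup>2 / \<delta> + \<delta> (F + G)\<^sup>2\<close>.  In the application \<open>F G\<close> and \<open>H\<^sup>2\<close> have small integrals, and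
  \<open>F\<^sup>2 + G\<^sup>2\<close> a bounded one.
\<close>

lemma ennreal_absdiff_squares:
  fixes K G F H :: ennreal
  assumes fin: "K < \<infinity>" "G < \<infinity>" "F < \<infinity>" "H < \<infinity>" and \<delta>: "\<delta> > 0"
    and up: "K \<le> G + F + H" and lo: "G + F \<le> K + H"
  defines "E \<equiv> 2 * (F * G) + ennreal (1 / \<delta> + 1) * H\<^sup>2 + ennreal (2 * \<delta>) * (F\<^sup>2 + G\<^sup>2)"
  shows "ennreal_absdiff (K\<^sup>2) (G\<^sup>2) \<le> F\<^sup>2 + E" "F\<^sup>2 \<le> ennreal_absdiff (K\<^sup>2) (G\<^sup>2) + E"
proof -
  obtain k g f h where eq: "K = ennreal k" "G = ennreal g" "F = ennreal f" "H = ennreal h"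
    and nn: "k \<ge> 0" "g \<ge> 0" "f \<ge> 0" "h \<ge> 0"
    using fin by (auto simp: less_top_ennreal)
  define e where "e = 2 * (f * g) + (1 / \<delta> + 1) * h\<^sup>2 + (2 * \<delta>) * (f\<^sup>2 + g\<^sup>2)"
  have d: "1 / \<delta> + 1 \<ge> 0" "2 * \<delta> \<ge> 0" using \<delta> by auto
  have e0: "e \<ge> 0" unfolding e_def using nn d by (intro add_nonneg_nonneg mult_nonneg_nonneg) auto
  have E: "E = ennreal e"
  proof -
    have "E = ennreal 2 * (ennreal f * ennreal g) + ennreal (1 / \<delta> + 1) * (ennreal h)\<^sup>2
        + ennreal (2 * \<delta>) * ((ennreal f)\<^sup>2 + (ennreal g)\<^sup>2)"
      by (simp add: E_def eq)
    moreover have "0 \<le> f\<^sup>2" "0 \<le> g\<^sup>2" "0 \<le> h\<^sup>2" "0 \<le> (2 :: real)" by auto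
    ultimately show ?thesis unfolding e_def using nn d
      by (simp only: ennreal_plus ennreal_mult ennreal_power mult_nonneg_nonneg add_nonneg_nonneg)
  qed
  have "k \<le> g + f + h" "g + f \<le> k + h"
    using up lo nn unfolding eq by (simp_all flip: ennreal_plus)
  then have r: "\<bar>k - g - f\<bar> \<le> h" by linarith
  define r where "r = k - g - f"
  have k: "k = g + f + r" by (simp add: r_def)
  have rh: "\<bar>r\<bar> \<le> h" using r by (simp add: r_def)
  have "\<bar>k\<^sup>2 - g\<^sup>2 - f\<^sup>2\<bar> \<le> e"
  proof -
    have "k\<^sup>2 - g\<^sup>2 - f\<^sup>2 = 2 * (f * g) + 2 * r * (f + g) + r\<^sup>2"
      unfolding k by (simp add: power2_eq_square algebra_simps)
    then have "\<bar>k\<^sup>2 - g\<^sup>2 - f\<^sup>2\<bar> \<le> 2 * (f * g) + 2 * (\<bar>r\<bar> * (f + g)) + r\<^sup>2"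
      using nn abs_triangle_ineq[of "2 * (f * g) + 2 * r * (f + g)" "r\<^sup>2"] abs_triangle_ineq[of "2 * (f * g)" "2 * r * (f + g)"]
      by (simp add: abs_mult)
    also have "\<dots> \<le> 2 * (f * g) + 2 * (h * (f + g)) + h\<^sup>2"
      using rh nn by (intro add_mono mult_left_mono mult_right_mono) (auto simp: abs_le_square_iff[symmetric])
    finally have 1: "\<bar>k\<^sup>2 - g\<^sup>2 - f\<^sup>2\<bar> \<le> 2 * (f * g) + 2 * (h * (f + g)) + h\<^sup>2" .
    have 2: "2 * (h * (f + g)) \<le> 1 / \<delta> * h\<^sup>2 + \<delta> * (f + g)\<^sup>2"
    proof -
      have "0 \<le> (h - \<delta> * (f + g))\<^sup>2" by simp
      then have "2 * (h * (f + g)) * \<delta> \<le> h\<^sup>2 + \<delta>\<^sup>2 * (f + g)\<^sup>2" by (simp add: power2_eq_square algebra_simps)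
      then have "2 * (h * (f + g)) * \<delta> / \<delta> \<le> (h\<^sup>2 + \<delta>\<^sup>2 * (f + g)\<^sup>2) / \<delta>" using \<delta> by (intro divide_right_mono) auto
      then show ?thesis using \<delta> by (simp add: add_divide_distrib power2_eq_square)
    qed
    have 3: "\<delta> * (f + g)\<^sup>2 \<le> 2 * \<delta> * (f\<^sup>2 + g\<^sup>2)"
    proof -
      have "(f + g)\<^sup>2 \<le> 2 * (f\<^sup>2 + g\<^sup>2)" using sum_squares_bound[of f g] by (simp add: power2_eq_square algebra_simps)
      from mult_left_mono[OF this, of \<delta>] \<delta> show ?thesis by (simp add: mult_ac)
    qed
    have "e = 2 * (f * g) + 1 / \<delta> * h\<^sup>2 + h\<^sup>2 + 2 * \<delta> * (f\<^sup>2 + g\<^sup>2)"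
      unfolding e_def distrib_right by simp
    with 1 2 3 show ?thesis by linarith
  qed
  moreover have absdiff: "ennreal_absdiff (K\<^sup>2) (G\<^sup>2) = ennreal \<bar>k\<^sup>2 - g\<^sup>2\<bar>"
    unfolding eq using nn by (simp add: ennreal_power ennreal_absdiff_ennreal)
  ultimately have "\<bar>k\<^sup>2 - g\<^sup>2\<bar> \<le> f\<^sup>2 + e \<and> f\<^sup>2 \<le> \<bar>k\<^sup>2 - g\<^sup>2\<bar> + e"
    using zero_le_power2[of f] by linarith
  then show "ennreal_absdiff (K\<^sup>2) (G\<^sup>2) \<le> F\<^sup>2 + E" "F\<^sup>2 \<le> ennreal_absdiff (K\<^sup>2) (G\<^sup>2) + E"
    using nn e0 unfolding E absdiff by (simp_all add: eq ennreal_power ennreal_leI del: ennreal_plus flip: ennreal_plus)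
qed

text \<open>
  Fatou's lemma, once for the potential and once for the integral of its square.
\<close>

lemma square_integral_riesz_potential_le_limit:
  fixes u :: "nat \<Rightarrow> real ^ 'n \<Rightarrow> real" and w :: "real ^ 'n \<Rightarrow> real"
  assumes p: "p > 0"
    and u[measurable]: "\<And>n. u n \<in> borel_measurable borel" and w[measurable]: "w \<in> borel_measurable borel"
    and lim: "AE x in lborel. (\<lambda>n. u n x) \<longlonglongrightarrow> w x"
    and bdd: "\<And>n. (\<integral>\<^sup>+ x. (riesz_potential \<beta> (\<lambda>y. \<bar>u n y\<bar> powr p) x)\<^sup>2 \<partial>lborel) \<le> B"
  shows "(\<integral>\<^sup>+ x. (riesz_potential \<beta> (\<lambda>y. \<bar>w y\<bar> powr p) x)\<^sup>2 \<partial>lborel) \<le> B"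
proof -
  define F where "F n = riesz_potential \<beta> (\<lambda>y. \<bar>u n y\<bar> powr p)" for n
  have [measurable]: "F n \<in> borel_measurable borel" for n unfolding F_def by measurable
  have 1: "riesz_potential \<beta> (\<lambda>y. \<bar>w y\<bar> powr p) x \<le> liminf (\<lambda>n. F n x)" for x
  proof -
    have "riesz_potential \<beta> (\<lambda>y. \<bar>w y\<bar> powr p) x
      = (\<integral>\<^sup>+ y. liminf (\<lambda>n. ennreal (riesz_kernel \<beta> (x - y) * \<bar>u n y\<bar> powr p)) \<partial>lborel)"
      unfolding riesz_potential_lborel
    proof (rule nn_integral_cong_AE)
      show "AE y in lborel. ennreal (riesz_kernel \<beta> (x - y) * \<bar>w y\<bar> powr p)
          = liminf (\<lambda>n. ennreal (riesz_kernel \<beta> (x - y) * \<bar>u n y\<bar> powr p))"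
        using lim
      proof eventually_elim
        case (elim y)
        have "(\<lambda>n. ennreal (riesz_kernel \<beta> (x - y) * \<bar>u n y\<bar> powr p)) \<longlonglongrightarrow> ennreal (riesz_kernel \<beta> (x - y) * \<bar>w y\<bar> powr p)"
          by (intro tendsto_ennrealI tendsto_mult tendsto_const tendsto_abs_powr[OF p elim])
        from lim_imp_Liminf[OF sequentially_bot this] show ?case by simp
      qed
    qed
    also have "\<dots> \<le> liminf (\<lambda>n. F n x)"
      unfolding F_def riesz_potential_lborel by (rule nn_integral_liminf) measurable
    finally show ?thesis .
  qed
  have sq: "liminf (\<lambda>n. (F n x)\<^sup>2) = (liminf (\<lambda>n. F n x))\<^sup>2" for x
  proof (rule Liminf_compose_continuous_mono)
    show "continuous_on UNIV (\<lambda>a :: ennreal. a\<^sup>2)"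
      unfolding continuous_on_def power2_eq_square by (auto intro!: tendsto_mult_ennreal)
    show "mono (\<lambda>a :: ennreal. a\<^sup>2)" by (intro monoI power_mono) auto
  qed simp
  have "(\<integral>\<^sup>+ x. (riesz_potential \<beta> (\<lambda>y. \<bar>w y\<bar> powr p) x)\<^sup>2 \<partial>lborel) \<le> (\<integral>\<^sup>+ x. liminf (\<lambda>n. (F n x)\<^sup>2) \<partial>lborel)"
    unfolding sq by (intro nn_integral_mono power_mono 1) simp
  also have "\<dots> \<le> liminf (\<lambda>n. \<integral>\<^sup>+ x. (F n x)\<^sup>2 \<partial>lborel)"
    by (rule nn_integral_liminf) measurable
  also have "\<dots> \<le> B"
    using bdd by (intro Liminf_le always_eventually) (auto simp: F_def)
  finally show ?thesis .
qed


section \<open>Convergence of the energies\<close>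

text \<open>
  The potential is finite at some point \<open>x\<close>, and every ball about the origin lies in a ball about
  \<open>x\<close>.
\<close>

lemma locally_integrable_of_square_integrable_riesz_potential:
  fixes f :: "real ^ 'n \<Rightarrow> real"
  assumes \<beta>: "0 < \<beta>" "\<beta> < real CARD('n)"
    and f[measurable]: "f \<in> borel_measurable borel" and f0: "\<And>y. f y \<ge> 0"
    and F: "(\<integral>\<^sup>+ x. (riesz_potential \<beta> f x)\<^sup>2 \<partial>lborel) < \<infinity>"
  shows "(\<integral>\<^sup>+ y. ennreal (f y) * indicator (ball 0 R) y \<partial>lborel) < \<infinity>"
proof -
  have "\<exists>x. riesz_potential \<beta> f x \<noteq> \<infinity>"
  proof (rule ccontr)
    assume "\<nexists>x. riesz_potential \<beta> f x \<noteq> \<infinity>"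
    then have "(\<integral>\<^sup>+ x. (riesz_potential \<beta> f x)\<^sup>2 \<partial>lborel) = \<infinity>"
      by (simp add: power2_eq_square ennreal_mult_top ennreal_top_mult emeasure_lborel_UNIV)
    with F show False by simp
  qed
  then obtain x where x: "riesz_potential \<beta> f x < \<infinity>" by (auto simp: less_top)
  define \<rho> where "\<rho> = \<bar>R\<bar> + norm x + 1"
  have \<rho>: "\<rho> > 0" unfolding \<rho>_def using norm_ge_zero[of x] by linarith
  have "(\<integral>\<^sup>+ y. ennreal (f y) * indicator (ball 0 R) y \<partial>lborel) \<le> (\<integral>\<^sup>+ y. ennreal (f y) * indicator (ball x \<rho>) y \<partial>lborel)"
  proof (rule nn_integral_mono)
    fix y :: "real ^ 'n"
    have "y \<in> ball 0 R \<Longrightarrow> y \<in> ball x \<rho>"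
      using norm_triangle_ineq4[of x y] by (simp add: dist_norm \<rho>_def)
    then show "ennreal (f y) * indicator (ball 0 R) y \<le> ennreal (f y) * indicator (ball x \<rho>) y"
      by (cases "y \<in> ball 0 R") auto
  qed
  also have "\<dots> \<le> ennreal (\<rho> powr (real CARD('n) - \<beta>) / riesz_const TYPE('n) \<beta>) * riesz_potential \<beta> f x"
    by (rule nn_integral_ball_le_riesz_potential[OF \<beta> \<rho> f f0])
  also have "\<dots> < \<infinity>" using x by (simp add: ennreal_mult_less_top)
  finally show ?thesis .
qed

text \<open>
  A form of Vitali's theorem.  The integral of \<open>\<bar>u\<^sub>n\<bar>\<^sup>p\<close> over \<open>\<bar>u\<^sub>n\<bar> > t\<close> is at most a multiple of
  \<open>t\<^bsup>p - q\<^esup>\<close>, uniformly in \<open>n\<close>; where \<open>\<bar>u\<^sub>n\<bar> \<le> t\<close>, the integrand is dominated by a multiple of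
  \<open>t\<^sup>p + \<bar>w\<bar>\<^sup>p\<close>.
\<close>

lemma nn_integral_ball_abs_diff_powr_tendsto_zero:
  fixes u :: "nat \<Rightarrow> real ^ 'n \<Rightarrow> real" and w :: "real ^ 'n \<Rightarrow> real"
  assumes p: "0 < p" "p < q"
    and u[measurable]: "\<And>n. u n \<in> borel_measurable borel" and w[measurable]: "w \<in> borel_measurable borel"
    and lim: "AE x in lborel. (\<lambda>n. u n x) \<longlonglongrightarrow> w x"
    and loc: "(\<integral>\<^sup>+ y. ennreal (\<bar>w y\<bar> powr p) * indicator (ball 0 R) y \<partial>lborel) < \<infinity>"
    and weak: "\<And>n t. t > 0 \<Longrightarrow> emeasure lborel {x. \<bar>u n x\<bar> > t} \<le> ennreal (K * t powr (- q))" and K: "K \<ge> 0"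
  shows "(\<lambda>n. \<integral>\<^sup>+ y. ennreal (\<bar>u n y - w y\<bar> powr p) * indicator (ball 0 R) y \<partial>lborel) \<longlonglongrightarrow> 0"
proof (rule tendsto_zero_ennreal_approx)
  define c where "c = (2 :: real) powr p"
  have c: "c > 0" by (simp add: c_def)
  define K' where "K' = K * 2 powr p / (1 - 2 powr (p - q))"
  have "2 powr (p - q) < (1::real)" using p powr_less_mono[of "p - q" 0 2] by simp
  then have K': "K' \<ge> 0" using K by (simp add: K'_def)
  show "c * K' \<ge> 0" using c K' by simp
  fix \<delta> :: real assume \<delta>: "\<delta> > 0"
  (* this t turns the tail bound into a multiple of \<delta> *)
  define t where "t = \<delta> powr (1 / (p - q))"
  have t: "t > 0" using \<delta> by (simp add: t_def)
  have t\<delta>: "t powr (p - q) = \<delta>" using \<delta> p by (simp add: t_def powr_powr)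
  define g where "g n y = min (\<bar>u n y - w y\<bar> powr p) (c * (t powr p + \<bar>w y\<bar> powr p))" for n y
  have [measurable]: "g n \<in> borel_measurable borel" for n unfolding g_def by measurable
  have g0: "g n y \<ge> 0" for n y using c by (simp add: g_def)
  have vle: "\<bar>u n y - w y\<bar> powr p \<le> c * \<bar>u n y\<bar> powr p + c * \<bar>w y\<bar> powr p" for n y
    using abs_add_powr_le[OF p(1), of 1 "u n y" "- w y"] by (simp add: c_def)
  have split: "\<bar>u n y - w y\<bar> powr p \<le> g n y + c * (\<bar>u n y\<bar> powr p * indicator {y. \<bar>u n y\<bar> > t} y)" for n y
  proof (cases "\<bar>u n y\<bar> > t")
    case True
    have "0 \<le> c * t powr p" "0 \<le> c * \<bar>u n y\<bar> powr p" using c by auto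
    then show ?thesis using vle[of n y] True by (simp add: g_def min_def distrib_left)
  next
    case False
    then have "\<bar>u n y\<bar> powr p \<le> t powr p" using p by (intro powr_mono2) auto
    then have "c * \<bar>u n y\<bar> powr p \<le> c * t powr p" using c by simp
    then show ?thesis using vle[of n y] False by (simp add: g_def min_def distrib_left)
  qed
  define a where "a n = (\<integral>\<^sup>+ y. ennreal (g n y) * indicator (ball 0 R) y \<partial>lborel)" for n
  have "a \<longlonglongrightarrow> (\<integral>\<^sup>+ y. 0 \<partial>(lborel :: (real ^ 'n) measure))"
    unfolding a_def
  proof (rule nn_integral_dominated_convergence[where w = "\<lambda>y. ennreal (c * t powr p) * indicator (ball 0 R) y + ennreal c * (ennreal (\<bar>w y\<bar> powr p) * indicator (ball 0 R) y)"])
    show "AE y in lborel. ennreal (g n y) * indicator (ball 0 R) y \<le> ennreal (c * t powr p) * indicator (ball 0 R) y + ennreal c * (ennreal (\<bar>w y\<bar> powr p) * indicator (ball 0 R) y)" for n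
    proof (rule AE_I2)
      fix y :: "real ^ 'n"
      have "g n y \<le> c * t powr p + c * \<bar>w y\<bar> powr p" by (simp add: g_def distrib_left)
      then have "ennreal (g n y) \<le> ennreal (c * t powr p) + ennreal c * ennreal (\<bar>w y\<bar> powr p)"
        using c by (simp add: ennreal_leI flip: ennreal_plus ennreal_mult)
      then show "ennreal (g n y) * indicator (ball 0 R) y \<le> ennreal (c * t powr p) * indicator (ball 0 R) y + ennreal c * (ennreal (\<bar>w y\<bar> powr p) * indicator (ball 0 R) y)"
        by (cases "y \<in> ball 0 R") auto
    qed
    have "emeasure lborel (ball (0 :: real ^ 'n) R) < \<infinity>" by (rule emeasure_bounded_finite) simp
    then show "(\<integral>\<^sup>+ y. ennreal (c * t powr p) * indicator (ball 0 R) y + ennreal c * (ennreal (\<bar>w y\<bar> powr p) * indicator (ball 0 R) y) \<partial>lborel) < \<infinity>"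
      using loc by (simp add: nn_integral_add nn_integral_cmult ennreal_mult_less_top)
    show "AE y in lborel. (\<lambda>n. ennreal (g n y) * indicator (ball 0 R) y) \<longlonglongrightarrow> 0"
      using lim
    proof eventually_elim
      case (elim y)
      have "(\<lambda>n. \<bar>u n y - w y\<bar> powr p) \<longlonglongrightarrow> 0"
        using tendsto_abs_powr[OF p(1) tendsto_diff[OF elim tendsto_const[of "w y"]]] p by simp
      moreover have "\<forall>\<^sub>F n in sequentially. norm (g n y) \<le> \<bar>u n y - w y\<bar> powr p"
        using g0 by (auto simp: g_def)
      ultimately have "(\<lambda>n. g n y) \<longlonglongrightarrow> 0" by (rule Lim_null_comparison[rotated])
      then have "(\<lambda>n. ennreal (g n y)) \<longlonglongrightarrow> ennreal 0" by (rule tendsto_ennrealI)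
      then show ?case by (cases "y \<in> ball 0 R") auto
    qed
  qed measurable
  moreover have "(\<integral>\<^sup>+ y. ennreal (\<bar>u n y - w y\<bar> powr p) * indicator (ball 0 R) y \<partial>lborel) \<le> a n + ennreal (\<delta> * (c * K'))" for n
  proof -
    have "(\<integral>\<^sup>+ y. ennreal (\<bar>u n y - w y\<bar> powr p) * indicator (ball 0 R) y \<partial>lborel)
      \<le> (\<integral>\<^sup>+ y. ennreal (g n y) * indicator (ball 0 R) y + ennreal c * (ennreal (\<bar>u n y\<bar> powr p) * indicator {y. \<bar>u n y\<bar> > t} y) \<partial>lborel)"
    proof (rule nn_integral_mono)
      fix y :: "real ^ 'n"
      have "ennreal (\<bar>u n y - w y\<bar> powr p) \<le> ennreal (g n y + c * (\<bar>u n y\<bar> powr p * indicator {y. \<bar>u n y\<bar> > t} y))"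
        by (intro ennreal_leI split)
      also have "\<dots> = ennreal (g n y) + ennreal c * (ennreal (\<bar>u n y\<bar> powr p) * indicator {y. \<bar>u n y\<bar> > t} y)"
        using c g0[of n y] by (cases "\<bar>u n y\<bar> > t") (auto simp: ennreal_plus ennreal_mult)
      finally show "ennreal (\<bar>u n y - w y\<bar> powr p) * indicator (ball 0 R) y
         \<le> ennreal (g n y) * indicator (ball 0 R) y + ennreal c * (ennreal (\<bar>u n y\<bar> powr p) * indicator {y. \<bar>u n y\<bar> > t} y)"
        by (cases "y \<in> ball 0 R") auto
    qed
    also have "\<dots> = a n + ennreal c * (\<integral>\<^sup>+ y. ennreal (\<bar>u n y\<bar> powr p) * indicator {y. \<bar>u n y\<bar> > t} y \<partial>lborel)"
      unfolding a_def by (subst nn_integral_add) (simp_all add: nn_integral_cmult)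
    also have "\<dots> \<le> a n + ennreal c * ennreal (K' * t powr (p - q))"
    proof (intro add_left_mono mult_left_mono)
      have "(\<integral>\<^sup>+ y. ennreal (\<bar>u n y\<bar> powr p) * indicator {y. \<bar>u n y\<bar> > t} y \<partial>lborel)
        \<le> ennreal (K * 2 powr p / (1 - 2 powr (p - q)) * t powr (p - q))"
        by (rule nn_integral_powr_tail_le) (use weak K p t in auto)
      then show "(\<integral>\<^sup>+ y. ennreal (\<bar>u n y\<bar> powr p) * indicator {y. \<bar>u n y\<bar> > t} y \<partial>lborel) \<le> ennreal (K' * t powr (p - q))"
        by (simp add: K'_def)
    qed simp
    also have "ennreal c * ennreal (K' * t powr (p - q)) = ennreal (\<delta> * (c * K'))"
      unfolding t\<delta> using c K' \<delta> by (simp add: mult_ac flip: ennreal_mult)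
    finally show ?thesis .
  qed
  ultimately show "\<exists>a. a \<longlonglongrightarrow> 0 \<and> (\<forall>n. (\<integral>\<^sup>+ y. ennreal (\<bar>u n y - w y\<bar> powr p) * indicator (ball 0 R) y \<partial>lborel) \<le> a n + ennreal (\<delta> * (c * K')))"
    by (intro exI[of _ a]) auto
qed

lemma ennreal_le_add_minus: "a \<le> b + (a - b :: ennreal)"
proof (cases "b \<le> a")
  case True
  then show ?thesis by (metis ennreal_ineq_diff_add order_refl)
next
  case False
  then have "a \<le> b" by simp
  then show ?thesis by (rule order_trans) simp
qed

text \<open>
  The exponent of the superlevel estimate exceeds \<open>p\<close>: this is where the relation between \<open>p\<close> and
  \<open>\<alpha> = 2 \<beta>\<close> enters.
\<close>

lemma coulomb_sobolev_exponent_gt: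
  fixes \<beta> p :: real
  assumes "0 < \<beta>" "0 < p" "1 / p > 1 / 2 - 1 / (2 * \<beta>)"
  shows "p < 2 * (p + \<beta>) / (1 + \<beta>)"
proof -
  have "(1 / 2 - 1 / (2 * \<beta>)) * (2 * \<beta> * p) < 1 / p * (2 * \<beta> * p)"
    using assms by (intro mult_strict_right_mono) auto
  then have "\<beta> * p - p < 2 * \<beta>" using assms by (simp add: left_diff_distrib)
  then show ?thesis using assms by (simp add: field_simps)
qed

text \<open>
  The theorem for Borel functions, with the gradient bound replaced by its consequence for
  translations.
\<close>

lemma brezis_lieb_riesz_energy:
  fixes u :: "nat \<Rightarrow> real ^ 'n \<Rightarrow> real" and w :: "real ^ 'n \<Rightarrow> real"
  assumes \<beta>: "0 < \<beta>" "\<beta> < real CARD('n)" and p: "1 \<le> p" and sub: "1 / p > 1 / 2 - 1 / (2 * \<beta>)"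
    and u[measurable]: "\<And>n. u n \<in> borel_measurable borel" and w[measurable]: "w \<in> borel_measurable borel"
    and lim: "AE x in lborel. (\<lambda>n. u n x) \<longlonglongrightarrow> w x"
    and energy: "\<And>n. (\<integral>\<^sup>+ x. (riesz_potential \<beta> (\<lambda>y. \<bar>u n y\<bar> powr p) x)\<^sup>2 \<partial>lborel) \<le> ennreal B1" and B1: "B1 \<ge> 0"
    and tr: "\<And>n h. (\<integral>\<^sup>+ x. ennreal ((u n (x + h) - u n x)\<^sup>2) \<partial>lborel) \<le> ennreal ((norm h)\<^sup>2 * B2)" and B2: "B2 \<ge> 0"
  shows "(\<lambda>n. \<integral>\<^sup>+ x. ennreal_absdiff
              ((riesz_potential \<beta> (\<lambda>y. \<bar>u n y\<bar> powr p) x)\<^sup>2)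
              ((riesz_potential \<beta> (\<lambda>y. \<bar>u n y - w y\<bar> powr p) x)\<^sup>2) \<partial>lborel)
         \<longlonglongrightarrow> (\<integral>\<^sup>+ x. (riesz_potential \<beta> (\<lambda>y. \<bar>w y\<bar> powr p) x)\<^sup>2 \<partial>lborel)"
proof -
  have p0: "p > 0" using p by simp
  define q where "q = 2 * (p + \<beta>) / (1 + \<beta>)"
  have pq: "p < q" unfolding q_def by (rule coulomb_sobolev_exponent_gt[OF \<beta>(1) p0 sub])
  define U where "U n = riesz_potential \<beta> (\<lambda>y. \<bar>u n y\<bar> powr p)" for n
  define G where "G n = riesz_potential \<beta> (\<lambda>y. \<bar>u n y - w y\<bar> powr p)" for n
  define F where "F = riesz_potential \<beta> (\<lambda>y. \<bar>w y\<bar> powr p)"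
  define H where "H n = riesz_potential \<beta> (\<lambda>y. \<bar>\<bar>u n y\<bar> powr p - \<bar>u n y - w y\<bar> powr p - \<bar>w y\<bar> powr p\<bar>)" for n
  have [measurable]: "U n \<in> borel_measurable borel" "G n \<in> borel_measurable borel" "F \<in> borel_measurable borel"
     "H n \<in> borel_measurable borel" for n unfolding U_def G_def F_def H_def by measurable
  have U2: "(\<integral>\<^sup>+ x. (U n x)\<^sup>2 \<partial>lborel) \<le> ennreal B1" for n unfolding U_def by (rule energy)
  have F2: "(\<integral>\<^sup>+ x. (F x)\<^sup>2 \<partial>lborel) \<le> ennreal B1"
    unfolding F_def by (rule square_integral_riesz_potential_le_limit[OF p0 u w lim energy])
  have F2': "(\<integral>\<^sup>+ x. (F x)\<^sup>2 \<partial>lborel) < \<infinity>" using le_less_trans[OF F2 ennreal_less_top] by simp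
  define c where "c = (2 :: real) powr p"
  have c: "c > 0" by (simp add: c_def)
  define B where "B = 4 * c\<^sup>2 * B1"
  have B: "B \<ge> 0" using c B1 by (simp add: B_def)
  have G2: "(\<integral>\<^sup>+ x. (G n x)\<^sup>2 \<partial>lborel) \<le> ennreal B" for n
  proof -
    have "G n x \<le> ennreal c * U n x + ennreal c * F x" for x
    proof -
      have "G n x \<le> riesz_potential \<beta> (\<lambda>y. c * \<bar>u n y\<bar> powr p + c * \<bar>w y\<bar> powr p) x"
        unfolding G_def
      proof (rule riesz_potential_mono[OF \<beta>])
        show "\<bar>u n y - w y\<bar> powr p \<le> c * \<bar>u n y\<bar> powr p + c * \<bar>w y\<bar> powr p" for y
          using abs_add_powr_le[OF p0, of 1 "u n y" "- w y"] by (simp add: c_def)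
      qed
      also have "\<dots> = riesz_potential \<beta> (\<lambda>y. c * \<bar>u n y\<bar> powr p) x + riesz_potential \<beta> (\<lambda>y. c * \<bar>w y\<bar> powr p) x"
        using c by (intro riesz_potential_add[OF \<beta>]) auto
      also have "\<dots> = ennreal c * U n x + ennreal c * F x"
        unfolding U_def F_def using c by (simp add: riesz_potential_cmult)
      finally show ?thesis .
    qed
    then have "(G n x)\<^sup>2 \<le> (ennreal c * U n x + ennreal c * F x)\<^sup>2" for x by (rule power_mono) simp
    then have "(G n x)\<^sup>2 \<le> 2 * (ennreal c * U n x)\<^sup>2 + 2 * (ennreal c * F x)\<^sup>2" for x
      using ennreal_add_square_le order_trans by blast
    then have "(\<integral>\<^sup>+ x. (G n x)\<^sup>2 \<partial>lborel) \<le> (\<integral>\<^sup>+ x. 2 * (ennreal c * U n x)\<^sup>2 + 2 * (ennreal c * F x)\<^sup>2 \<partial>lborel)"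
      by (rule nn_integral_mono)
    also have "\<dots> = 2 * (ennreal (c\<^sup>2) * (\<integral>\<^sup>+ x. (U n x)\<^sup>2 \<partial>lborel)) + 2 * (ennreal (c\<^sup>2) * (\<integral>\<^sup>+ x. (F x)\<^sup>2 \<partial>lborel))"
      using c by (simp add: nn_integral_add nn_integral_cmult power_mult_distrib ennreal_power)
    also have "\<dots> \<le> 2 * (ennreal (c\<^sup>2) * ennreal B1) + 2 * (ennreal (c\<^sup>2) * ennreal B1)"
      by (intro add_mono mult_left_mono U2 F2) auto
    also have "\<dots> = ennreal 2 * (ennreal (c\<^sup>2) * ennreal B1) + ennreal 2 * (ennreal (c\<^sup>2) * ennreal B1)" by simp
    also have "\<dots> = ennreal (2 * (c\<^sup>2 * B1) + 2 * (c\<^sup>2 * B1))"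
      using B1 by (simp only: ennreal_plus ennreal_mult mult_nonneg_nonneg zero_le_power2 zero_le_numeral)
    also have "2 * (c\<^sup>2 * B1) + 2 * (c\<^sup>2 * B1) = B" by (simp add: B_def)
    finally show ?thesis .
  qed
  define K where "K = (4 / (riesz_const TYPE('n) \<beta> * unit_ball_vol (real CARD('n)))\<^sup>2 * B1 + 2 * B2) * 2 powr q"
  have K: "K \<ge> 0" unfolding K_def using B1 B2 by simp
  have weak: "emeasure lborel {x. \<bar>u n x\<bar> > t} \<le> ennreal (K * t powr (- q))" if "t > 0" for n t
    unfolding K_def by (rule emeasure_superlevel_le_powr[OF \<beta> that p0 u energy B1 tr B2 q_def])
  have vloc: "(\<lambda>n. \<integral>\<^sup>+ y. ennreal (\<bar>u n y - w y\<bar> powr p) * indicator (ball 0 R) y \<partial>lborel) \<longlonglongrightarrow> 0" for R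
  proof (rule nn_integral_ball_abs_diff_powr_tendsto_zero[OF p0 pq u w lim _ weak K])
    show "(\<integral>\<^sup>+ y. ennreal (\<bar>w y\<bar> powr p) * indicator (ball 0 R) y \<partial>lborel) < \<infinity>"
      by (rule locally_integrable_of_square_integrable_riesz_potential[OF \<beta>]) (use F2' in \<open>auto simp: F_def\<close>)
  qed
  have Gloc: "(\<lambda>n. \<integral>\<^sup>+ x. G n x * indicator (ball 0 r) x \<partial>lborel) \<longlonglongrightarrow> 0" if "r > 0" for r
    unfolding G_def
    by (rule riesz_potential_tendsto_zero_L1_loc[OF \<beta> _ _ vloc G2[unfolded G_def] B that]) auto
  have FG: "(\<lambda>n. \<integral>\<^sup>+ x. F x * G n x \<partial>lborel) \<longlonglongrightarrow> 0"
    by (rule nn_integral_mult_tendsto_zero[OF _ F2' _ G2 B Gloc]) auto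
  have H2: "(\<lambda>n. \<integral>\<^sup>+ x. (H n x)\<^sup>2 \<partial>lborel) \<longlonglongrightarrow> 0"
    unfolding H_def
    by (rule nn_integral_square_riesz_potential_defect_tendsto_zero[OF \<beta> p0 u w lim F2'[unfolded F_def] G2[unfolded G_def] B])
  have up: "U n x \<le> G n x + F x + H n x" for n x
  proof -
    have "U n x \<le> riesz_potential \<beta> (\<lambda>y. (\<bar>u n y - w y\<bar> powr p + \<bar>w y\<bar> powr p) + \<bar>\<bar>u n y\<bar> powr p - \<bar>u n y - w y\<bar> powr p - \<bar>w y\<bar> powr p\<bar>) x"
      unfolding U_def by (rule riesz_potential_mono[OF \<beta>]) linarith
    also have "\<dots> = G n x + F x + H n x"
      unfolding G_def F_def H_def by (simp add: riesz_potential_add[OF \<beta>])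
    finally show ?thesis .
  qed
  have lo: "G n x + F x \<le> U n x + H n x" for n x
  proof -
    have "G n x + F x = riesz_potential \<beta> (\<lambda>y. \<bar>u n y - w y\<bar> powr p + \<bar>w y\<bar> powr p) x"
      unfolding G_def F_def by (simp add: riesz_potential_add[OF \<beta>])
    also have "\<dots> \<le> riesz_potential \<beta> (\<lambda>y. \<bar>u n y\<bar> powr p + \<bar>\<bar>u n y\<bar> powr p - \<bar>u n y - w y\<bar> powr p - \<bar>w y\<bar> powr p\<bar>) x"
      by (rule riesz_potential_mono[OF \<beta>]) linarith
    also have "\<dots> = U n x + H n x"
      unfolding U_def H_def by (simp add: riesz_potential_add[OF \<beta>])
    finally show ?thesis .
  qed
  have Hle: "H n x \<le> U n x + G n x + F x" for n x
  proof -
    have "H n x \<le> riesz_potential \<beta> (\<lambda>y. (\<bar>u n y\<bar> powr p + \<bar>u n y - w y\<bar> powr p) + \<bar>w y\<bar> powr p) x"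
      unfolding H_def
    proof (rule riesz_potential_mono[OF \<beta>])
      fix y
      have "0 \<le> \<bar>u n y\<bar> powr p" "0 \<le> \<bar>u n y - w y\<bar> powr p" "0 \<le> \<bar>w y\<bar> powr p" by auto
      then show "\<bar>\<bar>u n y\<bar> powr p - \<bar>u n y - w y\<bar> powr p - \<bar>w y\<bar> powr p\<bar> \<le> (\<bar>u n y\<bar> powr p + \<bar>u n y - w y\<bar> powr p) + \<bar>w y\<bar> powr p"
        by linarith
    qed
    also have "\<dots> = U n x + G n x + F x"
      unfolding G_def F_def U_def by (simp add: riesz_potential_add[OF \<beta>])
    finally show ?thesis .
  qed
  define L where "L n = (\<integral>\<^sup>+ x. ennreal_absdiff ((U n x)\<^sup>2) ((G n x)\<^sup>2) \<partial>lborel)" for n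
  define J where "J = (\<integral>\<^sup>+ x. (F x)\<^sup>2 \<partial>lborel)"
  define x where "x n = (L n - J) + (J - L n)" for n
  have "x \<longlonglongrightarrow> 0"
  proof (rule tendsto_zero_ennreal_approx)
    show "4 * (B1 + B) \<ge> 0" using B1 B by simp
    fix \<delta> :: real assume \<delta>: "\<delta> > 0"
    define b where "b n = 2 * (\<integral>\<^sup>+ x. F x * G n x \<partial>lborel) + ennreal (1 / \<delta> + 1) * (\<integral>\<^sup>+ x. (H n x)\<^sup>2 \<partial>lborel)" for n
    have "b \<longlonglongrightarrow> 2 * 0 + ennreal (1 / \<delta> + 1) * 0"
      unfolding b_def by (intro tendsto_add ennreal_tendsto_cmult FG H2) auto
    then have b0: "b \<longlonglongrightarrow> 0" by simp
    have "(\<lambda>n. 2 * b n) \<longlonglongrightarrow> 2 * 0" by (intro ennreal_tendsto_cmult b0) auto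
    moreover have "x n \<le> 2 * b n + ennreal (\<delta> * (4 * (B1 + B)))" for n
    proof -
      define E where "E x = 2 * (F x * G n x) + ennreal (1 / \<delta> + 1) * (H n x)\<^sup>2 + ennreal (2 * \<delta>) * ((F x)\<^sup>2 + (G n x)\<^sup>2)" for x
      have [measurable]: "E \<in> borel_measurable borel" unfolding E_def by measurable
      have "(\<integral>\<^sup>+ x. E x \<partial>lborel) = b n + ennreal (2 * \<delta>) * ((\<integral>\<^sup>+ x. (F x)\<^sup>2 \<partial>lborel) + (\<integral>\<^sup>+ x. (G n x)\<^sup>2 \<partial>lborel))"
        unfolding E_def b_def by (simp add: nn_integral_add nn_integral_cmult)
      also have "\<dots> \<le> b n + ennreal (2 * \<delta>) * (ennreal B1 + ennreal B)"
        by (intro add_left_mono mult_left_mono add_mono F2 G2) auto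
      also have "ennreal (2 * \<delta>) * (ennreal B1 + ennreal B) = ennreal (2 * \<delta> * (B1 + B))"
        using \<delta> B1 B by (simp add: ennreal_mult ennreal_plus)
      finally have Eb: "(\<integral>\<^sup>+ x. E x \<partial>lborel) \<le> b n + ennreal (2 * \<delta> * (B1 + B))" .
      have fin: "AE x in lborel. U n x < \<infinity>" "AE x in lborel. G n x < \<infinity>" "AE x in lborel. F x < \<infinity>"
        using AE_finite_of_square_integrable[of "U n" lborel] AE_finite_of_square_integrable[of "G n" lborel]
          AE_finite_of_square_integrable[of F lborel] F2'
          le_less_trans[OF U2[of n] ennreal_less_top] le_less_trans[OF G2[of n] ennreal_less_top]
        by auto
      have close: "AE x in lborel. ennreal_absdiff ((U n x)\<^sup>2) ((G n x)\<^sup>2) \<le> (F x)\<^sup>2 + E x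
          \<and> (F x)\<^sup>2 \<le> ennreal_absdiff ((U n x)\<^sup>2) ((G n x)\<^sup>2) + E x"
        using fin
      proof eventually_elim
        case (elim x)
        have "U n x + G n x + F x < \<infinity>" using elim by simp
        then have "H n x < \<infinity>" using Hle[of n x] by (rule le_less_trans[rotated])
        from ennreal_absdiff_squares[OF elim(1,2,3) this \<delta> up lo] show ?case by (simp add: E_def)
      qed
      have [measurable]: "(\<lambda>x. ennreal_absdiff ((U n x)\<^sup>2) ((G n x)\<^sup>2)) \<in> borel_measurable borel"
        unfolding ennreal_absdiff_def by measurable
      have "L n \<le> (\<integral>\<^sup>+ x. (F x)\<^sup>2 + E x \<partial>lborel)"
        unfolding L_def by (rule nn_integral_mono_AE) (use close in eventually_elim, auto)
      also have "\<dots> = J + (\<integral>\<^sup>+ x. E x \<partial>lborel)" unfolding J_def by (rule nn_integral_add) auto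
      finally have 1: "L n - J \<le> (\<integral>\<^sup>+ x. E x \<partial>lborel)" using F2' by (auto simp: ennreal_minus_le_iff J_def)
      have "J \<le> (\<integral>\<^sup>+ x. ennreal_absdiff ((U n x)\<^sup>2) ((G n x)\<^sup>2) + E x \<partial>lborel)"
        unfolding J_def by (rule nn_integral_mono_AE) (use close in eventually_elim, auto)
      also have "\<dots> = L n + (\<integral>\<^sup>+ x. E x \<partial>lborel)" unfolding L_def by (rule nn_integral_add) auto
      finally have 2: "J - L n \<le> (\<integral>\<^sup>+ x. E x \<partial>lborel)" using F2' by (auto simp: ennreal_minus_le_iff J_def)
      have "x n \<le> (\<integral>\<^sup>+ x. E x \<partial>lborel) + (\<integral>\<^sup>+ x. E x \<partial>lborel)" unfolding x_def using 1 2 by (rule add_mono)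
      also have "\<dots> \<le> (b n + ennreal (2 * \<delta> * (B1 + B))) + (b n + ennreal (2 * \<delta> * (B1 + B)))"
        by (intro add_mono Eb)
      also have "\<dots> = 2 * b n + (ennreal (2 * \<delta> * (B1 + B)) + ennreal (2 * \<delta> * (B1 + B)))"
        by (simp only: mult_2 add_ac)
      also have "ennreal (2 * \<delta> * (B1 + B)) + ennreal (2 * \<delta> * (B1 + B)) = ennreal (\<delta> * (4 * (B1 + B)))"
        using \<delta> B1 B by (subst ennreal_plus[symmetric]) (auto simp: algebra_simps)
      finally show ?thesis .
    qed
    ultimately show "\<exists>a. a \<longlonglongrightarrow> 0 \<and> (\<forall>n. x n \<le> a n + ennreal (\<delta> * (4 * (B1 + B))))"
      by (intro exI[of _ "\<lambda>n. 2 * b n"]) auto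
  qed
  then have "L \<longlonglongrightarrow> J"
  proof (rule tendsto_ennreal_of_close[rotated])
    show "J < \<infinity>" using F2' by (simp add: J_def)
    fix n
    have "L n \<le> J + (L n - J)" by (rule ennreal_le_add_minus)
    also have "\<dots> \<le> J + x n" unfolding x_def by (intro add_left_mono) simp
    finally show "L n \<le> J + x n" .
    have "J \<le> L n + (J - L n)" by (rule ennreal_le_add_minus)
    also have "\<dots> \<le> L n + x n" unfolding x_def by (intro add_left_mono) simp
    finally show "J \<le> L n + x n" .
  qed
  then show ?thesis unfolding L_def J_def U_def G_def F_def .
qed


section \<open>Borel versions of Lebesgue measurable functions\<close>

lemma locally_integrable_imp_measurable:
  fixes f :: "real ^ 'n \<Rightarrow> 'b :: euclidean_space"
  assumes "locally_integrable f"
  shows "f \<in> borel_measurable lebesgue"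
proof (rule borel_measurable_LIMSEQ_metric)
  fix k :: nat
  have "set_integrable lebesgue (cball 0 (real k)) f" using assms by (simp add: locally_integrable_def)
  then show "(\<lambda>x. indicator (cball 0 (real k)) x *\<^sub>R f x) \<in> borel_measurable lebesgue"
    unfolding set_integrable_def by (rule borel_measurable_integrable)
next
  fix x :: "real ^ 'n"
  obtain k0 where k0: "norm x \<le> real k0" using real_arch_simple by blast
  have "\<forall>\<^sub>F k in sequentially. indicator (cball 0 (real k)) x *\<^sub>R f x = f x"
    using eventually_ge_at_top[of k0]
  proof eventually_elim
    case (elim k)
    then have "norm x \<le> real k" using k0 by simp
    then show ?case by simp
  qed
  then show "(\<lambda>k. indicator (cball 0 (real k)) x *\<^sub>R f x) \<longlonglongrightarrow> f x" by (rule tendsto_eventually)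
qed

lemma borel_version_vec:
  fixes f :: "real ^ 'n \<Rightarrow> real ^ 'n"
  assumes "f \<in> borel_measurable lebesgue"
  obtains g where "g \<in> borel_measurable borel" "AE x in lborel. f x = g x"
proof -
  have "\<exists>h. h \<in> borel_measurable lborel \<and> (AE x in lborel. f x $ i = h x)" for i
  proof -
    have "(\<lambda>x. f x $ i) \<in> borel_measurable lebesgue"
      unfolding cart_eq_inner_axis using assms by (intro borel_measurable_inner) auto
    from completion_ex_borel_measurable_real[OF this] show ?thesis by blast
  qed
  then obtain h where h: "\<And>i. h i \<in> borel_measurable lborel" "\<And>i. AE x in lborel. f x $ i = h i x" by metis
  show thesis
  proof
    show "(\<lambda>x. \<chi> i. h i x) \<in> borel_measurable borel"
    proof (subst borel_measurable_euclidean_space, rule ballI)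
      fix b :: "real ^ 'n" assume "b \<in> Basis"
      then obtain i where "b = axis i 1" by (auto simp: Basis_vec_def)
      then show "(\<lambda>x. (\<chi> i. h i x) \<bullet> b) \<in> borel_measurable borel" using h(1)[of i] by (simp add: inner_axis)
    qed
    have "AE x in lborel. \<forall>i\<in>UNIV. f x $ i = h i x" using h(2) by (intro AE_finite_allI) auto
    then show "AE x in lborel. f x = (\<chi> i. h i x)" by eventually_elim (simp add: vec_eq_iff)
  qed
qed

lemma integral_lebesgue_eq_lborel:
  fixes f g :: "real ^ 'n \<Rightarrow> real"
  assumes "g \<in> borel_measurable borel" "AE x in lborel. f x = g x"
  shows "(\<integral> x. f x \<partial>lebesgue) = (\<integral> x. g x \<partial>lborel)"
    and "integrable lebesgue f \<longleftrightarrow> integrable lborel g"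
proof -
  have AE: "AE x in lebesgue. f x = g x" using assms(2) by (simp add: AE_completion_iff)
  have g: "g \<in> borel_measurable lborel" using assms(1) by simp
  then have g': "g \<in> borel_measurable lebesgue" by (rule measurable_completion)
  have f: "f \<in> borel_measurable lebesgue"
  proof (rule measurableI)
    fix A :: "real set" assume A[measurable]: "A \<in> sets borel"
    have [measurable]: "Measurable.pred lebesgue (\<lambda>x. f x \<noteq> g x \<and> f x \<in> A)" "Measurable.pred lebesgue (\<lambda>x. f x \<noteq> g x \<and> g x \<in> A)"
      by (rule sets_completion_AE, use assms(2) in eventually_elim, simp)+
    have [measurable]: "g \<in> borel_measurable lebesgue" by (rule g')
    have "{x \<in> space lebesgue. (g x \<in> A \<and> \<not> (f x \<noteq> g x \<and> g x \<in> A)) \<or> (f x \<noteq> g x \<and> f x \<in> A)} \<in> sets lebesgue"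
      by measurable
    also have "{x \<in> space lebesgue. (g x \<in> A \<and> \<not> (f x \<noteq> g x \<and> g x \<in> A)) \<or> (f x \<noteq> g x \<and> f x \<in> A)} = f -` A \<inter> space lebesgue"
      by auto
    finally show "f -` A \<inter> space lebesgue \<in> sets lebesgue" .
  qed simp
  show "(\<integral> x. f x \<partial>lebesgue) = (\<integral> x. g x \<partial>lborel)"
    using integral_cong_AE[OF f g' AE] integral_completion[OF g] by simp
  show "integrable lebesgue f \<longleftrightarrow> integrable lborel g"
    using integrable_cong_AE[OF f g' AE] integrable_completion[OF g] by simp
qed

text \<open>
  The Borel versions of a function and of its weak gradient inherit the identities that define the
  weak gradient, since these are blind to null sets.
\<close>

lemma weak_gradient_translation_estimate:
  fixes v v' :: "real ^ 'n \<Rightarrow> real" and G :: "real ^ 'n \<Rightarrow> real ^ 'n"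
  assumes weak: "weak_gradient v G" and v'[measurable]: "v' \<in> borel_measurable borel"
    and AEv: "AE x in lborel. v x = v' x"
    and bdd: "(\<integral>\<^sup>+ x. (ennreal (norm (G x)))\<^sup>2 \<partial>lebesgue) \<le> ennreal C" and C: "C \<ge> 0"
  shows "(\<integral>\<^sup>+ x. ennreal ((v' (x + h) - v' x)\<^sup>2) \<partial>lborel) \<le> ennreal ((norm h)\<^sup>2 * C)"
proof -
  have "G \<in> borel_measurable lebesgue"
    using weak by (intro locally_integrable_imp_measurable) (simp add: weak_gradient_def)
  then obtain G' where G'[measurable]: "G' \<in> borel_measurable borel" and AEG: "AE x in lborel. G x = G' x"
    by (rule borel_version_vec)
  have eq: "(\<integral>\<^sup>+ x. ennreal ((norm (G' x))\<^sup>2) \<partial>lborel) = (\<integral>\<^sup>+ x. (ennreal (norm (G x)))\<^sup>2 \<partial>lebesgue)"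
    unfolding nn_integral_completion
    by (rule nn_integral_cong_AE) (use AEG in eventually_elim, simp add: ennreal_power)
  have fin: "(\<integral>\<^sup>+ x. ennreal ((norm (G' x))\<^sup>2) \<partial>lborel) \<le> ennreal C" using bdd by (simp add: eq)
  have int: "integrable lborel (\<lambda>x. (norm (G' x))\<^sup>2)"
    using le_less_trans[OF fin ennreal_less_top] by (intro integrableI_bounded) auto
  have "ennreal (\<integral> x. (norm (G' x))\<^sup>2 \<partial>lborel) \<le> ennreal C"
    using fin nn_integral_eq_integral[OF int] by simp
  then have le: "(\<integral> x. (norm (G' x))\<^sup>2 \<partial>lborel) \<le> C" using C by (simp add: ennreal_le_iff)
  have "(\<integral>\<^sup>+ x. ennreal ((v' (x + h) - v' x)\<^sup>2) \<partial>lborel) \<le> ennreal ((norm h)\<^sup>2 * (\<integral> x. (norm (G' x))\<^sup>2 \<partial>lborel))"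
  proof (rule nn_integral_translation_difference_le[OF v' G' _ _ int])
    fix K :: "(real ^ 'n) set" assume K: "compact K"
    then have [measurable]: "K \<in> sets borel" by (simp add: borel_compact)
    have int: "integrable lebesgue (\<lambda>x. indicator K x *\<^sub>R v x)"
      using weak K by (simp add: weak_gradient_def locally_integrable_def set_integrable_def)
    have ae: "AE x in lborel. indicator K x *\<^sub>R v x = indicator K x *\<^sub>R v' x"
      using AEv by eventually_elim simp
    have m: "(\<lambda>x. indicator K x *\<^sub>R v' x) \<in> borel_measurable borel" by measurable
    show "set_integrable lborel K v'"
      unfolding set_integrable_def integral_lebesgue_eq_lborel(2)[OF m ae, symmetric] by (rule int)
  next
    fix \<phi> :: "real ^ 'n \<Rightarrow> real" and i :: 'n assume \<phi>: "test_function \<phi>"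
    have [measurable]: "\<phi> \<in> borel_measurable borel"
      by (rule borel_measurable_continuous_onI[OF continuous_on_test_function[OF \<phi>]])
    have [measurable]: "partial_deriv i \<phi> \<in> borel_measurable borel"
      by (rule borel_measurable_continuous_onI[OF continuous_on_partial_deriv_test_function[OF \<phi>]])
    have [measurable]: "(\<lambda>x. G' x $ i) \<in> borel_measurable borel" unfolding cart_eq_inner_axis by measurable
    have "(\<integral> x. v x * partial_deriv i \<phi> x \<partial>lebesgue) = (\<integral> x. v' x * partial_deriv i \<phi> x \<partial>lborel)"
    proof (rule integral_lebesgue_eq_lborel(1))
      show "AE x in lborel. v x * partial_deriv i \<phi> x = v' x * partial_deriv i \<phi> x"
        using AEv by eventually_elim simp
    qed measurable
    moreover have "(\<integral> x. G x $ i * \<phi> x \<partial>lebesgue) = (\<integral> x. G' x $ i * \<phi> x \<partial>lborel)"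
    proof (rule integral_lebesgue_eq_lborel(1))
      show "AE x in lborel. G x $ i * \<phi> x = G' x $ i * \<phi> x"
        using AEG by eventually_elim simp
    qed measurable
    ultimately show "(\<integral> x. v' x * partial_deriv i \<phi> x \<partial>lborel) = - (\<integral> x. G' x $ i * \<phi> x \<partial>lborel)"
      using weak \<phi> by (simp add: weak_gradient_def)
  qed
  also have "\<dots> \<le> ennreal ((norm h)\<^sup>2 * C)" by (intro ennreal_leI mult_left_mono le) simp
  finally show ?thesis .
qed

lemma riesz_potential_cong_AE:
  assumes "AE y in lborel. f y = g y"
  shows "riesz_potential \<beta> f = riesz_potential \<beta> g"
  unfolding riesz_potential_lborel[abs_def]
  by (rule ext, rule nn_integral_cong_AE) (use assms in eventually_elim, simp)

theorem proposition4p8: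
  fixes \<alpha> p :: real
    and u :: "nat \<Rightarrow> real ^ 'n \<Rightarrow> real"
    and u_lim :: "real ^ 'n \<Rightarrow> real"
    and Du :: "nat \<Rightarrow> real ^ 'n \<Rightarrow> real ^ 'n"
  assumes "0 < \<alpha>" and "\<alpha> < real CARD('n)"
    and "1 \<le> p"
    and "1 / p > 1 / 2 - 1 / \<alpha>"
    and "\<And>n. u n \<in> borel_measurable lebesgue"
    and "AE x in lebesgue. (\<lambda>n. u n x) \<longlonglongrightarrow> u_lim x"
    and "bounded_in_L2 (\<lambda>n. riesz_potential (\<alpha> / 2) (\<lambda>y. \<bar>u n y\<bar> powr p))"
    and "\<And>n. weak_gradient (u n) (Du n)"
    and "bounded_in_L2 (\<lambda>n x. ennreal (norm (Du n x)))"
  shows "(\<lambda>n. \<integral>\<^sup>+ x. ennreal_absdiff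
              ((riesz_potential (\<alpha> / 2) (\<lambda>y. \<bar>u n y\<bar> powr p) x)\<^sup>2)
              ((riesz_potential (\<alpha> / 2) (\<lambda>y. \<bar>u n y - u_lim y\<bar> powr p) x)\<^sup>2) \<partial>lebesgue)
         \<longlonglongrightarrow> (\<integral>\<^sup>+ x. (riesz_potential (\<alpha> / 2) (\<lambda>y. \<bar>u_lim y\<bar> powr p) x)\<^sup>2 \<partial>lebesgue)"
proof -
  define \<beta> where "\<beta> = \<alpha> / 2"
  have \<beta>: "0 < \<beta>" "\<beta> < real CARD('n)" using assms(1,2) by (auto simp: \<beta>_def)
  have sub: "1 / p > 1 / 2 - 1 / (2 * \<beta>)" using assms(4) by (simp add: \<beta>_def)
  have "\<exists>v. v \<in> borel_measurable lborel \<and> (AE x in lborel. u n x = v x)" for n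
    using completion_ex_borel_measurable_real[OF assms(5)[of n]] by blast
  then obtain v where "\<And>n. v n \<in> borel_measurable lborel" and uv: "\<And>n. AE x in lborel. u n x = v n x"
    by metis
  then have v[measurable]: "\<And>n. v n \<in> borel_measurable borel" by simp
  have all_uv: "AE x in lborel. \<forall>n. u n x = v n x" using uv by (simp add: AE_all_countable)
  (* Borel version of the limit; lim is an arbitrary value on the null set of divergence *)
  define w where "w x = lim (\<lambda>n. v n x)" for x
  have w[measurable]: "w \<in> borel_measurable borel" unfolding w_def by measurable
  have u_lim: "AE x in lborel. (\<lambda>n. u n x) \<longlonglongrightarrow> u_lim x"
    using assms(6) by (simp add: AE_completion_iff)
  have lim: "AE x in lborel. (\<lambda>n. v n x) \<longlonglongrightarrow> u_lim x"
    using u_lim all_uv by eventually_elim simp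
  have w_eq: "AE x in lborel. u_lim x = w x"
    using lim by eventually_elim (simp add: w_def limI)
  have vw: "AE x in lborel. (\<lambda>n. v n x) \<longlonglongrightarrow> w x"
    using lim w_eq by eventually_elim simp
  have pot_u: "riesz_potential \<beta> (\<lambda>y. \<bar>u n y\<bar> powr p) = riesz_potential \<beta> (\<lambda>y. \<bar>v n y\<bar> powr p)" for n
    by (rule riesz_potential_cong_AE) (use uv[of n] in eventually_elim, simp)
  have pot_w: "riesz_potential \<beta> (\<lambda>y. \<bar>u_lim y\<bar> powr p) = riesz_potential \<beta> (\<lambda>y. \<bar>w y\<bar> powr p)"
    by (rule riesz_potential_cong_AE) (use w_eq in eventually_elim, simp)
  have pot_d: "riesz_potential \<beta> (\<lambda>y. \<bar>u n y - u_lim y\<bar> powr p) = riesz_potential \<beta> (\<lambda>y. \<bar>v n y - w y\<bar> powr p)" for n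
  proof (rule riesz_potential_cong_AE)
    show "AE y in lborel. \<bar>u n y - u_lim y\<bar> powr p = \<bar>v n y - w y\<bar> powr p"
      using uv[of n] w_eq by eventually_elim simp
  qed
  obtain C1 :: real where "\<And>n. (\<integral>\<^sup>+ x. (riesz_potential \<beta> (\<lambda>y. \<bar>u n y\<bar> powr p) x)\<^sup>2 \<partial>lebesgue) \<le> ennreal C1"
    using assms(7) unfolding bounded_in_L2_def \<beta>_def by blast
  then have energy: "(\<integral>\<^sup>+ x. (riesz_potential \<beta> (\<lambda>y. \<bar>v n y\<bar> powr p) x)\<^sup>2 \<partial>lborel) \<le> ennreal (max C1 0)" for n
    unfolding pot_u nn_integral_completion by (rule order_trans) (simp add: ennreal_leI)
  obtain C2 :: real where "\<And>n. (\<integral>\<^sup>+ x. (ennreal (norm (Du n x)))\<^sup>2 \<partial>lebesgue) \<le> ennreal C2"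
    using assms(9) unfolding bounded_in_L2_def by blast
  then have Du: "(\<integral>\<^sup>+ x. (ennreal (norm (Du n x)))\<^sup>2 \<partial>lebesgue) \<le> ennreal (max C2 0)" for n
    by (rule order_trans) (simp add: ennreal_leI)
  have tr: "(\<integral>\<^sup>+ x. ennreal ((v n (x + h) - v n x)\<^sup>2) \<partial>lborel) \<le> ennreal ((norm h)\<^sup>2 * max C2 0)" for n h
    by (rule weak_gradient_translation_estimate[OF assms(8) v uv Du]) simp
  from brezis_lieb_riesz_energy[OF \<beta> assms(3) sub v w vw energy _ tr]
  show ?thesis unfolding \<beta>_def[symmetric] pot_u pot_w pot_d nn_integral_completion by simp
qed

end
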